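(* Let $G$ be an amenable, locally compact, separable group acting continuously, by $\mu$-preserving homeomorphisms, on a compact metric space $X$ equipped with a Borel probability measure $\mu$, such that the action is uniquely ergodic for $\mu$ and non-sensitive on $\operatorname{supp}\mu$. Let $\Phi_1,\Phi_2,\ldots$ be a sequence in $G$ that generates a dense semigroup in $G$. Let $Y=\widetilde{\mathbb{N}}^{\mathbb{Z}}$, $\lambda$, $T$ and the skew product $\Psi:X\times Y\to X\times Y$, $\Psi(x,r)=(\Phi_{r_1}(x),T(r))$, be as defined in the context. If $\tau$ is a Borel probability measure on $X\times Y$, invariant for $\Psi$, such that the projection of $\tau$ on $Y$ equals $\lambda$, then $\tau$ coincides with $\mu\times\lambda$.
   Context: Elements of $G$ are identified in notation with the homeomorphisms of $X$ by which they act, the product in $G$ acting as composition. The action is uniquely ergodic for $\mu$ if $\mu$ is the only $G$-invariant Borel probability measure on $X$. A continuous action of $G$ on a compact metric space $(X,\upsilon)$ is called sensitive on $X'\subset X$ if there exists $\beta>0$ such that for every $x\in X'$ and $\delta>0$ there exist $y\in X$ with $\upsilon(x,y)<\delta$ and $h\in G$ with $\upsilon(h(x),h(y))\ge\beta$; otherwise it is called non-sensitive on $X'$. Let $(p_n)_{n\ge1}$ be a probability sequence with $p_n>0$ for all $n$ and $\sum_n p_n=1$. Let $\widetilde{\mathbb{N}}=\mathbb{N}\cup\{\infty\}$ be the one-point compactification of the discrete space $\mathbb{N}=\{1,2,\ldots\}$, with the probability measure $m$ given by $m(\{n\})=p_n$ for $n\in\mathbb{N}$ and $m(\{\infty\})=0$.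 Let $Y:=\widetilde{\mathbb{N}}^{\mathbb{Z}}$ with product measure $\lambda:=\prod_{-\infty}^{+\infty}m$, and let $T:Y\to Y$ be the two-sided Bernoulli shift $T(\{x_n\})=\{y_n\}$, $y_n=x_{n+1}$ for $n\in\mathbb{Z}$. For $r=(\ldots,r_{-1},r_0,r_1,\ldots)\in Y$, $r_1$ is the coordinate of index $1$, and by convention $\Phi_\infty:=\mathrm{Id}_X$. The map $\Psi(x,r):=(\Phi_{r_1}(x),T(r))$ is Borel measurable and preserves $\mu\times\lambda$. *)

theory Defs
  imports "HOL-Probability.Probability" "HOL-Algebra.Group_Action"
begin

section \<open>Borel sets of an abstract topology\<close>

definition borel_of :: "'a topology \<Rightarrow> 'a measure" where
  "borel_of T = sigma (topspace T) {U. openin T U}"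


section \<open>Locally compact groups and amenability\<close>

definition topological_group :: "('g, 'm) monoid_scheme \<Rightarrow> 'g topology \<Rightarrow> bool" where
  "topological_group G T \<longleftrightarrow>
     group G \<and> topspace T = carrier G \<and>
     continuous_map (prod_topology T T) T (\<lambda>(g, h). g \<otimes>\<^bsub>G\<^esub> h) \<and>
     continuous_map T T (\<lambda>g. inv\<^bsub>G\<^esub> g)"

text \<open>As usual, locally compact groups are understood to be Hausdorff.\<close>

definition locally_compact_group :: "('g, 'm) monoid_scheme \<Rightarrow> 'g topology \<Rightarrow> bool" where
  "locally_compact_group G T \<longleftrightarrow>
     topological_group G T \<and> Hausdorff_space T \<and> locally_compact_space T"

definition left_haar_measure ::
    "('g, 'm) monoid_scheme \<Rightarrow> 'g topology \<Rightarrow> 'g measure \<Rightarrow> bool" where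
  "left_haar_measure G T H \<longleftrightarrow>
     sets H = sets (borel_of T) \<and>
     emeasure H (carrier G) \<noteq> 0 \<and>
     (\<forall>K. compactin T K \<longrightarrow> emeasure H K < \<infinity>) \<and>
     (\<forall>A\<in>sets H. emeasure H A = (INF U\<in>{U. openin T U \<and> A \<subseteq> U}. emeasure H U)) \<and>
     (\<forall>U. openin T U \<longrightarrow> emeasure H U = (SUP K\<in>{K. compactin T K \<and> K \<subseteq> U}. emeasure H K)) \<and>
     (\<forall>g\<in>carrier G. \<forall>A\<in>sets H. emeasure H (g <#\<^bsub>G\<^esub> A) = emeasure H A)"

text \<open>
  Essentially bounded measurable functions, before passing to classes modulo null functions.
  Values outside the space of the measure play no role.
\<close>

definition ess_bounded :: "'a measure \<Rightarrow> ('a \<Rightarrow> real) set" where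
  "ess_bounded H = {f \<in> borel_measurable H. \<exists>C. AE x in H. \<bar>f x\<bar> \<le> C}"

text \<open>
  A left-invariant mean on the space of essentially bounded functions. The functional is defined
  on representatives; linearity together with positivity up to null sets makes it well defined on
  classes modulo null functions.
\<close>

definition left_invariant_mean ::
    "('g, 'm) monoid_scheme \<Rightarrow> 'g measure \<Rightarrow> (('g \<Rightarrow> real) \<Rightarrow> real) \<Rightarrow> bool" where
  "left_invariant_mean G H L \<longleftrightarrow>
     (\<forall>f\<in>ess_bounded H. \<forall>h\<in>ess_bounded H. L (\<lambda>x. f x + h x) = L f + L h) \<and>
     (\<forall>c. \<forall>f\<in>ess_bounded H. L (\<lambda>x. c * f x) = c * L f) \<and>
     (\<forall>f\<in>ess_bounded H. (AE x in H. 0 \<le> f x) \<longrightarrow> 0 \<le> L f) \<and>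
     L (\<lambda>x. 1) = 1 \<and>
     (\<forall>g\<in>carrier G. \<forall>f\<in>ess_bounded H. L (\<lambda>x. f (g \<otimes>\<^bsub>G\<^esub> x)) = L f)"

text \<open>
  Amenability of a locally compact group. Haar measure exists and is unique up to a positive
  factor, so it does not matter which left Haar measure is used.
\<close>

definition amenable :: "('g, 'm) monoid_scheme \<Rightarrow> 'g topology \<Rightarrow> bool" where
  "amenable G T \<longleftrightarrow> (\<exists>H L. left_haar_measure G T H \<and> left_invariant_mean G H L)"

text \<open>The subsemigroup generated by a set: all products of one or more elements of the set.\<close>

inductive_set semigroup_generate :: "('g, 'm) monoid_scheme \<Rightarrow> 'g set \<Rightarrow> 'g set"
  for G and S where
    incl: "g \<in> S \<Longrightarrow> g \<in> semigroup_generate G S"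
  | mult: "g \<in> semigroup_generate G S \<Longrightarrow> h \<in> semigroup_generate G S
           \<Longrightarrow> g \<otimes>\<^bsub>G\<^esub> h \<in> semigroup_generate G S"


section \<open>Continuous actions\<close>

text \<open>
  The group action itself is the homomorphism into the group of bijections given by
  \<^locale>\<open>group_action\<close>; continuity is joint in the group element and the point, so every group
  element acts as a homeomorphism.
\<close>

definition continuous_group_action ::
    "('g, 'm) monoid_scheme \<Rightarrow> 'g topology \<Rightarrow> ('g \<Rightarrow> 'x::topological_space \<Rightarrow> 'x) \<Rightarrow> bool" where
  "continuous_group_action G T \<phi> \<longleftrightarrow>
     group_action G UNIV \<phi> \<and>
     continuous_map (prod_topology T euclidean) euclidean (\<lambda>(g, x). \<phi> g x)"

definition invariant_measure ::
    "('g, 'm) monoid_scheme \<Rightarrow> ('g \<Rightarrow> 'x \<Rightarrow> 'x) \<Rightarrow> 'x measure \<Rightarrow> bool" where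
  "invariant_measure G \<phi> M \<longleftrightarrow> (\<forall>g\<in>carrier G. distr M M (\<phi> g) = M)"

definition uniquely_ergodic_for ::
    "('g, 'm) monoid_scheme \<Rightarrow> ('g \<Rightarrow> 'x::topological_space \<Rightarrow> 'x) \<Rightarrow> 'x measure \<Rightarrow> bool" where
  "uniquely_ergodic_for G \<phi> \<mu> \<longleftrightarrow>
     (\<forall>\<nu>. (prob_space \<nu> \<and> sets \<nu> = sets borel \<and> invariant_measure G \<phi> \<nu>) \<longleftrightarrow> \<nu> = \<mu>)"

definition measure_support :: "'x::topological_space measure \<Rightarrow> 'x set" where
  "measure_support M = {x. \<forall>U. open U \<and> x \<in> U \<longrightarrow> emeasure M U > 0}"

definition sensitive_on ::
    "('g, 'm) monoid_scheme \<Rightarrow> ('g \<Rightarrow> 'x::metric_space \<Rightarrow> 'x) \<Rightarrow> 'x set \<Rightarrow> bool" where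
  "sensitive_on G \<phi> X' \<longleftrightarrow>
     (\<exists>\<beta>>0. \<forall>x\<in>X'. \<forall>\<delta>>0. \<exists>y. dist x y < \<delta> \<and> (\<exists>h\<in>carrier G. \<beta> \<le> dist (\<phi> h x) (\<phi> h y)))"


section \<open>The Bernoulli shift and the skew product\<close>

text \<open>
  The one-point compactification of the positive integers: the integer \<open>n \<ge> 1\<close> is \<open>Some n\<close> and the
  point at infinity is \<open>None\<close>.
\<close>

definition Ntilde :: "nat option topology" where
  "Ntilde = Alexandroff_compactification (discrete_topology {1..})"

definition symbol_measure :: "(nat \<Rightarrow> real) \<Rightarrow> nat option measure" where
  "symbol_measure p =
     point_measure (topspace Ntilde) (\<lambda>s. case s of None \<Rightarrow> 0 | Some n \<Rightarrow> ennreal (p n))"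

definition Y_top :: "(int \<Rightarrow> nat option) topology" where
  "Y_top = product_topology (\<lambda>_. Ntilde) UNIV"

definition bernoulli_measure :: "(nat \<Rightarrow> real) \<Rightarrow> (int \<Rightarrow> nat option) measure" where
  "bernoulli_measure p = PiM UNIV (\<lambda>_. symbol_measure p)"

definition shift :: "(int \<Rightarrow> 'a) \<Rightarrow> int \<Rightarrow> 'a" where
  "shift r = (\<lambda>n. r (n + 1))"

definition skew_product ::
    "('g \<Rightarrow> 'x \<Rightarrow> 'x) \<Rightarrow> (nat \<Rightarrow> 'g) \<Rightarrow> 'x \<times> (int \<Rightarrow> nat option) \<Rightarrow> 'x \<times> (int \<Rightarrow> nat option)" where
  "skew_product \<phi> \<Phi> = (\<lambda>(x, r). (case r 1 of None \<Rightarrow> x | Some n \<Rightarrow> \<phi> (\<Phi> n) x, shift r))"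


section \<open>The product sigma-algebras are the Borel sigma-algebras\<close>

lemma space_borel_of [simp]: "space (borel_of T) = topspace T"
  unfolding borel_of_def by (rule space_measure_of) (auto dest: openin_subset)

lemma sets_borel_of: "sets (borel_of T) = sigma_sets (topspace T) {U. openin T U}"
  unfolding borel_of_def by (rule sets_measure_of) (auto dest: openin_subset)

lemma topspace_Ntilde [simp]: "topspace Ntilde = insert None (Some ` {1..})"
  by (simp add: Ntilde_def)

lemma openin_Ntilde_Some: "n \<ge> 1 \<Longrightarrow> openin Ntilde {Some n}"
  using openin_Alexandroff_compactification_image_Some[of "discrete_topology {1..}" "{n}"]
  by (simp add: Ntilde_def)

lemma sets_symbol_measure [simp]: "sets (symbol_measure p) = Pow (topspace Ntilde)"
  by (simp add: symbol_measure_def sets_point_measure)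

lemma space_symbol_measure [simp]: "space (symbol_measure p) = topspace Ntilde"
  by (simp add: symbol_measure_def space_point_measure)

lemma sets_symbol_measure_borel: "sets (symbol_measure p) = sets (borel_of Ntilde)"
proof -
  interpret sigma_algebra "topspace Ntilde" "sets (borel_of Ntilde)"
    using sets.sigma_algebra_axioms[of "borel_of Ntilde"] by simp
  have *: "Some ` S \<in> sets (borel_of Ntilde)" if "S \<subseteq> {1..}" for S
  proof -
    have "openin Ntilde (Some ` S)"
      using that by (simp add: Ntilde_def)
    then show ?thesis by (simp add: sets_borel_of)
  qed
  have "topspace Ntilde - Some ` {1..} \<in> sets (borel_of Ntilde)"
    by (rule compl_sets) (rule *, simp)
  then have N: "{None} \<in> sets (borel_of Ntilde)"
    by (simp add: insert_Diff_if)
  have "A \<in> sets (borel_of Ntilde)" if "A \<subseteq> topspace Ntilde" for A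
  proof -
    have "A = Some ` {n. Some n \<in> A} \<union> (A \<inter> {None})"
    proof (rule Set.set_eqI)
      fix s show "s \<in> A \<longleftrightarrow> s \<in> Some ` {n. Some n \<in> A} \<union> (A \<inter> {None})"
        by (cases s) auto
    qed
    moreover have "Some ` {n. Some n \<in> A} \<in> sets (borel_of Ntilde)"
      using that by (intro *) auto
    moreover have "A \<inter> {None} \<in> sets (borel_of Ntilde)"
      using N by (cases "None \<in> A") auto
    ultimately show ?thesis by (metis Un)
  qed
  moreover have "A \<subseteq> topspace Ntilde" if "A \<in> sets (borel_of Ntilde)" for A
    using sets.sets_into_space[OF that] by simp
  ultimately show ?thesis by auto
qed

lemma Ntilde_countable_base:
  obtains B where "countable B" "\<And>V. V \<in> B \<Longrightarrow> openin Ntilde V"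
    "\<And>U x. openin Ntilde U \<Longrightarrow> x \<in> U \<Longrightarrow> \<exists>V\<in>B. x \<in> V \<and> V \<subseteq> U"
proof -
  define B where "B = (\<lambda>n. {Some n}) ` {1::nat..} \<union> (\<lambda>F. topspace Ntilde - Some ` F) ` {F. finite F \<and> F \<subseteq> {1::nat..}}"
  have 1: "countable B"
    unfolding B_def by (intro countable_Un countable_image countable_Collect_finite_subset) simp_all
  have 2: "openin Ntilde V" if "V \<in> B" for V
  proof -
    have "openin Ntilde (topspace Ntilde - Some ` F)" if "finite F" "F \<subseteq> {1..}" for F
      unfolding Ntilde_def openin_Alexandroff_compactification
      using that by (intro disjI2 exI[of _ F]) (auto simp: compactin_discrete_topology)
    then show ?thesis using that openin_Ntilde_Some by (auto simp: B_def)
  qed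
  have 3: "\<exists>V\<in>B. x \<in> V \<and> V \<subseteq> U" if U: "openin Ntilde U" "x \<in> U" for U x
  proof (cases x)
    case (Some n)
    then have "{Some n} \<in> B" using U openin_subset[OF U(1)] by (auto simp: B_def)
    then show ?thesis using Some U by blast
  next
    case None
    from U(1) consider S where "U = Some ` S"
      | C where "compactin (discrete_topology {1..}) C" "U = insert None (Some ` ({1..} - C))"
      unfolding Ntilde_def openin_Alexandroff_compactification by auto
    then show ?thesis
    proof cases
      case 1 then show ?thesis using None U by auto
    next
      case 2
      then have "finite C" "C \<subseteq> {1..}" by (auto simp: compactin_discrete_topology)
      moreover have "U = topspace Ntilde - Some ` C" using 2 by auto
      ultimately have "U \<in> B" unfolding B_def by blast
      then show ?thesis using U by blast
    qed
  qed
  show thesis by (rule that[OF 1 2 3])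
qed

lemma space_bernoulli_measure [simp]: "space (bernoulli_measure p) = topspace Y_top"
  by (simp add: bernoulli_measure_def Y_top_def space_PiM)

lemma Y_top_countable_base:
  obtains B where "countable B" "\<And>V. V \<in> B \<Longrightarrow> openin Y_top V \<and> V \<in> sets (bernoulli_measure p)"
    "\<And>U x. openin Y_top U \<Longrightarrow> x \<in> U \<Longrightarrow> \<exists>V\<in>B. x \<in> V \<and> V \<subseteq> U"
proof -
  obtain C where C: "countable C" "\<And>V. V \<in> C \<Longrightarrow> openin Ntilde V"
    "\<And>U x. openin Ntilde U \<Longrightarrow> x \<in> U \<Longrightarrow> \<exists>V\<in>C. x \<in> V \<and> V \<subseteq> U"
    using Ntilde_countable_base by metis
  define cyl where "cyl F = {r \<in> topspace Y_top. \<forall>(i, V)\<in>F. r i \<in> V}" for F :: "(int \<times> nat option set) set"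
  define B where "B = cyl ` {F. finite F \<and> F \<subseteq> UNIV \<times> C}"
  have 1: "countable B"
    unfolding B_def using C(1) by (intro countable_image countable_Collect_finite_subset) auto
  have cyl1: "{r \<in> topspace Y_top. r i \<in> V} \<in> sets (bernoulli_measure p)"
    and cyl2: "openin Y_top {r \<in> topspace Y_top. r i \<in> V}" if "V \<in> C" for i V
  proof -
    have "V \<in> sets (symbol_measure p)" using openin_subset[OF C(2)[OF that]] by simp
    then have "{r \<in> space (bernoulli_measure p). r i \<in> V} \<in> sets (bernoulli_measure p)"
      unfolding bernoulli_measure_def by measurable
    then show "{r \<in> topspace Y_top. r i \<in> V} \<in> sets (bernoulli_measure p)" by simp
    show "openin Y_top {r \<in> topspace Y_top. r i \<in> V}"
      unfolding Y_top_def
      by (rule openin_continuous_map_preimage[of _ Ntilde])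
         (auto intro: continuous_map_product_projection C(2)[OF that])
  qed
  have 2: "openin Y_top (cyl F) \<and> cyl F \<in> sets (bernoulli_measure p)"
    if "finite F" "F \<subseteq> UNIV \<times> C" for F
    using that
  proof (induction F)
    case empty
    have "cyl {} = topspace Y_top" by (simp add: cyl_def)
    then show ?case using sets.top[of "bernoulli_measure p"] by simp
  next
    case (insert a F)
    obtain i V where a: "a = (i, V)" "V \<in> C" using insert.prems by auto
    have "cyl (insert a F) = cyl F \<inter> {r \<in> topspace Y_top. r i \<in> V}"
      by (auto simp: cyl_def a)
    then show ?case using insert cyl1[OF a(2)] cyl2[OF a(2)] by (auto intro: openin_Int)
  qed
  have 3: "\<exists>V\<in>B. x \<in> V \<and> V \<subseteq> U" if U: "openin Y_top U" "x \<in> U" for U x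
  proof -
    obtain W where W: "finite {i. W i \<noteq> topspace Ntilde}" "\<And>i. openin Ntilde (W i)"
      "x \<in> PiE UNIV W" "PiE UNIV W \<subseteq> U"
      using U unfolding Y_top_def openin_product_topology_alt by auto
    have "\<exists>V\<in>C. x i \<in> V \<and> V \<subseteq> W i" for i
      using W by (intro C(3)) auto
    then obtain V where V: "\<And>i. V i \<in> C" "\<And>i. x i \<in> V i" "\<And>i. V i \<subseteq> W i" by metis
    let ?F = "(\<lambda>i. (i, V i)) ` {i. W i \<noteq> topspace Ntilde}"
    have "x \<in> topspace Y_top" using U openin_subset by blast
    then have "x \<in> cyl ?F" using V by (auto simp: cyl_def)
    moreover have "cyl ?F \<subseteq> PiE UNIV W"
    proof
      fix r assume r: "r \<in> cyl ?F"
      have "r i \<in> W i" for i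
      proof (cases "W i = topspace Ntilde")
        case True
        have "r \<in> topspace Y_top" using r by (simp add: cyl_def)
        then show ?thesis using True by (simp add: Y_top_def PiE_iff)
      next
        case False
        then show ?thesis using r V(3)[of i] by (auto simp: cyl_def)
      qed
      then show "r \<in> PiE UNIV W" by auto
    qed
    moreover have "cyl ?F \<in> B"
    proof -
      have "cyl ?F \<in> cyl ` {F. finite F \<and> F \<subseteq> UNIV \<times> C}"
        by (rule imageI) (use W(1) V(1) in auto)
      then show ?thesis by (simp only: B_def)
    qed
    ultimately show ?thesis using W(4) by (intro bexI[of _ "cyl ?F"]) auto
  qed
  have 4: "openin Y_top V \<and> V \<in> sets (bernoulli_measure p)" if "V \<in> B" for V
    using that 2 unfolding B_def by blast
  show thesis by (rule that[OF 1 4 3])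
qed

lemma sets_bernoulli_measure: "sets (bernoulli_measure p) = sets (borel_of Y_top)"
proof (rule antisym)
  obtain B where B: "countable B" "\<And>V. V \<in> B \<Longrightarrow> openin Y_top V \<and> V \<in> sets (bernoulli_measure p)"
    "\<And>U x. openin Y_top U \<Longrightarrow> x \<in> U \<Longrightarrow> \<exists>V\<in>B. x \<in> V \<and> V \<subseteq> U"
    using Y_top_countable_base by metis
  have "U \<in> sets (bernoulli_measure p)" if "openin Y_top U" for U
  proof -
    have "U = \<Union>{V \<in> B. V \<subseteq> U}" using B(3)[OF that] by blast
    moreover have "\<Union>{V \<in> B. V \<subseteq> U} \<in> sets (bernoulli_measure p)"
      using B by (intro sets.countable_Union) auto
    ultimately show ?thesis by simp
  qed
  then show "sets (borel_of Y_top) \<subseteq> sets (bernoulli_measure p)"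
    unfolding sets_borel_of
    using sets.sigma_sets_subset[of "{U. openin Y_top U}" "bernoulli_measure p"] by auto
  have *: "(\<lambda>r. r i) \<in> borel_of Y_top \<rightarrow>\<^sub>M symbol_measure p" for i
  proof -
    have "(\<lambda>r. r i) \<in> borel_of Y_top \<rightarrow>\<^sub>M borel_of Ntilde"
      unfolding borel_of_def[of Ntilde]
    proof (rule measurable_measure_of)
      show "{U. openin Ntilde U} \<subseteq> Pow (topspace Ntilde)" using openin_subset by blast
      show "(\<lambda>r. r i) \<in> space (borel_of Y_top) \<rightarrow> topspace Ntilde" by (auto simp: Y_top_def PiE_def Pi_def)
      fix V assume "V \<in> {U. openin Ntilde U}"
      then have "openin Y_top {r \<in> topspace Y_top. r i \<in> V}"
        unfolding Y_top_def
        by (intro openin_continuous_map_preimage[of _ Ntilde])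
           (auto intro: continuous_map_product_projection)
      moreover have "(\<lambda>r. r i) -` V \<inter> space (borel_of Y_top) = {r \<in> topspace Y_top. r i \<in> V}"
        by auto
      ultimately show "(\<lambda>r. r i) -` V \<inter> space (borel_of Y_top) \<in> sets (borel_of Y_top)"
        by (auto simp: sets_borel_of)
    qed
    then show ?thesis
      using measurable_cong_sets[OF refl sets_symbol_measure_borel] by blast
  qed
  have "(\<lambda>r. r) \<in> borel_of Y_top \<rightarrow>\<^sub>M bernoulli_measure p"
    unfolding bernoulli_measure_def
    by (rule measurable_PiM_single') (use * in \<open>auto simp: Y_top_def\<close>)
  then show "sets (bernoulli_measure p) \<subseteq> sets (borel_of Y_top)"
  proof (intro subsetI)
    fix A assume id: "(\<lambda>r. r) \<in> borel_of Y_top \<rightarrow>\<^sub>M bernoulli_measure p"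
      and A: "A \<in> sets (bernoulli_measure p)"
    have "(\<lambda>r. r) -` A \<inter> space (borel_of Y_top) = A"
      using sets.sets_into_space[OF A] by auto
    then show "A \<in> sets (borel_of Y_top)" using measurable_sets[OF id A] by simp
  qed
qed

lemma compact_metric_countable_base:
  assumes "compact (UNIV :: 'x::metric_space set)"
  obtains B :: "'x::metric_space set set" where "countable B" "\<And>V. V \<in> B \<Longrightarrow> open V"
    "\<And>U x. open U \<Longrightarrow> x \<in> U \<Longrightarrow> \<exists>V\<in>B. x \<in> V \<and> V \<subseteq> U"
proof -
  have "\<exists>K. finite K \<and> (UNIV :: 'x set) \<subseteq> (\<Union>x\<in>K. ball x (1 / real (Suc n)))" for n
    using compact_eq_totally_bounded[of "UNIV :: 'x set"] assms by auto
  then obtain K where K: "\<And>n. finite (K n)" "\<And>n. (UNIV :: 'x set) \<subseteq> (\<Union>x\<in>K n. ball x (1 / real (Suc n)))"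
    by metis
  let ?B = "\<Union>n. (\<lambda>x. ball x (1 / real (Suc n))) ` K n"
  have 1: "countable ?B" using K(1) by (auto intro: countable_finite)
  have 2: "open V" if "V \<in> ?B" for V using that by auto
  have 3: "\<exists>V\<in>?B. x \<in> V \<and> V \<subseteq> U" if U: "open U" "x \<in> U" for U x
  proof -
    obtain e where e: "e > 0" "ball x e \<subseteq> U" using U openE by blast
    obtain n where n: "1 / real (Suc n) < e / 2" using nat_approx_posE[of "e / 2"] e by auto
    have "x \<in> (\<Union>y\<in>K n. ball y (1 / real (Suc n)))" using K(2)[of n] by blast
    then obtain y where y: "y \<in> K n" "x \<in> ball y (1 / real (Suc n))" by blast
    have "ball y (1 / real (Suc n)) \<subseteq> ball x e"
    proof
      fix z assume "z \<in> ball y (1 / real (Suc n))"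
      then have "dist x z < e"
        using y(2) n dist_triangle[of x z y] by (simp add: dist_commute)
      then show "z \<in> ball x e" by simp
    qed
    then show ?thesis using y e(2) by blast
  qed
  show thesis by (rule that[OF 1 2 3])
qed

lemma sets_pair_bernoulli_measure:
  fixes \<mu> :: "'x::metric_space measure"
  assumes "compact (UNIV :: 'x::metric_space set)" and \<mu>: "sets \<mu> = sets borel"
  shows "sets (\<mu> \<Otimes>\<^sub>M bernoulli_measure p) = sets (borel_of (prod_topology euclidean Y_top))"
    (is "sets ?P = sets (borel_of ?T)")
proof (rule antisym)
  have sp: "space \<mu> = UNIV" using sets_eq_imp_space_eq[OF \<mu>] by simp
  obtain B :: "'x set set" where B: "countable B" "\<And>V. V \<in> B \<Longrightarrow> open V"
    "\<And>U x. open U \<Longrightarrow> x \<in> U \<Longrightarrow> \<exists>V\<in>B. x \<in> V \<and> V \<subseteq> U"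
    using compact_metric_countable_base[OF assms(1)] by metis
  obtain C where C: "countable C" "\<And>V. V \<in> C \<Longrightarrow> openin Y_top V \<and> V \<in> sets (bernoulli_measure p)"
    "\<And>U x. openin Y_top U \<Longrightarrow> x \<in> U \<Longrightarrow> \<exists>V\<in>C. x \<in> V \<and> V \<subseteq> U"
    using Y_top_countable_base by metis
  have "U \<in> sets ?P" if U: "openin ?T U" for U
  proof -
    let ?F = "{(V, W). V \<in> B \<and> W \<in> C \<and> V \<times> W \<subseteq> U}"
    have "countable ?F"
      by (rule countable_subset[of _ "B \<times> C"]) (use B C in auto)
    moreover have "V \<times> W \<in> sets ?P" if "V \<in> B" "W \<in> C" for V W
      using that B(2) C(2) \<mu> by (intro pair_measureI) auto
    ultimately have "(\<Union>(V, W)\<in>?F. V \<times> W) \<in> sets ?P"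
      by (intro sets.countable_UN') auto
    moreover have "U = (\<Union>(V, W)\<in>?F. V \<times> W)"
    proof
      show "U \<subseteq> (\<Union>(V, W)\<in>?F. V \<times> W)"
      proof
        fix z assume z: "z \<in> U"
        obtain x y where xy: "z = (x, y)" by (cases z)
        have "\<exists>V' W'. openin euclidean V' \<and> openin Y_top W' \<and> x \<in> V' \<and> y \<in> W' \<and> V' \<times> W' \<subseteq> U"
          using U z unfolding openin_prod_topology_alt xy by blast
        then obtain V' W' where VW': "open V'" "openin Y_top W'" "x \<in> V'" "y \<in> W'" "V' \<times> W' \<subseteq> U"
          by (metis open_openin)
        obtain V where V: "V \<in> B" "x \<in> V" "V \<subseteq> V'" using B(3) VW' by blast
        obtain W where W: "W \<in> C" "y \<in> W" "W \<subseteq> W'" using C(3) VW' by blast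
        have "V \<times> W \<subseteq> V' \<times> W'" using V(3) W(3) by (rule Sigma_mono)
        then have "(V, W) \<in> ?F" using V(1) W(1) VW'(5) by simp
        then show "z \<in> (\<Union>(V, W)\<in>?F. V \<times> W)"
          by (rule UN_I) (simp add: xy V(2) W(2))
      qed
      show "(\<Union>(V, W)\<in>?F. V \<times> W) \<subseteq> U"
        by (rule UN_least) (simp split: prod.splits)
    qed
    ultimately show ?thesis by simp
  qed
  moreover have "topspace ?T = space ?P" by (simp add: space_pair_measure sp)
  ultimately show "sets (borel_of ?T) \<subseteq> sets ?P"
    unfolding sets_borel_of
    using sets.sigma_sets_subset[of "{U. openin ?T U}" ?P] by auto
  have fst: "fst \<in> borel_of ?T \<rightarrow>\<^sub>M \<mu>"
  proof -
    have "fst \<in> borel_of ?T \<rightarrow>\<^sub>M (borel :: 'x measure)"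
    proof (rule borel_measurableI)
      fix S :: "'x set" assume "open S"
      then have "openin ?T (S \<times> topspace Y_top)" by (simp add: openin_prod_Times_iff)
      moreover have "fst -` S \<inter> space (borel_of ?T) = S \<times> topspace Y_top" by auto
      ultimately show "fst -` S \<inter> space (borel_of ?T) \<in> sets (borel_of ?T)"
        by (auto simp: sets_borel_of)
    qed
    then show ?thesis using measurable_cong_sets[OF refl \<mu>] by blast
  qed
  have snd: "snd \<in> borel_of ?T \<rightarrow>\<^sub>M bernoulli_measure p"
  proof -
    have "snd \<in> borel_of ?T \<rightarrow>\<^sub>M borel_of Y_top"
      unfolding borel_of_def[of Y_top]
    proof (rule measurable_measure_of)
      show "{U. openin Y_top U} \<subseteq> Pow (topspace Y_top)" using openin_subset by blast
      show "snd \<in> space (borel_of ?T) \<rightarrow> topspace Y_top" by auto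
      fix S assume "S \<in> {U. openin Y_top U}"
      then have "openin ?T (UNIV \<times> S)" "S \<subseteq> topspace Y_top"
        by (auto simp: openin_prod_Times_iff openin_subset)
      moreover from this have "snd -` S \<inter> space (borel_of ?T) = UNIV \<times> S" by auto
      ultimately show "snd -` S \<inter> space (borel_of ?T) \<in> sets (borel_of ?T)"
        by (auto simp: sets_borel_of)
    qed
    then show ?thesis using measurable_cong_sets[OF refl sets_bernoulli_measure] by blast
  qed
  have id: "(\<lambda>z. (fst z, snd z)) \<in> borel_of ?T \<rightarrow>\<^sub>M ?P"
    by (rule measurable_Pair[OF fst snd])
  show "sets ?P \<subseteq> sets (borel_of ?T)"
  proof
    fix A assume A: "A \<in> sets ?P"
    have "A \<subseteq> space (borel_of ?T)"
      using sets.sets_into_space[OF A] by (simp add: space_pair_measure sp)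
    then have "(\<lambda>z. (fst z, snd z)) -` A \<inter> space (borel_of ?T) = A" by auto
    then show "A \<in> sets (borel_of ?T)" using measurable_sets[OF id A] by simp
  qed
qed

end

theory Submission
  imports Defs
begin

text \<open>
  Unique ergodicity and amenability force every orbit to come close to every point of the support
  of \<open>\<mu>\<close>, in particular to a point of near equicontinuity, so the whole action is equicontinuous and
  minimal. By the maximum principle the averages of a random walk with steps \<open>\<Phi>\<^sub>n\<close> then converge to
  the mean over \<open>\<mu>\<close>, uniformly in the starting point. A second moment estimate turns this into
  convergence, for each fixed \<open>x\<close> and in mean over the symbol sequence, of the Birkhoff averages
  of a function on \<open>X \<times> Y\<close> that depends on finitely many future symbols. Equicontinuity makes finitely
  many \<open>x\<close> suffice for a bound uniform in \<open>x\<close>; only the projection to \<open>Y\<close> enters, so integrating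
  against \<open>\<tau>\<close> determines its value on such functions, and invariance removes the restriction to
  future symbols.
\<close>

section \<open>Regular measures from finitely additive set functions\<close>

text \<open>The obstacle is that under \<tau> the point x may depend on the whole sequence r, on its
  future as well as on its past, and that \<tau> need not be absolutely continuous with respect to
  \<mu> \<times> \<lambda>. An almost-everywhere ergodic theorem for the product would therefore say
  nothing about \<tau>. What is known under \<tau> is the law of r alone, so Birkhoff sums need a
  bound that depends on r only and has small mean. For a fixed starting point the symbols are
  independent of the point and moments can be computed; the finite net replaces the unknown x by
  finitely many fixed points at the same r. This works because closeness is measured along the whole
  group orbit and so is never lost under random iteration. Amenability supplies only a functional on
  bounded functions of g. Its values on indicator functions form a finitely additive content on
  closed sets, from which a Borel measure is built; control of that measure on open sets carries
  both its invariance and its vanishing on open sets that the orbit misses.\<close>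

locale closed_content =
  fixes \<nu> :: "'x::metric_space set \<Rightarrow> real"
  assumes compact_space: "compact (UNIV :: 'x set)"
    and nonneg: "closed F \<Longrightarrow> 0 \<le> \<nu> F"
    and mono: "closed F \<Longrightarrow> closed F' \<Longrightarrow> F \<subseteq> F' \<Longrightarrow> \<nu> F \<le> \<nu> F'"
    and subadd: "closed F \<Longrightarrow> closed F' \<Longrightarrow> \<nu> (F \<union> F') \<le> \<nu> F + \<nu> F'"
    and add: "closed F \<Longrightarrow> closed F' \<Longrightarrow> F \<inter> F' = {} \<Longrightarrow> \<nu> (F \<union> F') = \<nu> F + \<nu> F'"
    and total: "\<nu> UNIV = 1"
begin

text \<open>The content \<open>\<nu>\<close> need not be regular, as a mean gives no control of
  limits. As in the proof of the Riesz representation theorem, it is regularised from inside on open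
  sets and then from outside on arbitrary sets; the resulting measure may exceed
  \<open>\<nu>\<close> on closed sets.\<close>

definition inner_content :: "'x set \<Rightarrow> ennreal" where
  "inner_content U = (SUP F\<in>{F. closed F \<and> F \<subseteq> U}. ennreal (\<nu> F))"

definition outer_content :: "'x set \<Rightarrow> ennreal" where
  "outer_content A = (INF U\<in>{U. open U \<and> A \<subseteq> U}. inner_content U)"

lemma empty_eq_0: "\<nu> {} = 0"
  using add[of "{}" "{}"] by simp

lemma inner_content_upper: "closed F \<Longrightarrow> F \<subseteq> U \<Longrightarrow> ennreal (\<nu> F) \<le> inner_content U"
  unfolding inner_content_def by (rule SUP_upper) simp

lemma inner_content_least: "(\<And>F. closed F \<Longrightarrow> F \<subseteq> U \<Longrightarrow> ennreal (\<nu> F) \<le> c) \<Longrightarrow> inner_content U \<le> c"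
  unfolding inner_content_def by (rule SUP_least) simp

lemma inner_content_mono: "U \<subseteq> V \<Longrightarrow> inner_content U \<le> inner_content V"
  by (rule inner_content_least) (rule inner_content_upper, auto)

lemma inner_content_UNIV: "inner_content UNIV = 1"
proof (rule antisym)
  show "inner_content UNIV \<le> 1"
    using mono[of _ UNIV] by (intro inner_content_least) (auto simp: total)
  show "1 \<le> inner_content UNIV"
    using inner_content_upper[of UNIV UNIV] by (simp add: total)
qed

text \<open>Normality of the metric space cuts a closed subset of \<open>U \<union> V\<close> into
  two closed pieces, one inside \<open>U\<close> and one inside \<open>V\<close>. The pieces may
  overlap, so this is where subadditivity of \<open>\<nu>\<close> enters.\<close>

lemma inner_content_Un_le:
  assumes "open U" "open V"
  shows "inner_content (U \<union> V) \<le> inner_content U + inner_content V"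
proof (rule inner_content_least)
  fix F assume F: "closed F" "F \<subseteq> U \<union> V"
  have "closed (F - V)" "closed (F - U)" "(F - V) \<inter> (F - U) = {}"
    using F assms by auto
  then obtain A B where AB: "open A" "open B" "F - V \<subseteq> A" "F - U \<subseteq> B" "A \<inter> B = {}"
    using t4_space[of "F - V" "F - U"] by auto
  have cl: "closed (F - B)" "closed (F - A)" using F(1) AB(1,2) by auto
  have "F = (F - B) \<union> (F - A)" using AB by auto
  then have "ennreal (\<nu> F) \<le> ennreal (\<nu> (F - B) + \<nu> (F - A))"
    using subadd[OF cl] by (intro ennreal_leI) simp
  also have "\<dots> = ennreal (\<nu> (F - B)) + ennreal (\<nu> (F - A))"
    by (rule ennreal_plus) (auto intro: nonneg cl)
  also have "\<dots> \<le> inner_content U + inner_content V"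
    using F AB cl by (intro add_mono inner_content_upper) auto
  finally show "ennreal (\<nu> F) \<le> inner_content U + inner_content V" .
qed

lemma inner_content_UN_finite_le:
  fixes n :: nat
  assumes "\<And>i. open (U i)"
  shows "inner_content (\<Union>i<n. U i) \<le> (\<Sum>i<n. inner_content (U i))"
proof (induction n)
  case 0
  have "inner_content {} \<le> 0" by (rule inner_content_least) (auto simp: empty_eq_0)
  then show ?case by simp
next
  case (Suc n)
  have "(\<Union>i<Suc n. U i) = (\<Union>i<n. U i) \<union> U n" by (auto simp: less_Suc_eq)
  then have "inner_content (\<Union>i<Suc n. U i) \<le> inner_content (\<Union>i<n. U i) + inner_content (U n)"
    using assms by (auto intro!: inner_content_Un_le)
  also have "\<dots> \<le> (\<Sum>i<n. inner_content (U i)) + inner_content (U n)"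
    by (intro add_mono Suc.IH order_refl)
  finally show ?case by simp
qed

text \<open>Compactness upgrades finite to countable subadditivity: a closed subset of the union
  already lies in finitely many of the open sets.\<close>

lemma inner_content_UN_le:
  assumes "\<And>i::nat. open (U i)"
  shows "inner_content (\<Union>i. U i) \<le> (\<Sum>i. inner_content (U i))"
proof (rule inner_content_least)
  fix F assume F: "closed F" "F \<subseteq> (\<Union>i. U i)"
  have "compact F" using F(1) compact_space by (metis compact_Int_closed Int_UNIV_left)
  then obtain I where I: "finite I" "F \<subseteq> (\<Union>i\<in>I. U i)"
    using F(2) assms compactE_image[of F UNIV U] by metis
  obtain n where n: "\<forall>i\<in>I. i < n" using finite_nat_set_iff_bounded I(1) by blast
  have "F \<subseteq> (\<Union>i<n. U i)" using I n by blast
  then have "ennreal (\<nu> F) \<le> inner_content (\<Union>i<n. U i)" using F(1) by (rule inner_content_upper[rotated])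
  also have "\<dots> \<le> (\<Sum>i<n. inner_content (U i))" using assms by (rule inner_content_UN_finite_le)
  also have "\<dots> \<le> (\<Sum>i. inner_content (U i))" by (intro sum_le_suminf) auto
  finally show "ennreal (\<nu> F) \<le> (\<Sum>i. inner_content (U i))" .
qed

lemma outer_content_lower: "open U \<Longrightarrow> A \<subseteq> U \<Longrightarrow> outer_content A \<le> inner_content U"
  unfolding outer_content_def by (rule INF_lower) simp

lemma outer_content_mono: "A \<subseteq> B \<Longrightarrow> outer_content A \<le> outer_content B"
  unfolding outer_content_def by (rule INF_superset_mono) auto

lemma outer_content_open: "open U \<Longrightarrow> outer_content U = inner_content U"
  by (rule antisym, rule outer_content_lower, simp, simp)
     (auto simp: outer_content_def intro!: INF_greatest inner_content_mono)

lemma outer_content_le_1: "outer_content A \<le> 1"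
  using outer_content_lower[of UNIV A] by (simp add: inner_content_UNIV)

lemma outer_content_UN_le: "outer_content (\<Union>i. A i) \<le> (\<Sum>i. outer_content (A i))" for A :: "nat \<Rightarrow> 'x set"
proof (rule ennreal_le_epsilon)
  fix e :: real assume e: "0 < e"
  \<comment> \<open>Summable slack \<open>e / 2 ^ (i + 1)\<close>. The strict inequality requires a
    finite outer content, which is at most 1.\<close>
  have "\<exists>U. open U \<and> A i \<subseteq> U \<and> inner_content U < outer_content (A i) + ennreal (e * (1/2) ^ Suc i)" for i
  proof -
    have "outer_content (A i) \<noteq> \<top>" using outer_content_le_1[of "A i"] by (metis ennreal_one_less_top not_less top_greatest)
    then have "outer_content (A i) + 0 < outer_content (A i) + ennreal (e * (1/2) ^ Suc i)"
      using e by (subst ennreal_add_left_cancel_less) auto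
    then show ?thesis
      unfolding outer_content_def[of "A i"] by (auto simp: INF_less_iff)
  qed
  then obtain U where U: "\<And>i. open (U i)" "\<And>i. A i \<subseteq> U i"
    "\<And>i. inner_content (U i) < outer_content (A i) + ennreal (e * (1/2) ^ Suc i)" by metis
  have "outer_content (\<Union>i. A i) \<le> inner_content (\<Union>i. U i)"
    using U by (intro outer_content_lower UN_mono) auto
  also have "\<dots> \<le> (\<Sum>i. inner_content (U i))" using U(1) by (rule inner_content_UN_le)
  also have "\<dots> \<le> (\<Sum>i. outer_content (A i) + ennreal (e * (1/2) ^ Suc i))"
    by (intro suminf_le less_imp_le[OF U(3)]) auto
  also have "\<dots> = (\<Sum>i. outer_content (A i)) + (\<Sum>i. ennreal (e * (1/2) ^ Suc i))"
    by (rule suminf_add[symmetric]) auto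
  also have "(\<Sum>i. ennreal (e * (1/2) ^ Suc i)) = ennreal e"
    using sums_mult[OF power_half_series, of e] e
    by (intro sums_unique[symmetric]) (subst sums_ennreal, auto)
  finally show "outer_content (\<Union>i. A i) \<le> (\<Sum>i. outer_content (A i)) + ennreal e" .
qed

lemma outer_content_empty: "outer_content {} = 0"
  using inner_content_UN_finite_le[of "\<lambda>_. {}" 0] outer_content_lower[of "{}" "{}"] by simp

text \<open>The Caratheodory criterion for open sets. Given an open \<open>V\<close> that covers
  \<open>A\<close>, a closed \<open>F\<close> inside \<open>U \<inter> V\<close> is chosen before a
  closed \<open>F'\<close> inside \<open>V - F\<close>, an open set that still covers
  \<open>- U \<inter> A\<close>. The two are disjoint, so \<open>\<nu>\<close> adds exactly.\<close>

lemma outer_content_split_open: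
  assumes "open U"
  shows "outer_content (U \<inter> A) + outer_content (- U \<inter> A) = outer_content A"
proof (rule antisym)
  have "outer_content (U \<inter> A) + outer_content (- U \<inter> A) \<le> inner_content V" if V: "open V" "A \<subseteq> V" for V
  proof -
    have 1: "ennreal (\<nu> F) + outer_content (- U \<inter> A) \<le> inner_content V" if F: "closed F" "F \<subseteq> U \<inter> V" for F
    proof -
      have "ennreal (\<nu> F') + ennreal (\<nu> F) \<le> inner_content V" if F': "closed F'" "F' \<subseteq> V - F" for F'
      proof -
        have "ennreal (\<nu> F') + ennreal (\<nu> F) = ennreal (\<nu> (F' \<union> F))"
          using F F' by (subst add) (auto simp: nonneg intro: ennreal_plus[symmetric])
        also have "\<dots> \<le> inner_content V" using F F' by (intro inner_content_upper) auto
        finally show ?thesis .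
      qed
      then have "(SUP F'\<in>{F'. closed F' \<and> F' \<subseteq> V - F}. ennreal (\<nu> F') + ennreal (\<nu> F)) \<le> inner_content V"
        by (intro SUP_least) auto
      moreover have "(SUP F'\<in>{F'. closed F' \<and> F' \<subseteq> V - F}. ennreal (\<nu> F') + ennreal (\<nu> F))
          = inner_content (V - F) + ennreal (\<nu> F)"
        unfolding inner_content_def by (rule ennreal_SUP_add_left) auto
      moreover have "outer_content (- U \<inter> A) \<le> inner_content (V - F)"
        using F V by (intro outer_content_lower) auto
      ultimately show ?thesis
        by (metis add.commute add_left_mono order_trans)
    qed
    have "outer_content (U \<inter> A) + outer_content (- U \<inter> A) \<le> inner_content (U \<inter> V) + outer_content (- U \<inter> A)"
      using assms V by (intro add_right_mono outer_content_lower) auto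
    also have "\<dots> = (SUP F\<in>{F. closed F \<and> F \<subseteq> U \<inter> V}. ennreal (\<nu> F) + outer_content (- U \<inter> A))"
      unfolding inner_content_def by (rule ennreal_SUP_add_left[symmetric]) auto
    also have "\<dots> \<le> inner_content V" using 1 by (intro SUP_least) auto
    finally show ?thesis .
  qed
  then show "outer_content (U \<inter> A) + outer_content (- U \<inter> A) \<le> outer_content A"
    unfolding outer_content_def[of A] by (intro INF_greatest) auto
next
  \<comment> \<open>The two pieces are padded with empty sets to a sequence, so that countable
    subadditivity applies.\<close>
  have "outer_content A \<le> outer_content (\<Union>i. case i of 0 \<Rightarrow> U \<inter> A | Suc 0 \<Rightarrow> - U \<inter> A | _ \<Rightarrow> {})"
  proof (intro outer_content_mono subsetI)
    fix x assume "x \<in> A"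
    then have "x \<in> (case (if x \<in> U then 0 else Suc 0) of 0 \<Rightarrow> U \<inter> A | Suc 0 \<Rightarrow> - U \<inter> A | _ \<Rightarrow> {})"
      by auto
    then show "x \<in> (\<Union>i. case i of 0 \<Rightarrow> U \<inter> A | Suc 0 \<Rightarrow> - U \<inter> A | _ \<Rightarrow> {})" by blast
  qed
  also have "\<dots> \<le> (\<Sum>i. outer_content (case i of 0 \<Rightarrow> U \<inter> A | Suc 0 \<Rightarrow> - U \<inter> A | _ \<Rightarrow> {}))"
    by (rule outer_content_UN_le)
  also have "\<dots> = (\<Sum>i\<in>{0, Suc 0}. outer_content (case i of 0 \<Rightarrow> U \<inter> A | Suc 0 \<Rightarrow> - U \<inter> A | _ \<Rightarrow> {}))"
  proof (rule suminf_finite)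
    show "outer_content (case i of 0 \<Rightarrow> U \<inter> A | Suc 0 \<Rightarrow> - U \<inter> A | _ \<Rightarrow> {}) = 0" if "i \<notin> {0, Suc 0}" for i
      using that by (auto simp: outer_content_empty split: nat.splits)
  qed simp
  finally show "outer_content A \<le> outer_content (U \<inter> A) + outer_content (- U \<inter> A)" by simp
qed

text \<open>By Caratheodory the outer content is a measure on the sets that split every set
  additively; these include the open sets and hence all Borel sets.\<close>

lemma regular_measure:
  obtains N :: "'x measure" where "sets N = sets borel" "prob_space N"
    "\<And>U. open U \<Longrightarrow> emeasure N U = inner_content U"
proof -
  let ?L = "lambda_system UNIV (Pow UNIV) outer_content"
  have "outer_measure_space (Pow UNIV) outer_content"
    unfolding outer_measure_space_def positive_def increasing_def countably_subadditive_def
    using outer_content_empty outer_content_mono outer_content_UN_le by auto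
  then have L: "measure_space UNIV ?L outer_content"
    using sigma_algebra.caratheodory_lemma[OF sigma_algebra_Pow] by blast
  then have "sigma_sets UNIV {U. open U} \<subseteq> ?L"
    unfolding measure_space_def
    by (intro sigma_algebra.sigma_sets_subset) (auto simp: lambda_system_def Compl_eq_Diff_UNIV[symmetric] outer_content_split_open)
  then have sub: "sets borel \<subseteq> ?L" by (simp add: sets_borel)
  define N where "N = measure_of UNIV (sets (borel :: 'x measure)) outer_content"
  have sets: "sets N = sets borel"
    unfolding N_def by (metis sets.sets_measure_of_eq space_borel)
  have em: "emeasure N A = outer_content A" if "A \<in> sets borel" for A
  proof (rule emeasure_measure_of[OF N_def])
    show "positive (sets N) outer_content" by (simp add: positive_def outer_content_empty)
    show "countably_additive (sets N) outer_content"
      using L sub unfolding measure_space_def countably_additive_def sets by blast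
  qed (use that sets in auto)
  have "prob_space N"
    by (rule prob_spaceI) (simp add: sets_eq_imp_space_eq[OF sets] em outer_content_open inner_content_UNIV)
  then show thesis by (rule that[OF sets]) (simp add: em outer_content_open)
qed

end

section \<open>Equicontinuity and minimality\<close>

lemma ess_bounded_scale: "f \<in> ess_bounded H \<Longrightarrow> (\<lambda>x. c * f x) \<in> ess_bounded H"
proof -
  assume f: "f \<in> ess_bounded H"
  then obtain C where "AE x in H. \<bar>f x\<bar> \<le> C" by (auto simp: ess_bounded_def)
  then have "AE x in H. \<bar>c * f x\<bar> \<le> \<bar>c\<bar> * C"
    by eventually_elim (simp add: abs_mult mult_left_mono)
  then show ?thesis using f by (auto simp: ess_bounded_def)
qed

lemma ess_bounded_add:
  "f \<in> ess_bounded H \<Longrightarrow> h \<in> ess_bounded H \<Longrightarrow> (\<lambda>x. f x + h x) \<in> ess_bounded H"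
proof -
  assume f: "f \<in> ess_bounded H" and h: "h \<in> ess_bounded H"
  obtain C D where "AE x in H. \<bar>f x\<bar> \<le> C" "AE x in H. \<bar>h x\<bar> \<le> D"
    using f h by (auto simp: ess_bounded_def)
  then have "AE x in H. \<bar>f x + h x\<bar> \<le> C + D"
    by eventually_elim linarith
  then show ?thesis using f h by (auto simp: ess_bounded_def)
qed

lemma left_invariant_meanD:
  assumes "left_invariant_mean G H L"
  shows "f \<in> ess_bounded H \<Longrightarrow> h \<in> ess_bounded H \<Longrightarrow> L (\<lambda>x. f x + h x) = L f + L h"
    and "f \<in> ess_bounded H \<Longrightarrow> L (\<lambda>x. c * f x) = c * L f"
    and "f \<in> ess_bounded H \<Longrightarrow> AE x in H. 0 \<le> f x \<Longrightarrow> 0 \<le> L f"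
    and "g \<in> carrier G \<Longrightarrow> f \<in> ess_bounded H \<Longrightarrow> L (\<lambda>x. f (g \<otimes>\<^bsub>G\<^esub> x)) = L f"
    and "L (\<lambda>x. 1) = 1"
  using assms by (simp_all add: left_invariant_mean_def)

lemma left_invariant_mean_mono:
  assumes "left_invariant_mean G H L" "f \<in> ess_bounded H" "h \<in> ess_bounded H"
    and "\<And>x. x \<in> space H \<Longrightarrow> f x \<le> h x"
  shows "L f \<le> L h"
proof -
  have m: "(\<lambda>x. - 1 * f x) \<in> ess_bounded H"
    using assms(2) by (rule ess_bounded_scale)
  have "AE x in H. 0 \<le> h x + - 1 * f x"
    using assms(4) by (intro AE_I2) simp
  then have "0 \<le> L (\<lambda>x. h x + - 1 * f x)"
    by (rule left_invariant_meanD(3)[OF assms(1) ess_bounded_add[OF assms(3) m]])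
  also have "L (\<lambda>x. h x + - 1 * f x) = L h + - 1 * L f"
    unfolding left_invariant_meanD(1)[OF assms(1,3) m] left_invariant_meanD(2)[OF assms(1,2)] ..
  finally show ?thesis by simp
qed

text \<open>A mean is applied to functions on the whole type. Positivity is tested almost everywhere
  on the space only, so values off the space cannot influence it.\<close>

lemma left_invariant_mean_cong:
  assumes "left_invariant_mean G H L" "f \<in> ess_bounded H" "h \<in> ess_bounded H"
    and "\<And>x. x \<in> space H \<Longrightarrow> f x = h x"
  shows "L f = L h"
  using left_invariant_mean_mono[OF assms(1,2,3)] left_invariant_mean_mono[OF assms(1,3,2)] assms(4)
  by (auto intro: antisym)

section \<open>Continuous actions on a compact space and averages along an orbit\<close>

locale compact_action =
  fixes G :: "('g, 'm) monoid_scheme"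
    and T :: "'g topology"
    and \<phi> :: "'g \<Rightarrow> 'x::metric_space \<Rightarrow> 'x"
  assumes top_group: "topological_group G T"
    and compact_UNIV: "compact (UNIV :: 'x set)"
    and cont_action: "continuous_group_action G T \<phi>"
begin

lemma action: "group_action G UNIV \<phi>"
  using cont_action by (simp add: continuous_group_action_def)

lemma group: "group G"
  using top_group by (simp add: topological_group_def)

lemma topspace_eq: "topspace T = carrier G"
  using top_group by (simp add: topological_group_def)

lemma act_mult: "g \<in> carrier G \<Longrightarrow> h \<in> carrier G \<Longrightarrow> \<phi> (g \<otimes>\<^bsub>G\<^esub> h) x = \<phi> g (\<phi> h x)"
  using group_action.composition_rule[OF action] by simp

lemma act_one: "\<phi> \<one>\<^bsub>G\<^esub> x = x"
  using group_action.id_eq_one[OF action] by (metis UNIV_I restrict_apply')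

lemma act_inv: "g \<in> carrier G \<Longrightarrow> \<phi> (inv\<^bsub>G\<^esub> g) (\<phi> g x) = x"
  using group_action.orbit_sym_aux[OF action] by simp

lemma orbit_map_continuous: "continuous_map T euclidean (\<lambda>g. \<phi> g x)"
proof -
  have "continuous_map T (prod_topology T euclidean) (\<lambda>g. (g, x))"
    by (simp add: continuous_map_pairwise o_def)
  then have "continuous_map T euclidean ((\<lambda>(g, x). \<phi> g x) \<circ> (\<lambda>g. (g, x)))"
    using cont_action unfolding continuous_group_action_def by (intro continuous_map_compose) auto
  then show ?thesis by (simp add: o_def)
qed

lemma act_continuous: "g \<in> carrier G \<Longrightarrow> continuous_on UNIV (\<phi> g)"
proof -
  assume g: "g \<in> carrier G"
  then have "continuous_map euclidean (prod_topology T euclidean) (\<lambda>x. (g, x))"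
    by (simp add: continuous_map_pairwise o_def topspace_eq)
  then have "continuous_map euclidean euclidean ((\<lambda>(g, x). \<phi> g x) \<circ> (\<lambda>x. (g, x)))"
    using cont_action unfolding continuous_group_action_def by (intro continuous_map_compose) auto
  then show ?thesis by (simp add: o_def)
qed

lemma act_measurable: "g \<in> carrier G \<Longrightarrow> \<phi> g \<in> borel_measurable borel"
  by (intro borel_measurable_continuous_onI act_continuous)

text \<open>A mean over the group of the point masses at \<open>\<phi> g z\<close>: the content of a
  closed \<open>F\<close> is the mean of the indicator of \<open>\<phi> g z \<in> F\<close> as a
  function of \<open>g\<close>. Left translation in the group corresponds to taking preimages of
  \<open>F\<close>, which yields invariance; a set that the orbit avoids has indicator zero.\<close>

lemma orbit_invariant_measure:
  assumes "amenable G T"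
  obtains N where "prob_space N" "sets N = sets borel" "invariant_measure G \<phi> N"
    "\<And>U. open U \<Longrightarrow> (\<And>g. g \<in> carrier G \<Longrightarrow> \<phi> g z \<notin> U) \<Longrightarrow> emeasure N U = 0"
proof -
  obtain H L where HL: "left_haar_measure G T H" "left_invariant_mean G H L"
    using assms by (auto simp: amenable_def)
  have setsH: "sets H = sets (borel_of T)" using HL(1) by (simp add: left_haar_measure_def)
  have spaceH: "space H = carrier G"
    using sets_eq_imp_space_eq[OF setsH] by (simp add: topspace_eq)
  define \<psi> :: "'x set \<Rightarrow> 'g \<Rightarrow> real" where "\<psi> F g = indicator F (\<phi> g z)" for F g
  define \<nu> where "\<nu> F = L (\<psi> F)" for F
  have ess: "\<psi> F \<in> ess_bounded H" if "closed F" for F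
  proof -
    have "openin T {g \<in> topspace T. \<phi> g z \<in> - F}"
      using that by (intro openin_continuous_map_preimage[OF orbit_map_continuous]) auto
    then have "{g \<in> carrier G. \<phi> g z \<in> - F} \<in> sets H"
      by (auto simp: setsH sets_borel_of topspace_eq)
    then have "space H - {g \<in> carrier G. \<phi> g z \<in> - F} \<in> sets H" by auto
    moreover have "space H - {g \<in> carrier G. \<phi> g z \<in> - F} = {g \<in> space H. \<phi> g z \<in> F}"
      by (auto simp: spaceH)
    ultimately have m: "{g \<in> space H. \<phi> g z \<in> F} \<in> sets H" by simp
    have "\<psi> F \<in> borel_measurable H"
      by (rule measurable_cong[THEN iffD1, OF _ borel_measurable_indicator[OF m]])
        (auto simp: \<psi>_def indicator_def)
    then show ?thesis
      unfolding ess_bounded_def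
      by (auto intro!: exI[of _ 1] AE_I2 simp: \<psi>_def indicator_def)
  qed
  interpret closed_content \<nu>
  proof
    fix F F' :: "'x set" assume F: "closed F" and F': "closed F'"
    note e = ess[OF F] ess[OF F']
    show "\<nu> F \<le> \<nu> F'" if "F \<subseteq> F'"
      unfolding \<nu>_def using that
      by (intro left_invariant_mean_mono[OF HL(2) e]) (auto simp: \<psi>_def indicator_def)
    have sum: "L (\<lambda>g. \<psi> F g + \<psi> F' g) = \<nu> F + \<nu> F'"
      unfolding \<nu>_def by (rule left_invariant_meanD(1)[OF HL(2) e])
    show "\<nu> (F \<union> F') \<le> \<nu> F + \<nu> F'"
      unfolding sum[symmetric] unfolding \<nu>_def
      by (intro left_invariant_mean_mono[OF HL(2)] ess ess_bounded_add e closed_Un F F')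
         (auto simp: \<psi>_def indicator_def)
    show "\<nu> (F \<union> F') = \<nu> F + \<nu> F'" if "F \<inter> F' = {}"
      unfolding sum[symmetric] unfolding \<nu>_def
      using that by (intro arg_cong[where f=L] ext) (auto simp: \<psi>_def indicator_def)
    have "AE g in H. 0 \<le> \<psi> F g" by (simp add: \<psi>_def)
    then show "0 \<le> \<nu> F"
      unfolding \<nu>_def by (rule left_invariant_meanD(3)[OF HL(2) e(1)])
  next
    have "\<psi> UNIV = (\<lambda>x. 1)" by (simp add: \<psi>_def fun_eq_iff)
    then show "\<nu> UNIV = 1"
      using left_invariant_meanD(5)[OF HL(2)] by (simp add: \<nu>_def)
  qed (rule compact_UNIV)
  obtain N where N: "sets N = sets borel" "prob_space N"
    "\<And>U. open U \<Longrightarrow> emeasure N U = inner_content U" using regular_measure by metis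
  have sp: "space N = UNIV" using sets_eq_imp_space_eq[OF N(1)] by simp
  have inv: "\<nu> (\<phi> g -` F) = \<nu> F" if g: "g \<in> carrier G" and F: "closed F" for g F
  proof -
    have F': "closed (\<phi> g -` F)"
      by (rule closed_vimage[OF F act_continuous[OF g]])
    have eq: "\<psi> (\<phi> g -` F) h = \<psi> F (g \<otimes>\<^bsub>G\<^esub> h)" if "h \<in> space H" for h
      using g that by (simp add: \<psi>_def spaceH act_mult indicator_def)
    have "(\<lambda>h. \<psi> F (g \<otimes>\<^bsub>G\<^esub> h)) \<in> borel_measurable H"
      using ess[OF F'] measurable_cong[of H "\<psi> (\<phi> g -` F)", OF eq] by (simp add: ess_bounded_def)
    then have "(\<lambda>h. \<psi> F (g \<otimes>\<^bsub>G\<^esub> h)) \<in> ess_bounded H"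
      unfolding ess_bounded_def
      by (auto intro!: exI[of _ 1] AE_I2 simp: \<psi>_def indicator_def)
    then have "\<nu> (\<phi> g -` F) = L (\<lambda>h. \<psi> F (g \<otimes>\<^bsub>G\<^esub> h))"
      unfolding \<nu>_def by (intro left_invariant_mean_cong[OF HL(2)] ess F' eq)
    also have "\<dots> = \<nu> F"
      unfolding \<nu>_def by (rule left_invariant_meanD(4)[OF HL(2) g ess[OF F]])
    finally show ?thesis .
  qed
  \<comment> \<open>One inequality for all group elements suffices, since applied to the inverse of
    \<open>g\<close> it gives the reverse one.\<close>
  have le: "inner_content U \<le> inner_content (\<phi> g -` U)" if g: "g \<in> carrier G" for g U
  proof (rule inner_content_least)
    fix F assume F: "closed F" "F \<subseteq> U"
    have "closed (\<phi> g -` F)"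
      by (rule closed_vimage[OF F(1) act_continuous[OF g]])
    then have "ennreal (\<nu> (\<phi> g -` F)) \<le> inner_content (\<phi> g -` U)"
      using F by (intro inner_content_upper) auto
    then show "ennreal (\<nu> F) \<le> inner_content (\<phi> g -` U)" by (simp add: inv g F)
  qed
  have eq: "inner_content (\<phi> g -` U) = inner_content U" if g: "g \<in> carrier G" for g U
  proof (rule antisym[OF _ le[OF g]])
    have "inner_content (\<phi> g -` U) \<le> inner_content (\<phi> (inv\<^bsub>G\<^esub> g) -` (\<phi> g -` U))"
      using g group by (intro le) (simp add: group.inv_closed)
    also have "\<phi> (inv\<^bsub>G\<^esub> g) -` (\<phi> g -` U) = U"
      using act_inv[of "inv\<^bsub>G\<^esub> g"] g group by (auto simp: group.inv_closed group.inv_inv)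
    finally show "inner_content (\<phi> g -` U) \<le> inner_content U" .
  qed
  have "distr N N (\<phi> g) = N" if g: "g \<in> carrier G" for g
  proof (rule measure_eqI_generator_eq[where E="{U. open U}" and \<Omega>=UNIV and A="\<lambda>_. UNIV"])
    have m: "\<phi> g \<in> N \<rightarrow>\<^sub>M N"
      using act_measurable[OF g] measurable_cong_sets[OF N(1) N(1)] by blast
    show "emeasure (distr N N (\<phi> g)) U = emeasure N U" if "U \<in> {U. open U}" for U
    proof -
      have "open (\<phi> g -` U)"
        using that act_continuous[OF g] by (simp add: open_vimage)
      then show ?thesis
        using that N by (subst emeasure_distr[OF m]) (auto simp: sp eq[OF g])
    qed
    show "sets (distr N N (\<phi> g)) = sigma_sets UNIV {U. open U}" "sets N = sigma_sets UNIV {U. open U}"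
      by (simp_all add: N(1) sets_borel)
    have "prob_space (distr N N (\<phi> g))" by (rule prob_space.prob_space_distr[OF N(2) m])
    then show "emeasure (distr N N (\<phi> g)) UNIV \<noteq> \<infinity>" for i :: nat
      by (metis finite_measure.emeasure_finite infinity_ennreal_def prob_space.finite_measure)
  qed (auto simp: Int_stable_def)
  then have "invariant_measure G \<phi> N" by (simp add: invariant_measure_def)
  moreover have "emeasure N U = 0" if U: "open U" "\<And>g. g \<in> carrier G \<Longrightarrow> \<phi> g z \<notin> U" for U
  proof -
    have "inner_content U \<le> 0"
    proof (rule inner_content_least)
      fix F assume F: "closed F" "F \<subseteq> U"
      have "\<nu> F = \<nu> {}"
        unfolding \<nu>_def using U F
        by (intro left_invariant_mean_cong[OF HL(2)] ess) (auto simp: \<psi>_def spaceH indicator_def)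
      then show "ennreal (\<nu> F) \<le> 0" by (simp add: empty_eq_0)
    qed
    then show ?thesis using N(3)[OF U(1)] by simp
  qed
  ultimately show thesis using that N by blast
qed

text \<open>Smallness in the \<open>G\<close>-invariant metric that is the supremum of
  \<open>dist (\<phi> g x) (\<phi> g y)\<close> over \<open>g\<close>, stated without the supremum.
  Equicontinuity of the action means that this metric induces the original topology.\<close>

definition orbit_close :: "real \<Rightarrow> 'x \<Rightarrow> 'x \<Rightarrow> bool" where
  "orbit_close e x y \<longleftrightarrow> (\<forall>g\<in>carrier G. dist (\<phi> g x) (\<phi> g y) < e)"

lemma orbit_close_sym: "orbit_close e x y \<longleftrightarrow> orbit_close e y x"
  by (simp add: orbit_close_def dist_commute)

lemma orbit_close_trans: "orbit_close a x y \<Longrightarrow> orbit_close b y z \<Longrightarrow> orbit_close (a + b) x z"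
  unfolding orbit_close_def by (metis add.commute dist_commute dist_triangle_less_add)

lemma orbit_close_dist: "orbit_close e x y \<Longrightarrow> dist x y < e"
  unfolding orbit_close_def using act_one group.is_monoid[OF group] by (metis monoid.one_closed)

lemma orbit_close_act:
  assumes "orbit_close e x y" "g \<in> carrier G"
  shows "orbit_close e (\<phi> g x) (\<phi> g y)"
  unfolding orbit_close_def
proof
  fix h assume h: "h \<in> carrier G"
  have "h \<otimes>\<^bsub>G\<^esub> g \<in> carrier G" using assms h group by (simp add: group.is_monoid monoid.m_closed)
  then show "dist (\<phi> h (\<phi> g x)) (\<phi> h (\<phi> g y)) < e"
    using assms h by (simp add: orbit_close_def flip: act_mult)
qed

end

section \<open>Equicontinuity from unique ergodicity and non-sensitivity\<close>

locale nonsensitive_action = compact_action G T \<phi>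
  for G :: "('g, 'm) monoid_scheme" and T and \<phi> :: "'g \<Rightarrow> 'x::metric_space \<Rightarrow> 'x" +
  fixes \<mu> :: "'x measure"
  assumes amenable: "amenable G T"
    and uniq: "uniquely_ergodic_for G \<phi> \<mu>"
    and nonsens: "\<not> sensitive_on G \<phi> (measure_support \<mu>)"
begin

text \<open>By unique ergodicity the invariant measure averaged along the orbit of \<open>z\<close>
  is \<open>\<mu>\<close>, whatever \<open>z\<close> is. A ball about a support point has positive
  measure, so the orbit cannot avoid it.\<close>

lemma orbit_meets_support:
  assumes "x \<in> measure_support \<mu>" "\<delta> > 0"
  obtains g where "g \<in> carrier G" "dist x (\<phi> g z) < \<delta>"
proof -
  obtain N where N: "prob_space N" "sets N = sets borel" "invariant_measure G \<phi> N"
    "\<And>U. open U \<Longrightarrow> (\<And>g. g \<in> carrier G \<Longrightarrow> \<phi> g z \<notin> U) \<Longrightarrow> emeasure N U = 0"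
    using orbit_invariant_measure[OF amenable] by metis
  have "N = \<mu>" using uniq N(1-3) unfolding uniquely_ergodic_for_def by blast
  moreover have "emeasure \<mu> (ball x \<delta>) > 0"
    using assms by (auto simp: measure_support_def)
  ultimately have "\<exists>g\<in>carrier G. \<phi> g z \<in> ball x \<delta>"
    using N(4)[OF open_ball, of x \<delta>] by (metis less_irrefl)
  then show thesis using that by auto
qed

text \<open>One point of equicontinuity attracts every orbit, and this spreads equicontinuity and
  minimality to the whole space.\<close>

lemma stable_ball:
  assumes "e > 0"
  obtains x \<delta> where "x \<in> measure_support \<mu>" "\<delta> > 0" "\<And>y. dist x y < \<delta> \<Longrightarrow> orbit_close e x y"
  using nonsens assms unfolding sensitive_on_def orbit_close_def by (metis not_less)

text \<open>The centre of the stable ball may change with \<open>e\<close>, which does no harm as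
  each \<open>e\<close> is treated separately. A group element that moves \<open>z\<close> into the
  ball moves a neighbourhood of \<open>z\<close> into it, and closeness found there is pulled back
  by the inverse, because \<open>orbit_close\<close> quantifies over the whole group.\<close>

lemma equicontinuous_at:
  assumes "e > 0"
  obtains U where "open U" "z \<in> U" "U \<subseteq> {w. orbit_close e z w}"
proof -
  obtain x \<delta> where x: "x \<in> measure_support \<mu>" "\<delta> > 0"
    "\<And>y. dist x y < \<delta> \<Longrightarrow> orbit_close (e/2) x y" using stable_ball[of "e/2"] assms by auto
  obtain g where g: "g \<in> carrier G" "dist x (\<phi> g z) < \<delta>"
    by (rule orbit_meets_support[OF x(1,2)])
  show thesis
  proof (rule that[of "\<phi> g -` ball x \<delta>"])
    show "open (\<phi> g -` ball x \<delta>)" using act_continuous[OF g(1)] by (simp add: open_vimage)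
    show "z \<in> \<phi> g -` ball x \<delta>" using g by simp
    show "\<phi> g -` ball x \<delta> \<subseteq> {w. orbit_close e z w}"
    proof (intro subsetI CollectI)
      fix w assume "w \<in> \<phi> g -` ball x \<delta>"
      then have "orbit_close (e/2) x (\<phi> g w)" "orbit_close (e/2) x (\<phi> g z)" using x(3) g by auto
    then have "orbit_close e (\<phi> g z) (\<phi> g w)"
      using orbit_close_trans[of "e/2" "\<phi> g z" x "e/2" "\<phi> g w"] by (simp add: orbit_close_sym)
    then have "orbit_close e (\<phi> (inv\<^bsub>G\<^esub> g) (\<phi> g z)) (\<phi> (inv\<^bsub>G\<^esub> g) (\<phi> g w))"
      by (rule orbit_close_act) (use g(1) group in \<open>simp add: group.inv_closed\<close>)
    then show "orbit_close e z w" by (simp add: act_inv g)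
    qed
  qed
qed

lemma orbit_close_net:
  assumes "e > 0"
  obtains D where "finite D" "\<And>x. \<exists>y\<in>D. orbit_close e y x"
proof -
  \<comment> \<open>The sets of \<open>orbit_close\<close> neighbours are not known to be open;
    their interiors contain the centres and form the open cover.\<close>
  define U where "U z = interior {w. orbit_close e z w}" for z
  have U: "open (U z)" "z \<in> U z" for z
  proof -
    obtain V where "open V" "z \<in> V" "V \<subseteq> {w. orbit_close e z w}"
      by (rule equicontinuous_at[OF assms])
    then show "z \<in> U z" unfolding U_def by (rule interiorI)
  qed (simp add: U_def)
  have "(UNIV :: 'x set) \<subseteq> (\<Union>z\<in>UNIV. U z)" using U(2) by auto
  then obtain D where D: "finite D" "(UNIV :: 'x set) \<subseteq> (\<Union>z\<in>D. U z)"
    using compactE_image[OF compact_UNIV, of UNIV U] U(1) by metis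
  show thesis
  proof (rule that[OF D(1)])
    fix x
    obtain y where "y \<in> D" "x \<in> U y" using D(2) by blast
    then show "\<exists>y\<in>D. orbit_close e y x" using interior_subset by (fastforce simp: U_def)
  qed
qed

text \<open>The orbits of \<open>x\<close> and of \<open>y\<close> enter the same stable ball.
  Undoing the motion \<open>h\<close> of \<open>y\<close> shows that \<open>h\<close> inverse times
  \<open>g\<close> is the element wanted.\<close>

lemma minimal:
  assumes "e > 0"
  obtains g where "g \<in> carrier G" "orbit_close e (\<phi> g x) y"
proof -
  obtain a \<delta> where a: "a \<in> measure_support \<mu>" "\<delta> > 0"
    "\<And>y. dist a y < \<delta> \<Longrightarrow> orbit_close (e/2) a y" using stable_ball[of "e/2"] assms by auto
  obtain g where g: "g \<in> carrier G" "dist a (\<phi> g x) < \<delta>"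
    by (rule orbit_meets_support[OF a(1,2)])
  obtain h where h: "h \<in> carrier G" "dist a (\<phi> h y) < \<delta>"
    by (rule orbit_meets_support[OF a(1,2)])
  have "orbit_close e (\<phi> g x) (\<phi> h y)"
    using orbit_close_trans[of "e/2" "\<phi> g x" a "e/2" "\<phi> h y"] a(3) g h by (simp add: orbit_close_sym)
  then have "orbit_close e (\<phi> (inv\<^bsub>G\<^esub> h) (\<phi> g x)) (\<phi> (inv\<^bsub>G\<^esub> h) (\<phi> h y))"
    by (rule orbit_close_act) (use h(1) group in \<open>simp add: group.inv_closed\<close>)
  then have "orbit_close e (\<phi> (inv\<^bsub>G\<^esub> h \<otimes>\<^bsub>G\<^esub> g) x) y"
    using g h group by (simp add: act_inv act_mult group.inv_closed)
  then show thesis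
    using that g h group by (meson group.inv_closed group.is_monoid monoid.m_closed)
qed

text \<open>The orbit map at \<open>x\<close> is continuous, and the image only has to land in a
  neighbourhood of equicontinuity of \<open>\<phi> g x\<close>, so \<open>g\<close> may be replaced
  by an element of \<open>W\<close>. Inverses, which a semigroup need not contain, have already been
  used up in \<open>minimal\<close>.\<close>

lemma dense_subset_minimal:
  assumes "e > 0" and dense: "T closure_of W = carrier G"
  obtains w where "w \<in> W" "orbit_close e (\<phi> w x) y"
proof -
  have e2: "e/2 > 0" using assms(1) by simp
  obtain g where g: "g \<in> carrier G" "orbit_close (e/2) (\<phi> g x) y" by (rule minimal[OF e2])
  obtain U where U: "open U" "\<phi> g x \<in> U" "U \<subseteq> {w. orbit_close (e/2) (\<phi> g x) w}"
    by (rule equicontinuous_at[OF e2])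
  have "openin T {h \<in> topspace T. \<phi> h x \<in> U}"
    using U(1) by (intro openin_continuous_map_preimage[OF orbit_map_continuous]) auto
  moreover have "g \<in> {h \<in> topspace T. \<phi> h x \<in> U}" using g(1) U(2) by (simp add: topspace_eq)
  moreover have "\<forall>S. g \<in> S \<and> openin T S \<longrightarrow> (\<exists>w. w \<in> W \<and> w \<in> S)"
    using g(1) dense in_closure_of[of g T W] by simp
  ultimately have "\<exists>w. w \<in> W \<and> w \<in> {h \<in> topspace T. \<phi> h x \<in> U}" by metis
  then obtain w where w: "w \<in> W" "\<phi> w x \<in> U" by auto
  have "orbit_close (e/2) (\<phi> w x) (\<phi> g x)" using U(3) w(2) by (auto simp: orbit_close_sym)
  from orbit_close_trans[OF this g(2)] have "orbit_close e (\<phi> w x) y" by simp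
  then show thesis by (rule that[OF w(1)])
qed

text \<open>Finitely many elements serve all pairs of points, since each pair may be replaced by net
  points: \<open>w\<close> keeps \<open>x\<close> and its net point orbit close. The finiteness of
  \<open>V\<close> later makes the constant of the maximum principle uniform.\<close>

lemma dense_subset_finitely_transitive:
  assumes "e > 0" and dense: "T closure_of W = carrier G" and W: "W \<subseteq> carrier G"
  obtains V where "finite V" "V \<subseteq> W" "\<And>x y. \<exists>w\<in>V. orbit_close e (\<phi> w x) y"
proof -
  obtain D where D: "finite D" "\<And>x. \<exists>y\<in>D. orbit_close (e/3) y x"
    using orbit_close_net[of "e/3"] assms by auto
  have "\<exists>w. w \<in> W \<and> orbit_close (e/3) (\<phi> w x) y" for x y
    by (rule dense_subset_minimal[OF _ dense, of "e/3" x y]) (use assms(1) in auto)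
  then obtain w where w: "\<And>x y. w x y \<in> W" "\<And>x y. orbit_close (e/3) (\<phi> (w x y) x) y"
    by metis
  show thesis
  proof (rule that[of "case_prod w ` (D \<times> D)"])
    fix x y
    obtain x' y' where x': "x' \<in> D" "orbit_close (e/3) x' x" and y': "y' \<in> D" "orbit_close (e/3) y' y"
      using D by metis
    have "orbit_close (e/3) (\<phi> (w x' y') x) (\<phi> (w x' y') x')"
      using x'(2) w(1) W by (intro orbit_close_act) (auto simp: orbit_close_sym[of _ x])
    from orbit_close_trans[OF orbit_close_trans[OF this w(2)] y'(2)]
    have "orbit_close e (\<phi> (w x' y') x) y" by simp
    then show "\<exists>w\<in>case_prod w ` (D \<times> D). orbit_close e (\<phi> w x) y" using x' y' by blast
  qed (use D w in auto)
qed

end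

section \<open>Random iteration\<close>

text \<open>What is used of the group is condensed into \<open>close\<close>, the abstract form of
  \<open>orbit_close\<close>: it implies metric closeness, survives every symbol, has finite nets,
  and any point is carried close to any other by one of finitely many words. The letters must have
  positive probability, so that the random walk follows each word with positive probability.\<close>

locale random_iteration = sequence_space M for M :: "'a measure" +
  fixes act :: "'a \<Rightarrow> 'x::metric_space \<Rightarrow> 'x"
    and \<mu> :: "'x measure"
    and close :: "real \<Rightarrow> 'x \<Rightarrow> 'x \<Rightarrow> bool"
  assumes countable_symbols: "countable (space M)"
    and sets_symbols: "sets M = Pow (space M)"
    and prob_\<mu>: "prob_space \<mu>"
    and sets_\<mu>: "sets \<mu> = sets borel"
    and act_measurable: "a \<in> space M \<Longrightarrow> act a \<in> borel_measurable borel"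
    and act_invariant: "a \<in> space M \<Longrightarrow> distr \<mu> borel (act a) = \<mu>"
    and compact_UNIV: "compact (UNIV :: 'x set)"
    and close_dist: "close e x y \<Longrightarrow> dist x y < e"
    and act_close: "a \<in> space M \<Longrightarrow> close e x y \<Longrightarrow> close e (act a x) (act a y)"
    and close_net: "e > 0 \<Longrightarrow> \<exists>D. finite D \<and> (\<forall>x. \<exists>y\<in>D. close e y x)"
    and transitive: "e > 0 \<Longrightarrow> \<exists>V. finite V \<and> V \<subseteq> lists {a\<in>space M. measure M {a} > 0} \<and>
      (\<forall>x y. \<exists>w\<in>V. close e (foldr act w x) y)"
begin

abbreviation XS :: "('x \<times> (nat \<Rightarrow> 'a)) measure" where
  "XS \<equiv> borel \<Otimes>\<^sub>M S"

definition skew :: "'x \<times> (nat \<Rightarrow> 'a) \<Rightarrow> 'x \<times> (nat \<Rightarrow> 'a)" where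
  "skew = (\<lambda>(x, s). (act (s 0) x, \<lambda>n. s (Suc n)))"

text \<open>The Markov operator of the random walk that moves \<open>x\<close> by a symbol drawn
  from \<open>M\<close>.\<close>

definition transfer :: "('x \<Rightarrow> real) \<Rightarrow> 'x \<Rightarrow> real" where
  "transfer h x = (\<integral>a. h (act a x) \<partial>M)"

definition fibre_mean :: "('x \<times> (nat \<Rightarrow> 'a) \<Rightarrow> real) \<Rightarrow> 'x \<Rightarrow> real" where
  "fibre_mean f x = (\<integral>s. f (x, s) \<partial>S)"

sublocale MS: pair_prob_space M S
  by unfold_locales

sublocale \<mu>p: prob_space \<mu>
  by (rule prob_\<mu>)

sublocale \<mu>M: pair_prob_space \<mu> M
  by unfold_locales

lemma space_S_iff: "s \<in> space S \<longleftrightarrow> (\<forall>n. s n \<in> space M)"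
  by (auto simp: space_PiM)

lemma bounded_integrable:
  fixes f :: "'b \<Rightarrow> real"
  assumes "prob_space N" "f \<in> borel_measurable N" "\<And>z. \<bar>f z\<bar> \<le> C"
  shows "integrable N f"
proof -
  interpret prob_space N by fact
  show ?thesis using assms(2,3) by (intro integrable_const_bound[where B=C]) auto
qed

lemma bounded_integral:
  fixes f :: "'b \<Rightarrow> real"
  assumes N: "prob_space N" and "\<And>z. \<bar>f z\<bar> \<le> C"
  shows "\<bar>integral\<^sup>L N f\<bar> \<le> C"
proof (cases "integrable N f")
  case True
  interpret prob_space N by fact
  have "\<bar>integral\<^sup>L N f\<bar> \<le> (\<integral>z. \<bar>f z\<bar> \<partial>N)" by (rule integral_abs_bound)
  also have "\<dots> \<le> (\<integral>z. C \<partial>N)" using True assms(2) by (intro integral_mono) auto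
  finally show ?thesis by (simp add: prob_space)
next
  \<comment> \<open>A non-integrable function has integral 0 by convention, and
    \<open>C \<ge> 0\<close> because it bounds an absolute value.\<close>
  case False
  have "0 \<le> C" using assms(2) abs_ge_zero order_trans by blast
  then show ?thesis using False by (simp add: not_integrable_integral_eq)
qed

lemma measurable_symbols: "h \<in> borel_measurable M"
  for h :: "'a \<Rightarrow> real"
  by (rule measurableI) (auto simp: sets_symbols)

text \<open>There are countably many symbols and all sets of symbols are measurable, so joint
  measurability reduces to that of each single map.\<close>

lemma act_measurable_pair:
  "(\<lambda>z. act (snd z) (fst z)) \<in> (borel \<Otimes>\<^sub>M M) \<rightarrow>\<^sub>M borel"
proof (rule measurable_compose_countable'[where f="\<lambda>a z. act a (fst z)" and g=snd and I="space M"])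
  show "(\<lambda>z. act a (fst z)) \<in> borel \<Otimes>\<^sub>M M \<rightarrow>\<^sub>M borel" if "a \<in> space M" for a
    using act_measurable[OF that] by measurable
  have eq: "sets M = sets (count_space (space M))" by (simp add: sets_symbols)
  show "snd \<in> borel \<Otimes>\<^sub>M M \<rightarrow>\<^sub>M count_space (space M)"
    using measurable_snd[of borel M] by (simp only: measurable_cong_sets[OF refl eq])
qed (rule countable_symbols)

lemma skew_measurable [measurable]: "skew \<in> XS \<rightarrow>\<^sub>M XS"
proof -
  have "(\<lambda>z. (fst z, snd z 0)) \<in> XS \<rightarrow>\<^sub>M borel \<Otimes>\<^sub>M M" by measurable
  from measurable_compose[OF this act_measurable_pair]
  have 1: "(\<lambda>z. act (snd z 0) (fst z)) \<in> XS \<rightarrow>\<^sub>M borel" by simp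
  have 2: "(\<lambda>z n. snd z (Suc n)) \<in> XS \<rightarrow>\<^sub>M S"
    by (rule measurable_PiM_single') (auto simp: space_pair_measure space_PiM)
  show ?thesis
    using measurable_Pair[OF 1 2] by (simp add: skew_def case_prod_beta')
qed

lemma skew_funpow_measurable [measurable]: "skew ^^ n \<in> XS \<rightarrow>\<^sub>M XS"
  by (induction n) (auto simp: o_def intro: measurable_compose[OF _ skew_measurable])

lemma section_measurable:
  assumes "f \<in> borel_measurable XS"
  shows "(\<lambda>s. f (x, s)) \<in> borel_measurable S"
  using assms by measurable

lemma fibre_mean_measurable [measurable]:
  assumes "f \<in> borel_measurable XS"
  shows "fibre_mean f \<in> borel_measurable borel"
  unfolding fibre_mean_def using assms by (intro P.borel_measurable_lebesgue_integral) auto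

lemma transfer_measurable [measurable]:
  assumes "h \<in> borel_measurable borel"
  shows "transfer h \<in> borel_measurable borel"
  unfolding transfer_def using measurable_compose[OF act_measurable_pair assms]
  by (intro M.borel_measurable_lebesgue_integral) (simp add: case_prod_beta')

lemma transfer_bounded: "(\<And>x. \<bar>h x\<bar> \<le> C) \<Longrightarrow> \<bar>transfer h x\<bar> \<le> C"
  unfolding transfer_def by (rule bounded_integral[OF M.prob_space_axioms])

lemma fibre_mean_bounded: "(\<And>x. \<bar>f x\<bar> \<le> C) \<Longrightarrow> \<bar>fibre_mean f x\<bar> \<le> C"
  unfolding fibre_mean_def by (rule bounded_integral[OF P.prob_space_axioms])

lemma transfer_funpow_measurable [measurable]:
  "h \<in> borel_measurable borel \<Longrightarrow> (transfer ^^ n) h \<in> borel_measurable borel"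
  by (induction n) auto

lemma transfer_funpow_bounded: "(\<And>x. \<bar>h x\<bar> \<le> C) \<Longrightarrow> \<bar>(transfer ^^ n) h x\<bar> \<le> C"
  by (induction n arbitrary: x) (auto intro: transfer_bounded)

section \<open>The Markov property of the one-sided skew product\<close>

lemma integral_S_split:
  fixes v :: "(nat \<Rightarrow> 'a) \<Rightarrow> real"
  assumes v[measurable]: "v \<in> borel_measurable S" and C: "\<And>s. \<bar>v s\<bar> \<le> C"
  shows "(\<integral>s. v s \<partial>S) = (\<integral>a. (\<integral>s. v (case_nat a s) \<partial>S) \<partial>M)"
proof -
  have m: "(\<lambda>(a, s). case_nat a s) \<in> M \<Otimes>\<^sub>M S \<rightarrow>\<^sub>M S" by measurable
  have "(\<integral>s. v s \<partial>S) = (\<integral>s. v s \<partial>distr (M \<Otimes>\<^sub>M S) S (\<lambda>(a, s). case_nat a s))"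
    by (simp only: PiM_iter)
  also have "\<dots> = (\<integral>z. v (case_nat (fst z) (snd z)) \<partial>(M \<Otimes>\<^sub>M S))"
    by (subst integral_distr[OF m v]) (simp add: case_prod_beta')
  also have "\<dots> = (\<integral>a. (\<integral>s. v (case_nat a s) \<partial>S) \<partial>M)"
  proof -
    have "integrable (M \<Otimes>\<^sub>M S) (\<lambda>z. v (case_nat (fst z) (snd z)))"
      using C measurable_compose[OF m v]
      by (intro bounded_integrable[where C=C] MS.P.prob_space_axioms) (simp_all add: case_prod_beta')
    from MS.integral_fst'[OF this] show ?thesis by simp
  qed
  finally show ?thesis .
qed

text \<open>Drawing the first symbol separately turns one step of the skew map into one application
  of the Markov operator.\<close>

lemma fibre_mean_skew:
  assumes f: "f \<in> borel_measurable XS" and C: "\<And>z. \<bar>f z\<bar> \<le> C"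
  shows "fibre_mean (\<lambda>z. f (skew z)) x = transfer (fibre_mean f) x"
  unfolding fibre_mean_def transfer_def
  using section_measurable[OF measurable_compose[OF skew_measurable f]] C
  by (subst integral_S_split[where C=C]) (simp_all add: skew_def)

lemma fibre_mean_skew_funpow:
  assumes f: "f \<in> borel_measurable XS" and C: "\<And>z. \<bar>f z\<bar> \<le> C"
  shows "fibre_mean (\<lambda>z. f ((skew ^^ n) z)) x = (transfer ^^ n) (fibre_mean f) x"
proof (induction n arbitrary: x)
  case (Suc n)
  have m: "(\<lambda>z. f ((skew ^^ n) z)) \<in> borel_measurable XS" using f by measurable
  have "fibre_mean (\<lambda>z. f ((skew ^^ Suc n) z)) x = fibre_mean (\<lambda>z. f ((skew ^^ n) (skew z))) x"
    by (simp only: funpow_Suc_right o_def)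
  also have "\<dots> = transfer (fibre_mean (\<lambda>z. f ((skew ^^ n) z))) x"
    using fibre_mean_skew[OF m C] by simp
  also have "fibre_mean (\<lambda>z. f ((skew ^^ n) z)) = (transfer ^^ n) (fibre_mean f)"
    using Suc by blast
  finally show ?case by simp
qed simp

definition depends_on_prefix :: "nat \<Rightarrow> ((nat \<Rightarrow> 'a) \<Rightarrow> real) \<Rightarrow> bool" where
  "depends_on_prefix L v \<longleftrightarrow>
     (\<forall>s\<in>space S. \<forall>t\<in>space S. (\<forall>n<L. s n = t n) \<longrightarrow> v s = v t)"

text \<open>After \<open>L\<close> steps the remaining symbols are independent of the first
  \<open>L\<close>, and these alone determine \<open>v\<close> and the current point. Averaging over
  the remaining symbols replaces \<open>g\<close> by its fibre mean at that point.\<close>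

lemma markov_property:
  assumes v: "v \<in> borel_measurable S" "\<And>s. \<bar>v s\<bar> \<le> C" "depends_on_prefix L v"
    and g: "g \<in> borel_measurable XS" "\<And>z. \<bar>g z\<bar> \<le> D"
  shows "(\<integral>s. v s * g ((skew ^^ L) (x, s)) \<partial>S) = (\<integral>s. v s * fibre_mean g (fst ((skew ^^ L) (x, s))) \<partial>S)"
  using v
proof (induction L arbitrary: v x)
  case 0
  obtain s0 where s0: "s0 \<in> space S" using P.not_empty by (meson ex_in_conv)
  have eq: "v s = v s0" if "s \<in> space S" for s
    using 0(3) s0 that unfolding depends_on_prefix_def by blast
  have "(\<integral>s. v s * g ((skew ^^ 0) (x, s)) \<partial>S) = (\<integral>s. v s0 * g (x, s) \<partial>S)"
    by (rule Bochner_Integration.integral_cong) (simp_all add: eq)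
  also have "\<dots> = (\<integral>s. v s0 * fibre_mean g x \<partial>S)"
    by (simp add: fibre_mean_def P.prob_space)
  also have "\<dots> = (\<integral>s. v s * fibre_mean g (fst ((skew ^^ 0) (x, s))) \<partial>S)"
    by (rule Bochner_Integration.integral_cong) (simp_all add: eq)
  finally show ?case .
next
  case (Suc L)
  have D: "0 \<le> D" using g(2) abs_ge_zero order_trans by blast
  \<comment> \<open>Stated for every \<open>k\<close> bounded by \<open>D\<close>, since it serves
    both for \<open>g\<close> and for its fibre mean, regarded as a function of pairs.\<close>
  have split: "(\<integral>s. v s * k ((skew ^^ Suc L) (x, s)) \<partial>S) =
      (\<integral>a. (\<integral>s. v (case_nat a s) * k ((skew ^^ L) (act a x, s)) \<partial>S) \<partial>M)"
    if k: "k \<in> borel_measurable XS" "\<And>z. \<bar>k z\<bar> \<le> D" for k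
  proof -
    have "(\<lambda>s. v s * k ((skew ^^ Suc L) (x, s))) \<in> borel_measurable S"
      by (rule borel_measurable_times[OF Suc.prems(1)
            section_measurable[OF measurable_compose[OF skew_funpow_measurable k(1)]]])
    moreover have "\<bar>v s * k ((skew ^^ Suc L) (x, s))\<bar> \<le> C * D" for s
      unfolding abs_mult using Suc.prems(2)[of s] k(2) by (intro mult_mono) auto
    ultimately have "(\<integral>s. v s * k ((skew ^^ Suc L) (x, s)) \<partial>S) =
        (\<integral>a. (\<integral>s. v (case_nat a s) * k ((skew ^^ Suc L) (x, case_nat a s)) \<partial>S) \<partial>M)"
      by (rule integral_S_split)
    moreover have "(skew ^^ Suc L) (x, case_nat a s) = (skew ^^ L) (act a x, s)" for a s
      by (simp only: funpow_Suc_right o_def) (simp add: skew_def)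
    ultimately show ?thesis by (simp only:)
  qed
  have fm: "(\<lambda>z. fibre_mean g (fst z)) \<in> borel_measurable XS"
    using fibre_mean_measurable[OF g(1)] by measurable
  have "(\<integral>s. v (case_nat a s) * g ((skew ^^ L) (act a x, s)) \<partial>S) =
      (\<integral>s. v (case_nat a s) * fibre_mean g (fst ((skew ^^ L) (act a x, s))) \<partial>S)" if a: "a \<in> space M" for a
  proof (rule Suc.IH)
    show "(\<lambda>s. v (case_nat a s)) \<in> borel_measurable S"
      using a by (intro measurable_compose[OF _ Suc.prems(1)]) measurable
    show "depends_on_prefix L (\<lambda>s. v (case_nat a s))"
      unfolding depends_on_prefix_def
    proof (intro ballI impI)
      fix s t assume st: "s \<in> space S" "t \<in> space S" "\<forall>n<L. s n = t n"
      have "case_nat a s \<in> space S" "case_nat a t \<in> space S"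
        using a st by (auto simp: space_S_iff split: nat.splits)
      moreover have "\<forall>n<Suc L. case_nat a s n = case_nat a t n"
        using st by (auto split: nat.splits)
      ultimately show "v (case_nat a s) = v (case_nat a t)"
        using Suc.prems(3) unfolding depends_on_prefix_def by blast
    qed
  qed (rule Suc.prems(2))
  then show ?case
    unfolding split[OF g] split[OF fm fibre_mean_bounded[OF g(2)]]
    by (rule Bochner_Integration.integral_cong[OF refl])
qed

text \<open>\<open>\<mu>\<close> is stationary for the random walk: Fubini reduces this to
  invariance under each single symbol.\<close>

lemma integral_transfer:
  assumes h: "h \<in> borel_measurable borel" and C: "\<And>x. \<bar>h x\<bar> \<le> C"
  shows "(\<integral>x. transfer h x \<partial>\<mu>) = (\<integral>x. h x \<partial>\<mu>)"
proof -
  have "(\<lambda>(x, a). h (act a x)) \<in> borel_measurable (\<mu> \<Otimes>\<^sub>M M)"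
    using measurable_compose[OF act_measurable_pair h]
    by (subst measurable_cong_sets[OF sets_pair_measure_cong[OF sets_\<mu> refl] refl])
      (simp add: case_prod_beta')
  then have "integrable (\<mu> \<Otimes>\<^sub>M M) (\<lambda>(x, a). h (act a x))"
    using C by (intro bounded_integrable[where C=C] \<mu>M.P.prob_space_axioms) (auto split: prod.splits)
  from \<mu>M.Fubini_integral[OF this]
  have "(\<integral>x. transfer h x \<partial>\<mu>) = (\<integral>a. (\<integral>x. h (act a x) \<partial>\<mu>) \<partial>M)"
    by (simp add: transfer_def)
  also have "\<dots> = (\<integral>a. (\<integral>x. h x \<partial>\<mu>) \<partial>M)"
  proof (rule Bochner_Integration.integral_cong[OF refl])
    fix a assume a: "a \<in> space M"
    have "act a \<in> \<mu> \<rightarrow>\<^sub>M borel"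
      using act_measurable[OF a] measurable_cong_sets[OF sets_\<mu> refl] by blast
    from integral_distr[OF this h] show "(\<integral>x. h (act a x) \<partial>\<mu>) = (\<integral>x. h x \<partial>\<mu>)"
      by (simp add: act_invariant[OF a])
  qed
  finally show ?thesis by (simp add: M.prob_space)
qed

lemma integral_transfer_funpow:
  assumes h: "h \<in> borel_measurable borel" and C: "\<And>x. \<bar>h x\<bar> \<le> C"
  shows "(\<integral>x. (transfer ^^ n) h x \<partial>\<mu>) = (\<integral>x. h x \<partial>\<mu>)"
proof (induction n)
  case (Suc n)
  have "(\<integral>x. transfer ((transfer ^^ n) h) x \<partial>\<mu>) = (\<integral>x. (transfer ^^ n) h x \<partial>\<mu>)"
    using h transfer_funpow_bounded[of h C, OF C] by (intro integral_transfer) auto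
  then show ?case using Suc by simp
qed simp

subsection \<open>Uniform convergence of averages\<close>

text \<open>\<open>B - h\<close> is nonnegative, so its mean over all symbols is at least the
  contribution of the single symbol \<open>a\<close>.\<close>

lemma gap_step:
  assumes a: "a \<in> space M" and h: "\<And>x. \<bar>h x\<bar> \<le> C" "\<And>x. h x \<le> B"
  shows "measure M {a} * (B - h (act a x)) \<le> B - transfer h x"
proof -
  have int: "integrable M (\<lambda>b. h (act b x))"
    using h(1) by (intro bounded_integrable[where C=C] M.prob_space_axioms measurable_symbols)
  have a': "{a} \<in> sets M" using a by (simp add: sets_symbols)
  have "measure M {a} * (B - h (act a x)) = (\<integral>b. (B - h (act a x)) * indicator {a} b \<partial>M)"
    using a' by (simp add: Int_absorb1 sets.sets_into_space mult.commute)
  also have "\<dots> \<le> (\<integral>b. B - h (act b x) \<partial>M)"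
  proof (rule integral_mono)
    show "integrable M (\<lambda>b. (B - h (act a x)) * indicator {a} b)"
      using a' by (intro integrable_mult_right integrable_real_indicator) (simp_all add: M.emeasure_eq_measure)
    show "integrable M (\<lambda>b. B - h (act b x))" using int by simp
    show "(B - h (act a x)) * indicator {a} b \<le> B - h (act b x)" for b
      using h(2)[of "act b x"] by (auto simp: indicator_def)
  qed
  also have "\<dots> = B - transfer h x"
    using int by (simp add: transfer_def M.prob_space)
  finally show ?thesis .
qed

text \<open>The maximum principle in quantitative form; \<open>K\<close> depends on the word alone.\<close>

lemma gap_word:
  assumes "w \<in> lists {a\<in>space M. measure M {a} > 0}"
  shows "\<exists>K\<ge>0. \<forall>h C B \<eta> x. (\<forall>x. \<bar>h x\<bar> \<le> C \<and> h x \<le> B \<and> h x - \<eta> \<le> transfer h x) \<longrightarrow> \<eta> \<ge> 0 \<longrightarrow>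
    B - h (foldr act w x) \<le> K * (B - h x + \<eta>)"
  using assms
proof (induction w)
  case Nil
  show ?case by (rule exI[of _ 1]) simp
next
  case (Cons a w)
  have a: "a \<in> space M" "measure M {a} > 0" using Cons.hyps by auto
  obtain K where K: "K \<ge> 0" "\<And>h C B \<eta> x. (\<forall>x. \<bar>h x\<bar> \<le> C \<and> h x \<le> B \<and> h x - \<eta> \<le> transfer h x) \<Longrightarrow>
    \<eta> \<ge> 0 \<Longrightarrow> B - h (foldr act w x) \<le> K * (B - h x + \<eta>)"
    using Cons.IH by blast
  show ?case
  \<comment> \<open>\<open>foldr\<close> applies \<open>a\<close> last. This step costs an
    additional \<open>\<eta>\<close> and the factor \<open>1 / measure M {a}\<close>; the 1 in
    \<open>K + 1\<close> absorbs that \<open>\<eta>\<close>, because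
    \<open>h x \<le> B\<close>.\<close>
  proof (rule exI[of _ "(K + 1) / measure M {a}"], intro conjI allI impI)
    show "0 \<le> (K + 1) / measure M {a}" using K(1) by simp
    fix h C B \<eta> x
    assume h: "\<forall>x. \<bar>h x\<bar> \<le> C \<and> h x \<le> B \<and> h x - \<eta> \<le> transfer h x" and \<eta>: "0 \<le> \<eta>"
    let ?y = "foldr act w x"
    have "measure M {a} * (B - h (act a ?y)) \<le> B - transfer h ?y"
      using h by (intro gap_step[OF a(1), where C=C]) auto
    also have "\<dots> \<le> B - h ?y + \<eta>"
    proof -
      have "h ?y - \<eta> \<le> transfer h ?y" using h by blast
      then show ?thesis by simp
    qed
    also have "\<dots> \<le> K * (B - h x + \<eta>) + \<eta>"
      using K(2)[OF h \<eta>, of x] by simp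
    also have "\<dots> \<le> K * (B - h x + \<eta>) + (B - h x + \<eta>)"
    proof -
      have "h x \<le> B" using h by blast
      then show ?thesis by simp
    qed
    finally have "measure M {a} * (B - h (act a ?y)) \<le> (K + 1) * (B - h x + \<eta>)"
      by (simp add: algebra_simps)
    then have "B - h (act a ?y) \<le> (K + 1) * (B - h x + \<eta>) / measure M {a}"
      using a(2) by (simp add: pos_le_divide_eq mult.commute)
    then show "B - h (foldr act (a # w) x) \<le> (K + 1) / measure M {a} * (B - h x + \<eta>)"
      by simp
  qed
qed

text \<open>From a point almost at the supremum, one of finitely many words leads close to any
  prescribed point, and along it the gap to the supremum grows by a bounded factor only. The order
  of quantifiers matters: \<open>K\<close> depends on \<open>\<delta>\<close> and not on
  \<open>h\<close>, so one \<open>K\<close> serves averages of every length.\<close>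

lemma almost_subharmonic_oscillation:
  assumes "\<delta> > 0"
  obtains K where "K \<ge> 0"
    "\<And>h C \<eta> \<epsilon> x y. (\<And>x. \<bar>h x\<bar> \<le> C) \<Longrightarrow> (\<And>x y. close \<delta> x y \<Longrightarrow> \<bar>h x - h y\<bar> \<le> \<epsilon>) \<Longrightarrow>
      (\<And>x. h x - \<eta> \<le> transfer h x) \<Longrightarrow> \<eta> > 0 \<Longrightarrow> h x - h y \<le> K * \<eta> + \<epsilon>"
proof -
  obtain V where V: "finite V" "V \<subseteq> lists {a\<in>space M. measure M {a} > 0}"
    "\<And>x y. \<exists>w\<in>V. close \<delta> (foldr act w x) y"
    using transitive[OF assms] by blast
  have "\<forall>w\<in>V. \<exists>K\<ge>0. \<forall>h C B \<eta> x. (\<forall>x. \<bar>h x\<bar> \<le> C \<and> h x \<le> B \<and> h x - \<eta> \<le> transfer h x) \<longrightarrow> \<eta> \<ge> 0 \<longrightarrow>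
    B - h (foldr act w x) \<le> K * (B - h x + \<eta>)"
    using gap_word V(2) by blast
  then obtain k where k: "\<forall>w\<in>V. k w \<ge> 0 \<and> (\<forall>h C B \<eta> x.
    (\<forall>x. \<bar>h x\<bar> \<le> C \<and> h x \<le> B \<and> h x - \<eta> \<le> transfer h x) \<longrightarrow> \<eta> \<ge> 0 \<longrightarrow>
    B - h (foldr act w x) \<le> k w * (B - h x + \<eta>))"
    unfolding bchoice_iff ..
  define K where "K = sum k V"
  have K0: "K \<ge> 0" unfolding K_def using k by (intro sum_nonneg) auto
  have kK: "k w \<le> K" if "w \<in> V" for w
    unfolding K_def using that k V(1) by (intro member_le_sum) auto
  show thesis
  proof (rule that[of "2 * K"])
    fix h C \<eta> \<epsilon> x y
    assume h: "\<And>x. \<bar>h x\<bar> \<le> C" "\<And>x y. close \<delta> x y \<Longrightarrow> \<bar>h x - h y\<bar> \<le> \<epsilon>"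
      "\<And>x. h x - \<eta> \<le> transfer h x" "\<eta> > 0"
    define B where "B = (SUP x. h x)"
    have bdd: "bdd_above (range h)"
      using h(1) by (intro bdd_aboveI[of _ C]) (auto simp: abs_le_iff)
    have B: "h x \<le> B" for x unfolding B_def by (rule cSUP_upper[OF _ bdd]) simp
    have "B - \<eta> < (SUP x. h x)" using h(4) by (simp add: B_def)
    \<comment> \<open>The supremum need not be attained. At a point within \<open>\<eta>\<close> of
      it the gap plus \<open>\<eta>\<close> is at most \<open>2 * \<eta>\<close>, whence the factor
      2 in the constant.\<close>
    then obtain z where z: "B - \<eta> < h z" using less_cSUP_iff[OF _ bdd] by auto
    obtain w where w: "w \<in> V" "close \<delta> (foldr act w z) y" using V(3) by blast
    have "B - h (foldr act w z) \<le> k w * (B - h z + \<eta>)"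
      using k w(1) h B by (metis less_imp_le)
    also have "\<dots> \<le> K * (2 * \<eta>)"
      using kK[OF w(1)] z K0 h(4) B[of z] by (intro mult_mono) auto
    finally show "h x - h y \<le> 2 * K * \<eta> + \<epsilon>"
      using h(2)[OF w(2)] B[of x] by (simp add: abs_le_iff)
  qed (use K0 in simp)
qed

definition close_continuous :: "('x \<Rightarrow> real) \<Rightarrow> bool" where
  "close_continuous h \<longleftrightarrow> (\<forall>\<epsilon>>0. \<exists>\<delta>>0. \<forall>x y. close \<delta> x y \<longrightarrow> \<bar>h x - h y\<bar> \<le> \<epsilon>)"

lemma transfer_modulus:
  assumes h: "\<And>x. \<bar>h x\<bar> \<le> C" and m: "\<And>x y. close \<delta> x y \<Longrightarrow> \<bar>h x - h y\<bar> \<le> \<epsilon>"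
    and xy: "close \<delta> x y"
  shows "\<bar>transfer h x - transfer h y\<bar> \<le> \<epsilon>"
proof -
  have int: "integrable M (\<lambda>b. h (act b x))" for x
    using h by (intro bounded_integrable[where C=C] M.prob_space_axioms measurable_symbols)
  have "\<bar>transfer h x - transfer h y\<bar> = \<bar>\<integral>a. h (act a x) - h (act a y) \<partial>M\<bar>"
    unfolding transfer_def using int by simp
  also have "\<dots> \<le> (\<integral>a. \<bar>h (act a x) - h (act a y)\<bar> \<partial>M)" by (rule integral_abs_bound)
  also have "\<dots> \<le> (\<integral>a. \<epsilon> \<partial>M)"
    using int m act_close xy by (intro integral_mono) auto
  finally show ?thesis by (simp add: M.prob_space)
qed

lemma transfer_sum:
  assumes "\<And>k x. \<bar>h k x\<bar> \<le> (C::real)"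
  shows "transfer (\<lambda>x. c * (\<Sum>k<n. h k x)) x = c * (\<Sum>k<n. transfer (h k) x)"
proof -
  have int: "integrable M (\<lambda>b. h k (act b x))" for k
    using assms by (intro bounded_integrable[where C=C] M.prob_space_axioms measurable_symbols)
  show ?thesis unfolding transfer_def using int by simp
qed

text \<open>The average \<open>H\<close> of \<open>n\<close> iterates is almost invariant, since
  \<open>transfer H - H\<close> telescopes to a boundary term of order \<open>1 / n\<close>, and it
  shares the modulus of continuity of \<open>h\<close>. So its oscillation is small, while its mean
  over \<open>\<mu>\<close> is that of \<open>h\<close>. Multiplication by \<open>n\<close> turns
  the boundary term into a constant.\<close>

lemma transfer_averages:
  assumes h: "h \<in> borel_measurable borel" "\<And>x. \<bar>h x\<bar> \<le> C" "close_continuous h" and "\<epsilon> > 0"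
  obtains A where "A \<ge> 0"
    "\<And>n x. \<bar>(\<Sum>k<n. (transfer ^^ k) h x) - real n * (\<integral>x. h x \<partial>\<mu>)\<bar> \<le> A + \<epsilon> * real n"
proof -
  obtain \<delta> where \<delta>: "\<delta> > 0" "\<And>x y. close \<delta> x y \<Longrightarrow> \<bar>h x - h y\<bar> \<le> \<epsilon>"
    using h(3) \<open>\<epsilon> > 0\<close> unfolding close_continuous_def by metis
  obtain K where K: "K \<ge> 0"
    "\<And>h C \<eta> \<epsilon> x y. (\<And>x. \<bar>h x\<bar> \<le> C) \<Longrightarrow> (\<And>x y. close \<delta> x y \<Longrightarrow> \<bar>h x - h y\<bar> \<le> \<epsilon>) \<Longrightarrow>
      (\<And>x. h x - \<eta> \<le> transfer h x) \<Longrightarrow> \<eta> > 0 \<Longrightarrow> h x - h y \<le> K * \<eta> + \<epsilon>"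
    by (rule almost_subharmonic_oscillation[OF \<delta>(1)]) blast
  have C: "0 \<le> C" using h(2) abs_ge_zero order_trans by blast
  note b = transfer_funpow_bounded[of h C, OF h(2)]
  \<comment> \<open>One \<open>\<delta>\<close> serves all iterates, because every symbol preserves
    \<open>close \<delta>\<close>.\<close>
  have m: "\<bar>(transfer ^^ k) h x - (transfer ^^ k) h y\<bar> \<le> \<epsilon>" if "close \<delta> x y" for k x y
    using that
  proof (induction k arbitrary: x y)
    case (Suc k)
    show ?case using transfer_modulus[OF b Suc.IH Suc.prems] by simp
  qed (use \<delta>(2) in simp)
  have main: "\<bar>(\<Sum>k<n. (transfer ^^ k) h x) - real n * (\<integral>x. h x \<partial>\<mu>)\<bar> \<le> K * (2 * C + 1) + \<epsilon> * real n"
    if n: "n > 0" for n x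
  proof -
    define H where "H x = (1 / real n) * (\<Sum>k<n. (transfer ^^ k) h x)" for x
    \<comment> \<open>The boundary term is at most \<open>2 * C / n\<close>; the added 1 keeps
      \<open>\<eta>\<close> positive when \<open>C = 0\<close>.\<close>
    define \<eta> where "\<eta> = (2 * C + 1) / real n"
    have \<eta>: "\<eta> > 0" using C n by (simp add: \<eta>_def)
    have Hb: "\<bar>H x\<bar> \<le> C" for x
    proof -
      have "\<bar>\<Sum>k<n. (transfer ^^ k) h x\<bar> \<le> (\<Sum>k<n. C)"
        by (rule order_trans[OF sum_abs sum_mono]) (rule b)
      then show ?thesis using n by (simp add: H_def abs_mult field_simps)
    qed
    have Hm: "\<bar>H x - H y\<bar> \<le> \<epsilon>" if "close \<delta> x y" for x y
    proof -
      have "\<bar>\<Sum>k<n. (transfer ^^ k) h x - (transfer ^^ k) h y\<bar> \<le> (\<Sum>k<n. \<epsilon>)"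
        by (rule order_trans[OF sum_abs sum_mono]) (rule m[OF that])
      moreover have "H x - H y = (1 / real n) * (\<Sum>k<n. (transfer ^^ k) h x - (transfer ^^ k) h y)"
        by (simp add: H_def sum_subtractf algebra_simps)
      moreover have "\<bar>(1 / real n) * t\<bar> \<le> \<epsilon>" if "\<bar>t\<bar> \<le> (\<Sum>k<n. \<epsilon>)" for t :: real
        using that n by (simp add: abs_mult field_simps)
      ultimately show ?thesis by simp
    qed
    have HP: "H x - \<eta> \<le> transfer H x" for x
    proof -
      have "transfer H x = (1 / real n) * (\<Sum>k<n. (transfer ^^ Suc k) h x)"
        unfolding H_def using transfer_sum[of "\<lambda>k. (transfer ^^ k) h" C "1 / real n" n x] b by simp
      then have "transfer H x - H x = (1 / real n) * (\<Sum>k<n. (transfer ^^ Suc k) h x - (transfer ^^ k) h x)"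
        by (simp add: H_def sum_subtractf algebra_simps)
      also have "\<dots> = (1 / real n) * ((transfer ^^ n) h x - h x)"
        by (subst sum_lessThan_telescope) simp
      also have "\<dots> \<ge> (1 / real n) * - (2 * C + 1)"
        using b[of n x] h(2)[of x] by (intro mult_left_mono) (auto simp: abs_le_iff)
      finally show ?thesis by (simp add: \<eta>_def diff_divide_distrib add_divide_distrib)
    qed
    have osc: "H x - H y \<le> K * \<eta> + \<epsilon>" for x y by (rule K(2)[OF Hb Hm HP \<eta>])
    have fb: "(transfer ^^ k) h \<in> borel_measurable \<mu>" for k
      using transfer_funpow_measurable[OF h(1)] measurable_cong_sets[OF sets_\<mu> refl] by blast
    have fi: "integrable \<mu> ((transfer ^^ k) h)" for k
      by (rule bounded_integrable[OF prob_\<mu> fb b])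
    have "(\<integral>x. H x \<partial>\<mu>) = (1 / real n) * (\<Sum>k<n. \<integral>x. (transfer ^^ k) h x \<partial>\<mu>)"
      unfolding H_def using fi by simp
    also have "\<dots> = (\<integral>x. h x \<partial>\<mu>)"
      using integral_transfer_funpow[OF h(1,2)] n by simp
    finally have mean: "(\<integral>x. H x \<partial>\<mu>) = (\<integral>x. h x \<partial>\<mu>)" .
    have Hi: "integrable \<mu> H" unfolding H_def using fi by simp
    \<comment> \<open>Averaging the oscillation bound over \<open>y\<close> compares
      \<open>H x\<close> with the mean of \<open>H\<close>.\<close>
    have "(\<integral>y. H x - H y \<partial>\<mu>) \<le> (\<integral>y. K * \<eta> + \<epsilon> \<partial>\<mu>)" "(\<integral>y. H y - H x \<partial>\<mu>) \<le> (\<integral>y. K * \<eta> + \<epsilon> \<partial>\<mu>)"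
      by (rule integral_mono; use Hi osc in simp)+
    then have "\<bar>H x - (\<integral>x. h x \<partial>\<mu>)\<bar> \<le> K * \<eta> + \<epsilon>"
      using Hi by (simp add: mean \<mu>p.prob_space abs_le_iff)
    then have "real n * \<bar>H x - (\<integral>x. h x \<partial>\<mu>)\<bar> \<le> real n * (K * \<eta> + \<epsilon>)"
      by (rule mult_left_mono) simp
    moreover have "real n * \<bar>H x - (\<integral>x. h x \<partial>\<mu>)\<bar> = \<bar>(\<Sum>k<n. (transfer ^^ k) h x) - real n * (\<integral>x. h x \<partial>\<mu>)\<bar>"
      using n by (subst abs_of_nat[symmetric, of n], subst abs_mult[symmetric])
        (simp add: H_def algebra_simps)
    moreover have "real n * (K * \<eta> + \<epsilon>) = K * (2 * C + 1) + \<epsilon> * real n"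
      using n by (simp add: \<eta>_def field_simps)
    ultimately show ?thesis by simp
  qed
  show thesis
  proof (rule that[of "K * (2 * C + 1)"])
    show "0 \<le> K * (2 * C + 1)" using K(1) C by simp
    show "\<bar>(\<Sum>k<n. (transfer ^^ k) h x) - real n * (\<integral>x. h x \<partial>\<mu>)\<bar> \<le> K * (2 * C + 1) + \<epsilon> * real n" for n x
      using main[of n x] \<open>0 \<le> K * (2 * C + 1)\<close> by (cases "n = 0") auto
  qed
qed

subsection \<open>Second moments of Birkhoff sums\<close>

text \<open>The modulus of continuity is uniform in the symbols and expressed by
  \<open>close\<close> rather than by the metric; in this form it persists along orbits driven by a
  common sequence of symbols.\<close>

definition test_function :: "('x \<times> (nat \<Rightarrow> 'a) \<Rightarrow> real) \<Rightarrow> bool" where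
  "test_function f \<longleftrightarrow>
     f \<in> borel_measurable XS \<and> (\<exists>C. \<forall>z. \<bar>f z\<bar> \<le> C) \<and>
     (\<exists>L. \<forall>x. depends_on_prefix L (\<lambda>s. f (x, s))) \<and>
     (\<forall>\<epsilon>>0. \<exists>\<delta>>0. \<forall>x y. close \<delta> x y \<longrightarrow> (\<forall>s\<in>space S. \<bar>f (x, s) - f (y, s)\<bar> \<le> \<epsilon>))"

lemma fibre_mean_close_continuous:
  assumes "test_function f"
  shows "close_continuous (fibre_mean f)"
  unfolding close_continuous_def
proof (intro allI impI)
  fix \<epsilon> :: real assume "\<epsilon> > 0"
  then obtain \<delta> where \<delta>: "\<delta> > 0" "\<And>x y s. close \<delta> x y \<Longrightarrow> s \<in> space S \<Longrightarrow> \<bar>f (x, s) - f (y, s)\<bar> \<le> \<epsilon>"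
    using assms unfolding test_function_def by metis
  obtain C where C: "\<And>z. \<bar>f z\<bar> \<le> C" and m: "f \<in> borel_measurable XS"
    using assms unfolding test_function_def by blast
  have int: "integrable S (\<lambda>s. f (x, s))" for x
    using C section_measurable[OF m] by (intro bounded_integrable[where C=C] P.prob_space_axioms)
  have "\<bar>fibre_mean f x - fibre_mean f y\<bar> \<le> \<epsilon>" if "close \<delta> x y" for x y
  proof -
    have "\<bar>fibre_mean f x - fibre_mean f y\<bar> = \<bar>\<integral>s. f (x, s) - f (y, s) \<partial>S\<bar>"
      unfolding fibre_mean_def using int by simp
    also have "\<dots> \<le> (\<integral>s. \<bar>f (x, s) - f (y, s)\<bar> \<partial>S)" by (rule integral_abs_bound)
    also have "\<dots> \<le> (\<integral>s. \<epsilon> \<partial>S)"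
      using int \<delta>(2)[OF that] by (intro integral_mono) auto
    finally show ?thesis by (simp add: P.prob_space)
  qed
  then show "\<exists>\<delta>>0. \<forall>x y. close \<delta> x y \<longrightarrow> \<bar>fibre_mean f x - fibre_mean f y\<bar> \<le> \<epsilon>"
    using \<delta>(1) by blast
qed

definition birkhoff_sum :: "('x \<times> (nat \<Rightarrow> 'a) \<Rightarrow> real) \<Rightarrow> nat \<Rightarrow> 'x \<times> (nat \<Rightarrow> 'a) \<Rightarrow> real" where
  "birkhoff_sum f n z = (\<Sum>k<n. f ((skew ^^ k) z))"

lemma birkhoff_sum_Suc: "birkhoff_sum f (Suc n) z = f z + birkhoff_sum f n (skew z)"
  unfolding birkhoff_sum_def sum.lessThan_Suc_shift by (simp add: funpow_swap1)

lemma birkhoff_sum_add: "birkhoff_sum f (m + n) z = birkhoff_sum f m z + birkhoff_sum f n ((skew ^^ m) z)"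
proof (induction n)
  case (Suc n)
  have "(skew ^^ (m + n)) z = (skew ^^ n) ((skew ^^ m) z)"
    by (subst add.commute) (simp add: funpow_add)
  then show ?case using Suc by (simp add: birkhoff_sum_def)
qed (simp add: birkhoff_sum_def)

lemma birkhoff_sum_measurable [measurable]:
  "f \<in> borel_measurable XS \<Longrightarrow> birkhoff_sum f n \<in> borel_measurable XS"
  unfolding birkhoff_sum_def[abs_def]
  by (intro borel_measurable_sum measurable_compose[OF skew_funpow_measurable])

lemma birkhoff_sum_bounded:
  assumes "\<And>z. \<bar>f z\<bar> \<le> C"
  shows "\<bar>birkhoff_sum f n z\<bar> \<le> real n * C"
proof -
  have "\<bar>birkhoff_sum f n z\<bar> \<le> (\<Sum>k<n. C)"
    unfolding birkhoff_sum_def by (rule order_trans[OF sum_abs sum_mono]) (rule assms)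
  then show ?thesis by simp
qed

lemma fibre_mean_birkhoff_sum:
  assumes f: "f \<in> borel_measurable XS" "\<And>z. \<bar>f z\<bar> \<le> C"
  shows "fibre_mean (birkhoff_sum f n) x = (\<Sum>k<n. (transfer ^^ k) (fibre_mean f) x)"
proof -
  have "integrable S (\<lambda>s. f ((skew ^^ k) (x, s)))" for k
    by (rule bounded_integrable[OF P.prob_space_axioms
          section_measurable[OF measurable_compose[OF skew_funpow_measurable f(1)]] f(2)])
  then have "fibre_mean (birkhoff_sum f n) x = (\<Sum>k<n. fibre_mean (\<lambda>z. f ((skew ^^ k) z)) x)"
    by (simp add: fibre_mean_def birkhoff_sum_def)
  then show ?thesis by (simp add: fibre_mean_skew_funpow[OF f])
qed

text \<open>The first \<open>L\<close> terms of the sum may share symbols with \<open>f\<close> and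
  are bounded trivially. Later terms see only fresh symbols, so the Markov property turns them into
  sums of iterates of the Markov operator, which are small relative to \<open>n\<close> because the
  mean is zero.\<close>

lemma correlation_bound:
  assumes f: "test_function f" and mean0: "(\<integral>x. fibre_mean f x \<partial>\<mu>) = 0" and \<epsilon>: "\<epsilon> > 0"
  obtains A where "A \<ge> 0"
    "\<And>n x. \<bar>\<integral>s. f (x, s) * birkhoff_sum f n (skew (x, s)) \<partial>S\<bar> \<le> A + \<epsilon> * real n"
proof -
  obtain C where C: "\<And>z. \<bar>f z\<bar> \<le> C" and m: "f \<in> borel_measurable XS"
    using f unfolding test_function_def by blast
  obtain L where L: "\<And>x. depends_on_prefix L (\<lambda>s. f (x, s))"
    using f unfolding test_function_def by blast
  have C0: "0 \<le> C" using C abs_ge_zero order_trans by blast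
  \<comment> \<open>The Birkhoff sum starts one step late, at \<open>skew (x, s)\<close>. Past its
    first \<open>L\<close> terms the point is \<open>(skew ^^ Suc L) (x, s)\<close>, so
    \<open>Suc L\<close> symbols are conditioned on.\<close>
  have L': "depends_on_prefix (Suc L) (\<lambda>s. f (x, s))" for x
    using L[of x] unfolding depends_on_prefix_def by (meson less_SucI)
  \<comment> \<open>The bound obtained with this constant is later multiplied by \<open>C\<close>, a
    bound for \<open>f\<close>; the 1 allows for \<open>C = 0\<close>.\<close>
  have eps: "\<epsilon> / (C + 1) > 0" using \<epsilon> C0 by simp
  obtain A where A: "A \<ge> 0"
    "\<And>n x. \<bar>(\<Sum>k<n. (transfer ^^ k) (fibre_mean f) x) - real n * (\<integral>x. fibre_mean f x \<partial>\<mu>)\<bar> \<le> A + \<epsilon> / (C + 1) * real n"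
    by (rule transfer_averages[OF fibre_mean_measurable[OF m] fibre_mean_bounded[of f C, OF C]
          fibre_mean_close_continuous[OF f] eps]) blast
  have A': "\<bar>fibre_mean (birkhoff_sum f n) x\<bar> \<le> A + \<epsilon> / (C + 1) * real n" for n x
    using A(2)[of x n] by (simp add: mean0 fibre_mean_birkhoff_sum[OF m C])
  have short: "\<bar>\<integral>s. f (x, s) * birkhoff_sum f n (skew (x, s)) \<partial>S\<bar> \<le> C * (real n * C)" for n x
  proof (rule bounded_integral[OF P.prob_space_axioms])
    show "\<bar>f (x, s) * birkhoff_sum f n (skew (x, s))\<bar> \<le> C * (real n * C)" for s
      unfolding abs_mult using C birkhoff_sum_bounded[of f C, OF C] C0 by (intro mult_mono) auto
  qed
  have long: "\<bar>\<integral>s. f (x, s) * birkhoff_sum f n ((skew ^^ Suc L) (x, s)) \<partial>S\<bar> \<le> C * (A + \<epsilon> / (C + 1) * real n)" for n x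
  proof -
    have "(\<integral>s. f (x, s) * birkhoff_sum f n ((skew ^^ Suc L) (x, s)) \<partial>S) =
        (\<integral>s. f (x, s) * fibre_mean (birkhoff_sum f n) (fst ((skew ^^ Suc L) (x, s))) \<partial>S)"
      by (rule markov_property[OF section_measurable[OF m] C L' birkhoff_sum_measurable[OF m] birkhoff_sum_bounded[of f C, OF C]])
    also have "\<bar>\<dots>\<bar> \<le> C * (A + \<epsilon> / (C + 1) * real n)"
    proof (rule bounded_integral[OF P.prob_space_axioms])
      show "\<bar>f (x, s) * fibre_mean (birkhoff_sum f n) (fst ((skew ^^ Suc L) (x, s)))\<bar>
          \<le> C * (A + \<epsilon> / (C + 1) * real n)" for s
        unfolding abs_mult using C A' C0 by (intro mult_mono) auto
    qed
    finally show ?thesis .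
  qed
  have CA: "C * (\<epsilon> / (C + 1) * real n) \<le> \<epsilon> * real n" for n
  proof -
    have "C / (C + 1) * (\<epsilon> * real n) \<le> 1 * (\<epsilon> * real n)"
      using C0 \<epsilon> by (intro mult_right_mono) auto
    then show ?thesis by simp
  qed
  show thesis
  proof (rule that[of "C * (real L * C) + C * A"])
    show "0 \<le> C * (real L * C) + C * A" using C0 A(1) by simp
    fix n x
    show "\<bar>\<integral>s. f (x, s) * birkhoff_sum f n (skew (x, s)) \<partial>S\<bar> \<le> C * (real L * C) + C * A + \<epsilon> * real n"
    proof (cases "n < L")
      case True
      then have "C * (real n * C) \<le> C * (real L * C)"
        using C0 by (intro mult_left_mono mult_right_mono) auto
      then show ?thesis using short[of x n] C0 A(1) \<epsilon> by (smt (verit) mult_nonneg_nonneg of_nat_0_le_iff)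
    next
      case False
      then obtain k where k: "n = L + k" using le_Suc_ex not_less by blast
      have int: "integrable S (\<lambda>s. f (x, s) * birkhoff_sum f L (skew (x, s)))"
        "integrable S (\<lambda>s. f (x, s) * birkhoff_sum f k ((skew ^^ Suc L) (x, s)))"
      proof -
        have b: "\<bar>f z * birkhoff_sum f j z'\<bar> \<le> C * (real j * C)" for j z z'
          unfolding abs_mult using C birkhoff_sum_bounded[of f C, OF C] C0 by (intro mult_mono) auto
        have 1: "(\<lambda>z. f z * birkhoff_sum f L (skew z)) \<in> borel_measurable XS"
          using m by measurable
        show "integrable S (\<lambda>s. f (x, s) * birkhoff_sum f L (skew (x, s)))"
          using section_measurable[OF 1] b by (rule bounded_integrable[OF P.prob_space_axioms])
        have 2: "(\<lambda>z. f z * birkhoff_sum f k ((skew ^^ Suc L) z)) \<in> borel_measurable XS"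
          by (rule borel_measurable_times[OF m measurable_compose[OF skew_funpow_measurable birkhoff_sum_measurable[OF m]]])
        show "integrable S (\<lambda>s. f (x, s) * birkhoff_sum f k ((skew ^^ Suc L) (x, s)))"
          using section_measurable[OF 2] b by (rule bounded_integrable[OF P.prob_space_axioms])
      qed
      have "(\<integral>s. f (x, s) * birkhoff_sum f n (skew (x, s)) \<partial>S) =
          (\<integral>s. f (x, s) * birkhoff_sum f L (skew (x, s)) + f (x, s) * birkhoff_sum f k ((skew ^^ Suc L) (x, s)) \<partial>S)"
        by (simp add: k birkhoff_sum_add funpow_swap1 algebra_simps)
      also have "\<dots> = (\<integral>s. f (x, s) * birkhoff_sum f L (skew (x, s)) \<partial>S) +
          (\<integral>s. f (x, s) * birkhoff_sum f k ((skew ^^ Suc L) (x, s)) \<partial>S)"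
        by (rule Bochner_Integration.integral_add[OF int])
      also have "\<bar>\<dots>\<bar> \<le> C * (real L * C) + C * (A + \<epsilon> / (C + 1) * real k)"
        using short[of x L] long[of x k] by linarith
      also have "\<dots> \<le> C * (real L * C) + C * A + \<epsilon> * real n"
      proof -
        have "\<epsilon> * real k \<le> \<epsilon> * real n" using \<epsilon> by (simp add: k)
        then show ?thesis using CA[of k] by (simp only: distrib_left)
      qed
      finally show ?thesis .
    qed
  qed
qed

text \<open>Splitting off the first summand gives a recursion in \<open>n\<close>. The square of the
  rest is an average of the same quantity at the next point, so a bound uniform in \<open>x\<close>
  passes through; the cross term contributes a constant plus \<open>\<epsilon> * n\<close>, and such
  increments sum to at most \<open>\<epsilon> * n\<^sup>2\<close> plus a linear term.\<close>

lemma second_moment_bound: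
  assumes f: "test_function f" and mean0: "(\<integral>x. fibre_mean f x \<partial>\<mu>) = 0" and \<epsilon>: "\<epsilon> > 0"
  obtains A where "A \<ge> 0"
    "\<And>n x. (\<integral>s. (birkhoff_sum f n (x, s))\<^sup>2 \<partial>S) \<le> A * real n + \<epsilon> * (real n)\<^sup>2"
proof -
  obtain C where C: "\<And>z. \<bar>f z\<bar> \<le> C" and m: "f \<in> borel_measurable XS"
    using f unfolding test_function_def by blast
  \<comment> \<open>Half of \<open>\<epsilon>\<close>, because the cross term occurs twice in the
    square.\<close>
  have e2: "\<epsilon> / 2 > 0" using \<epsilon> by simp
  obtain A where A: "A \<ge> 0"
    "\<And>n x. \<bar>\<integral>s. f (x, s) * birkhoff_sum f n (skew (x, s)) \<partial>S\<bar> \<le> A + \<epsilon> / 2 * real n"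
    by (rule correlation_bound[OF f mean0 e2]) blast
  have sq: "(birkhoff_sum f n z)\<^sup>2 \<le> (real n * C)\<^sup>2" for n z
    using birkhoff_sum_bounded[of f C n z, OF C] by (simp add: abs_le_square_iff[symmetric])
  have "(\<integral>s. (birkhoff_sum f n (x, s))\<^sup>2 \<partial>S) \<le> (C\<^sup>2 + 2 * A) * real n + \<epsilon> * (real n)\<^sup>2" for n x
  proof (induction n arbitrary: x)
    case 0
    show ?case by (simp add: birkhoff_sum_def)
  next
    case (Suc n)
    let ?B = "\<lambda>s. birkhoff_sum f n (skew (x, s))"
    have Bm: "(\<lambda>z. birkhoff_sum f n (skew z)) \<in> borel_measurable XS" using m by measurable
    have m1: "(\<lambda>z. (f z)\<^sup>2) \<in> borel_measurable XS" using m by measurable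
    have m2: "(\<lambda>z. f z * birkhoff_sum f n (skew z)) \<in> borel_measurable XS" using m Bm by measurable
    have m3: "(\<lambda>z. (birkhoff_sum f n (skew z))\<^sup>2) \<in> borel_measurable XS" using Bm by measurable
    have C0: "0 \<le> C" using C abs_ge_zero order_trans by blast
    have b1: "\<bar>(f z)\<^sup>2\<bar> \<le> C\<^sup>2" for z using power_mono[OF C[of z], of 2] by simp
    have b2: "\<bar>f z * birkhoff_sum f n (skew z)\<bar> \<le> C * (real n * C)" for z
      unfolding abs_mult using C birkhoff_sum_bounded[of f C, OF C] C0 by (intro mult_mono) auto
    have b3: "\<bar>(birkhoff_sum f n z)\<^sup>2\<bar> \<le> (real n * C)\<^sup>2" for z using sq by simp
    have i1: "integrable S (\<lambda>s. (f (x, s))\<^sup>2)"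
      by (rule bounded_integrable[OF P.prob_space_axioms section_measurable[OF m1] b1])
    have i2: "integrable S (\<lambda>s. f (x, s) * ?B s)"
      by (rule bounded_integrable[OF P.prob_space_axioms section_measurable[OF m2] b2])
    have i3: "integrable S (\<lambda>s. (?B s)\<^sup>2)"
      by (rule bounded_integrable[OF P.prob_space_axioms section_measurable[OF m3] b3])
    have "(\<integral>s. (birkhoff_sum f (Suc n) (x, s))\<^sup>2 \<partial>S) =
        (\<integral>s. (f (x, s))\<^sup>2 + 2 * (f (x, s) * ?B s) + (?B s)\<^sup>2 \<partial>S)"
      by (simp add: birkhoff_sum_Suc power2_sum algebra_simps)
    also have "\<dots> = (\<integral>s. (f (x, s))\<^sup>2 \<partial>S) + 2 * (\<integral>s. f (x, s) * ?B s \<partial>S) + (\<integral>s. (?B s)\<^sup>2 \<partial>S)"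
      using i1 i2 i3 by simp
    also have "\<dots> \<le> C\<^sup>2 + 2 * (A + \<epsilon> / 2 * real n) + ((C\<^sup>2 + 2 * A) * real n + \<epsilon> * (real n)\<^sup>2)"
    proof (intro add_mono mult_left_mono)
      show "(\<integral>s. (f (x, s))\<^sup>2 \<partial>S) \<le> C\<^sup>2"
        using bounded_integral[OF P.prob_space_axioms, of "\<lambda>s. (f (x, s))\<^sup>2" "C\<^sup>2"] b1 by (simp add: abs_le_iff)
      show "(\<integral>s. f (x, s) * ?B s \<partial>S) \<le> A + \<epsilon> / 2 * real n"
        using A(2)[of x n] by (simp add: abs_le_iff)
      have sqm: "(\<lambda>z. (birkhoff_sum f n z)\<^sup>2) \<in> borel_measurable XS" using m by measurable
      have "(\<integral>s. (?B s)\<^sup>2 \<partial>S) = transfer (fibre_mean (\<lambda>z. (birkhoff_sum f n z)\<^sup>2)) x"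
        using fibre_mean_skew[OF sqm b3] by (simp add: fibre_mean_def)
      also have "\<dots> \<le> (C\<^sup>2 + 2 * A) * real n + \<epsilon> * (real n)\<^sup>2"
        using Suc.IH transfer_bounded[of "fibre_mean (\<lambda>z. (birkhoff_sum f n z)\<^sup>2)"
          "(C\<^sup>2 + 2 * A) * real n + \<epsilon> * (real n)\<^sup>2" x]
        by (simp add: fibre_mean_def abs_le_iff abs_of_nonneg integral_nonneg)
      finally show "(\<integral>s. (?B s)\<^sup>2 \<partial>S) \<le> (C\<^sup>2 + 2 * A) * real n + \<epsilon> * (real n)\<^sup>2" .
    qed simp
    also have "\<dots> \<le> (C\<^sup>2 + 2 * A) * real (Suc n) + \<epsilon> * (real (Suc n))\<^sup>2"
      using \<epsilon> by (simp add: power2_eq_square algebra_simps)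
    finally show ?case .
  qed
  then show thesis using that[of "C\<^sup>2 + 2 * A"] A(1) by simp
qed

text \<open>Nonnegativity of the variance bounds the square of the mean by the second
  moment.\<close>

lemma first_moment_bound:
  assumes f: "test_function f" and mean0: "(\<integral>x. fibre_mean f x \<partial>\<mu>) = 0" and \<epsilon>: "\<epsilon> > 0"
  obtains N where "\<And>n x. n \<ge> N \<Longrightarrow> (\<integral>s. \<bar>birkhoff_sum f n (x, s)\<bar> \<partial>S) \<le> \<epsilon> * real n"
proof -
  obtain C where C: "\<And>z. \<bar>f z\<bar> \<le> C" and m: "f \<in> borel_measurable XS"
    using f unfolding test_function_def by blast
  have e2: "\<epsilon>\<^sup>2 / 2 > 0" using \<epsilon> by simp
  obtain A where A: "A \<ge> 0"
    "\<And>n x. (\<integral>s. (birkhoff_sum f n (x, s))\<^sup>2 \<partial>S) \<le> A * real n + \<epsilon>\<^sup>2 / 2 * (real n)\<^sup>2"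
    by (rule second_moment_bound[OF f mean0 e2]) blast
  \<comment> \<open>From this \<open>N\<close> on the linear term \<open>A * n\<close> is at most
    half of \<open>(\<epsilon> * n)\<^sup>2\<close>; the quadratic term takes the other
    half.\<close>
  obtain N :: nat where N: "2 * A / \<epsilon>\<^sup>2 < real N" using reals_Archimedean2 by blast
  show thesis
  proof (rule that[of N])
    fix n x assume n: "N \<le> n"
    have "2 * A / \<epsilon>\<^sup>2 \<le> real n" using N n by linarith
    then have "A \<le> \<epsilon>\<^sup>2 / 2 * real n" using \<epsilon> by (simp add: field_simps)
    then have "A * real n \<le> \<epsilon>\<^sup>2 / 2 * real n * real n" by (rule mult_right_mono) simp
    then have le: "(\<integral>s. (birkhoff_sum f n (x, s))\<^sup>2 \<partial>S) \<le> (\<epsilon> * real n)\<^sup>2"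
      using A(2)[of n x] by (simp add: power2_eq_square algebra_simps)
    have bm: "(\<lambda>s. \<bar>birkhoff_sum f n (x, s)\<bar>) \<in> borel_measurable S"
      using section_measurable[OF birkhoff_sum_measurable[OF m]] by measurable
    have "(\<integral>s. \<bar>birkhoff_sum f n (x, s)\<bar> \<partial>S)\<^sup>2 \<le> (\<integral>s. \<bar>birkhoff_sum f n (x, s)\<bar>\<^sup>2 \<partial>S)"
    proof -
      have 1: "integrable S (\<lambda>s. \<bar>birkhoff_sum f n (x, s)\<bar>)"
        using birkhoff_sum_bounded[of f C, OF C]
        by (intro bounded_integrable[OF P.prob_space_axioms bm]) simp
      have 2: "integrable S (\<lambda>s. \<bar>birkhoff_sum f n (x, s)\<bar>\<^sup>2)"
      proof (rule bounded_integrable[OF P.prob_space_axioms borel_measurable_power[OF bm]])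
        show "\<bar>\<bar>birkhoff_sum f n (x, s)\<bar>\<^sup>2\<bar> \<le> (real n * C)\<^sup>2" for s
          using power_mono[OF birkhoff_sum_bounded[of f C n "(x, s)", OF C], of 2] by simp
      qed
      show ?thesis
        using P.variance_eq[OF 1 2] P.variance_positive[of "\<lambda>s. \<bar>birkhoff_sum f n (x, s)\<bar>"]
        by linarith
    qed
    also have "\<dots> \<le> (\<epsilon> * real n)\<^sup>2" using le by simp
    finally show "(\<integral>s. \<bar>birkhoff_sum f n (x, s)\<bar> \<partial>S) \<le> \<epsilon> * real n"
      by (rule power2_le_imp_le) (use \<epsilon> in simp)
  qed
qed

subsection \<open>Invariant measures of the skew product\<close>

lemma skew_funpow_close:
  assumes "s \<in> space S" "close e x y"
  shows "close e (fst ((skew ^^ k) (x, s))) (fst ((skew ^^ k) (y, s)))"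
    and "snd ((skew ^^ k) (x, s)) = (\<lambda>n. s (n + k))"
    and "snd ((skew ^^ k) (y, s)) = (\<lambda>n. s (n + k))"
proof -
  have "close e (fst ((skew ^^ k) (x, s))) (fst ((skew ^^ k) (y, s))) \<and>
    snd ((skew ^^ k) (x, s)) = (\<lambda>n. s (n + k)) \<and> snd ((skew ^^ k) (y, s)) = (\<lambda>n. s (n + k))"
  proof (induction k)
    case (Suc k)
    have "s k \<in> space M" using assms(1) by (simp add: space_S_iff)
    then show ?case using Suc act_close
      by (auto simp: skew_def case_prod_beta')
  qed (use assms(2) in simp)
  then show "close e (fst ((skew ^^ k) (x, s))) (fst ((skew ^^ k) (y, s)))"
    "snd ((skew ^^ k) (x, s)) = (\<lambda>n. s (n + k))" "snd ((skew ^^ k) (y, s)) = (\<lambda>n. s (n + k))"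
    by auto
qed

text \<open>Two points driven by the same symbols stay close at all times, so their Birkhoff sums
  differ by at most \<open>\<epsilon> * n\<close>. The sum over the net stands in for a maximum,
  since it integrates term by term; the right-hand side no longer involves \<open>x\<close>.\<close>

lemma birkhoff_sum_net:
  assumes f: "test_function f" and \<epsilon>: "\<epsilon> > 0"
  obtains D where "finite D"
    "\<And>n x s. s \<in> space S \<Longrightarrow> \<bar>birkhoff_sum f n (x, s)\<bar> \<le> \<epsilon> * real n + (\<Sum>y\<in>D. \<bar>birkhoff_sum f n (y, s)\<bar>)"
proof -
  obtain \<delta> where \<delta>: "\<delta> > 0" "\<And>x y s. close \<delta> x y \<Longrightarrow> s \<in> space S \<Longrightarrow> \<bar>f (x, s) - f (y, s)\<bar> \<le> \<epsilon>"
    using f \<epsilon> unfolding test_function_def by metis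
  obtain D where D: "finite D" "\<And>x. \<exists>y\<in>D. close \<delta> y x" using close_net[OF \<delta>(1)] by blast
  show thesis
  proof (rule that[OF D(1)])
    fix n x s assume s: "s \<in> space S"
    obtain y where y: "y \<in> D" "close \<delta> y x" using D(2) by blast
    have "\<bar>f ((skew ^^ k) (y, s)) - f ((skew ^^ k) (x, s))\<bar> \<le> \<epsilon>" for k
    proof -
      have "(\<lambda>n. s (n + k)) \<in> space S" using s by (simp add: space_S_iff)
      from \<delta>(2)[OF skew_funpow_close(1)[OF s y(2)] this, of k]
      show ?thesis
        using skew_funpow_close(2,3)[OF s y(2), of k] by (metis prod.collapse)
    qed
    then have "\<bar>\<Sum>k<n. f ((skew ^^ k) (y, s)) - f ((skew ^^ k) (x, s))\<bar> \<le> (\<Sum>k<n. \<epsilon>)"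
      by (intro order_trans[OF sum_abs sum_mono])
    then have "\<bar>birkhoff_sum f n (y, s) - birkhoff_sum f n (x, s)\<bar> \<le> \<epsilon> * real n"
      by (simp add: birkhoff_sum_def sum_subtractf mult.commute)
    moreover have "\<bar>birkhoff_sum f n (y, s)\<bar> \<le> (\<Sum>y\<in>D. \<bar>birkhoff_sum f n (y, s)\<bar>)"
      using y(1) D(1) by (intro member_le_sum) auto
    ultimately show "\<bar>birkhoff_sum f n (x, s)\<bar> \<le> \<epsilon> * real n + (\<Sum>y\<in>D. \<bar>birkhoff_sum f n (y, s)\<bar>)"
      by linarith
  qed
qed

lemma integral_skew_funpow:
  fixes f :: "'x \<times> (nat \<Rightarrow> 'a) \<Rightarrow> real"
  assumes \<tau>: "sets \<tau> = sets XS" "distr \<tau> \<tau> skew = \<tau>" and f: "f \<in> borel_measurable XS"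
  shows "(\<integral>z. f ((skew ^^ k) z) \<partial>\<tau>) = (\<integral>z. f z \<partial>\<tau>)"
proof (induction k)
  case (Suc k)
  have sk: "skew \<in> \<tau> \<rightarrow>\<^sub>M \<tau>"
    using skew_measurable by (simp only: measurable_cong_sets[OF \<tau>(1) \<tau>(1)])
  have m: "(\<lambda>z. f ((skew ^^ k) z)) \<in> borel_measurable \<tau>"
    using measurable_compose[OF skew_funpow_measurable f]
    by (simp only: measurable_cong_sets[OF \<tau>(1) refl])
  have "(\<integral>z. f ((skew ^^ Suc k) z) \<partial>\<tau>) = (\<integral>z. f ((skew ^^ k) (skew z)) \<partial>\<tau>)"
    by (simp only: funpow_Suc_right o_def)
  also have "\<dots> = (\<integral>z. f ((skew ^^ k) z) \<partial>distr \<tau> \<tau> skew)"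
    by (rule integral_distr[OF sk m, symmetric])
  finally show ?case by (simp only: \<tau>(2) Suc)
qed simp

text \<open>By invariance, \<open>n\<close> times the integral is the integral of the Birkhoff sum.
  The bound by the net involves only the symbols, whose law under \<open>\<tau>\<close> is known, so
  the first moment estimate at fixed points applies even if point and symbols are dependent.\<close>

lemma invariant_integral_zero:
  assumes \<tau>: "prob_space \<tau>" "sets \<tau> = sets XS" "distr \<tau> \<tau> skew = \<tau>" "distr \<tau> S snd = S"
    and f: "test_function f" and mean0: "(\<integral>x. fibre_mean f x \<partial>\<mu>) = 0"
  shows "(\<integral>z. f z \<partial>\<tau>) = 0"
proof -
  interpret \<tau>: prob_space \<tau> by fact
  obtain C where C: "\<And>z. \<bar>f z\<bar> \<le> C" and m: "f \<in> borel_measurable XS"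
    using f unfolding test_function_def by blast
  have bm: "birkhoff_sum f n \<in> borel_measurable \<tau>" for n
    using birkhoff_sum_measurable[OF m] by (simp only: measurable_cong_sets[OF \<tau>(2) refl])
  have "\<bar>\<integral>z. f z \<partial>\<tau>\<bar> \<le> \<epsilon>" if \<epsilon>: "\<epsilon> > 0" for \<epsilon>
  proof -
    have e2: "\<epsilon> / 2 > 0" using \<epsilon> by simp
    obtain D where D: "finite D"
      "\<And>n x s. s \<in> space S \<Longrightarrow> \<bar>birkhoff_sum f n (x, s)\<bar> \<le> \<epsilon> / 2 * real n + (\<Sum>y\<in>D. \<bar>birkhoff_sum f n (y, s)\<bar>)"
      by (rule birkhoff_sum_net[OF f e2]) blast
    \<comment> \<open>Half of \<open>\<epsilon>\<close> is shared among the net points; the 1 rules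
      out a zero denominator.\<close>
    have eD: "\<epsilon> / (2 * (real (card D) + 1)) > 0" using \<epsilon> by simp
    obtain N where N: "\<And>n x. n \<ge> N \<Longrightarrow> (\<integral>s. \<bar>birkhoff_sum f n (x, s)\<bar> \<partial>S) \<le> \<epsilon> / (2 * (real (card D) + 1)) * real n"
      by (rule first_moment_bound[OF f mean0 eD]) blast
    \<comment> \<open>Large enough and also positive, since the factor \<open>n\<close> is cancelled
      at the end.\<close>
    define n where "n = Suc N"
    have snd: "snd \<in> \<tau> \<rightarrow>\<^sub>M S"
      using measurable_snd by (simp only: measurable_cong_sets[OF \<tau>(2) refl])
    have sm: "(\<lambda>s. \<bar>birkhoff_sum f n (y, s)\<bar>) \<in> borel_measurable S" for y
      using section_measurable[OF birkhoff_sum_measurable[OF m]] by measurable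
    have fi: "integrable \<tau> (\<lambda>z. \<bar>birkhoff_sum f n (y, snd z)\<bar>)" for y
      using birkhoff_sum_bounded[of f C, OF C]
      by (intro bounded_integrable[OF \<tau>(1) measurable_compose[OF snd sm]]) simp
    have fy: "(\<integral>z. \<bar>birkhoff_sum f n (y, snd z)\<bar> \<partial>\<tau>) \<le> \<epsilon> / (2 * (real (card D) + 1)) * real n" for y
      using integral_distr[OF snd sm, of y] N[of n y] by (simp add: \<tau>(4) n_def)
    have bi: "integrable \<tau> (birkhoff_sum f n)"
      by (rule bounded_integrable[OF \<tau>(1) bm birkhoff_sum_bounded[of f C, OF C]])
    have "integrable \<tau> (\<lambda>z. f ((skew ^^ k) z))" for k
    proof (rule bounded_integrable[OF \<tau>(1) _ C])
      show "(\<lambda>z. f ((skew ^^ k) z)) \<in> borel_measurable \<tau>"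
        using measurable_compose[OF skew_funpow_measurable m]
        by (simp only: measurable_cong_sets[OF \<tau>(2) refl])
    qed
    then have "(\<integral>z. birkhoff_sum f n z \<partial>\<tau>) = real n * (\<integral>z. f z \<partial>\<tau>)"
      unfolding birkhoff_sum_def by (simp add: integral_skew_funpow[OF \<tau>(2,3) m])
    then have eq: "real n * \<bar>\<integral>z. f z \<partial>\<tau>\<bar> = \<bar>\<integral>z. birkhoff_sum f n z \<partial>\<tau>\<bar>"
      by (simp add: abs_mult)
    have le: "\<bar>\<integral>z. birkhoff_sum f n z \<partial>\<tau>\<bar> \<le> (\<integral>z. \<bar>birkhoff_sum f n z\<bar> \<partial>\<tau>)"
      using integral_abs_bound[of \<tau> "birkhoff_sum f n"] .
    have si: "integrable \<tau> (\<lambda>z. \<Sum>y\<in>D. \<bar>birkhoff_sum f n (y, snd z)\<bar>)"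
      by (rule Bochner_Integration.integrable_sum) (rule fi)
    have "(\<integral>z. \<bar>birkhoff_sum f n z\<bar> \<partial>\<tau>) \<le> (\<integral>z. \<epsilon> / 2 * real n + (\<Sum>y\<in>D. \<bar>birkhoff_sum f n (y, snd z)\<bar>) \<partial>\<tau>)"
    proof (rule integral_mono)
      show "integrable \<tau> (\<lambda>z. \<bar>birkhoff_sum f n z\<bar>)" by (rule integrable_abs[OF bi])
      show "integrable \<tau> (\<lambda>z. \<epsilon> / 2 * real n + (\<Sum>y\<in>D. \<bar>birkhoff_sum f n (y, snd z)\<bar>))"
        by (rule Bochner_Integration.integrable_add[OF \<tau>.integrable_const si])
      fix z assume "z \<in> space \<tau>"
      then have "snd z \<in> space S"
        unfolding sets_eq_imp_space_eq[OF \<tau>(2)] space_pair_measure by (simp only: mem_Times_iff)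
      from D(2)[OF this, of n "fst z"]
      show "\<bar>birkhoff_sum f n z\<bar> \<le> \<epsilon> / 2 * real n + (\<Sum>y\<in>D. \<bar>birkhoff_sum f n (y, snd z)\<bar>)"
        by (simp only: prod.collapse)
    qed
    also have "\<dots> = \<epsilon> / 2 * real n + (\<Sum>y\<in>D. \<integral>z. \<bar>birkhoff_sum f n (y, snd z)\<bar> \<partial>\<tau>)"
      unfolding Bochner_Integration.integral_add[OF \<tau>.integrable_const si]
        Bochner_Integration.integral_sum[OF fi] by (simp add: \<tau>.prob_space)
    also have "\<dots> \<le> \<epsilon> / 2 * real n + (\<Sum>y\<in>D. \<epsilon> / (2 * (real (card D) + 1)) * real n)"
      by (intro add_left_mono sum_mono fy)
    also have "\<dots> = (\<epsilon> / 2 + real (card D) * (\<epsilon> / (2 * (real (card D) + 1)))) * real n"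
      by (simp add: algebra_simps)
    also have "\<dots> \<le> \<epsilon> * real n"
    proof (rule mult_right_mono)
      have "real (card D) / (real (card D) + 1) * \<epsilon> \<le> 1 * \<epsilon>"
        using \<epsilon> by (intro mult_right_mono) auto
      moreover have "real (card D) * (\<epsilon> / (2 * t)) = real (card D) / t * \<epsilon> / 2" for t by simp
      moreover have "\<epsilon> / 2 + a / 2 \<le> \<epsilon>" if "a \<le> 1 * \<epsilon>" for a using that by simp
      ultimately show "\<epsilon> / 2 + real (card D) * (\<epsilon> / (2 * (real (card D) + 1))) \<le> \<epsilon>"
        by (simp only:)
    qed simp
    finally have "real n * \<bar>\<integral>z. f z \<partial>\<tau>\<bar> \<le> real n * \<epsilon>"
      using eq le by (simp only: mult.commute[of "real n" \<epsilon>])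
    then show ?thesis by (simp add: n_def)
  qed
  then have "\<bar>\<integral>z. f z \<partial>\<tau>\<bar> \<le> 0" by - (rule field_le_epsilon, simp)
  then show ?thesis by simp
qed

lemma test_function_diff_const:
  assumes "test_function f"
  shows "test_function (\<lambda>z. f z - c)"
proof -
  obtain C where C: "\<And>z. \<bar>f z\<bar> \<le> C" using assms unfolding test_function_def by blast
  have m: "f \<in> borel_measurable XS" using assms by (simp add: test_function_def)
  have "\<bar>f z - c\<bar> \<le> C + \<bar>c\<bar>" for z using C[of z] by linarith
  then have "\<exists>C. \<forall>z. \<bar>f z - c\<bar> \<le> C" by blast
  moreover have "(\<lambda>z. f z - c) \<in> borel_measurable XS"
    by (intro borel_measurable_diff borel_measurable_const m)
  moreover obtain L where L: "\<And>x. depends_on_prefix L (\<lambda>s. f (x, s))"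
    using assms unfolding test_function_def by blast
  moreover have "depends_on_prefix L (\<lambda>s. f (x, s) - c)" for x
    using L[of x] unfolding depends_on_prefix_def by metis
  ultimately show ?thesis using assms unfolding test_function_def by auto
qed

lemma invariant_integral:
  assumes \<tau>: "prob_space \<tau>" "sets \<tau> = sets XS" "distr \<tau> \<tau> skew = \<tau>" "distr \<tau> S snd = S"
    and f: "test_function f"
  shows "(\<integral>z. f z \<partial>\<tau>) = (\<integral>x. fibre_mean f x \<partial>\<mu>)"
proof -
  interpret \<tau>: prob_space \<tau> by fact
  define c where "c = (\<integral>x. fibre_mean f x \<partial>\<mu>)"
  obtain C where C: "\<And>z. \<bar>f z\<bar> \<le> C" and m: "f \<in> borel_measurable XS"
    using f unfolding test_function_def by blast
  have fi: "integrable S (\<lambda>s. f (x, s))" for x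
    by (rule bounded_integrable[OF P.prob_space_axioms section_measurable[OF m] C])
  have m': "fibre_mean f \<in> borel_measurable \<mu>"
    using fibre_mean_measurable[OF m] by (simp only: measurable_cong_sets[OF sets_\<mu> refl])
  have "integrable \<mu> (fibre_mean f)"
    by (rule bounded_integrable[OF prob_\<mu> m' fibre_mean_bounded[of f C, OF C]])
  moreover have "fibre_mean (\<lambda>z. f z - c) x = fibre_mean f x - c" for x
    unfolding fibre_mean_def using fi by (simp add: P.prob_space)
  ultimately have "(\<integral>x. fibre_mean (\<lambda>z. f z - c) x \<partial>\<mu>) = 0"
    by (simp add: c_def \<mu>p.prob_space)
  from invariant_integral_zero[OF \<tau> test_function_diff_const[OF f] this]
  have "(\<integral>z. f z - c \<partial>\<tau>) = 0" .
  moreover have "f \<in> borel_measurable \<tau>"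
    using m by (simp only: measurable_cong_sets[OF \<tau>(2) refl])
  then have "integrable \<tau> f" by (rule bounded_integrable[OF \<tau>(1) _ C])
  ultimately show ?thesis by (simp add: \<tau>.prob_space c_def)
qed

section \<open>Two-sided symbol sequences\<close>

abbreviation Y :: "(int \<Rightarrow> 'a) measure" where
  "Y \<equiv> \<Pi>\<^sub>M i\<in>UNIV. M"

definition two_sided_skew :: "'x \<times> (int \<Rightarrow> 'a) \<Rightarrow> 'x \<times> (int \<Rightarrow> 'a)" where
  "two_sided_skew = (\<lambda>(x, r). (act (r 1) x, shift r))"

text \<open>The offset makes entry 0 the coordinate of index 1, which the two-sided map
  reads.\<close>

definition future :: "(int \<Rightarrow> 'a) \<Rightarrow> nat \<Rightarrow> 'a" where
  "future r n = r (int n + 1)"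

lemma space_Y_iff: "r \<in> space Y \<longleftrightarrow> (\<forall>i. r i \<in> space M)"
  by (auto simp: space_PiM)

lemma prob_space_Y: "prob_space Y"
  by (intro prob_space_PiM M.prob_space_axioms)

lemma future_measurable [measurable]: "future \<in> Y \<rightarrow>\<^sub>M S"
  unfolding future_def[abs_def] by (rule measurable_PiM_single') (auto simp: space_PiM)

lemma shift_measurable [measurable]: "shift \<in> Y \<rightarrow>\<^sub>M Y"
  unfolding shift_def[abs_def] by (rule measurable_PiM_single') (auto simp: space_PiM)

lemma distr_future: "distr Y S future = S"
proof -
  have "distr Y S (\<lambda>r. \<lambda>n\<in>UNIV. r (int n + 1)) = S"
    by (rule distr_PiM_reindex) (auto simp: inj_on_def intro: M.prob_space_axioms)
  then show ?thesis by (simp add: future_def[abs_def] restrict_UNIV)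
qed

lemma distr_shift: "distr Y Y shift = Y"
proof -
  have "distr Y Y (\<lambda>r. \<lambda>n\<in>UNIV. r (n + 1)) = Y"
    by (rule distr_PiM_reindex) (auto simp: inj_on_def intro: M.prob_space_axioms)
  then show ?thesis by (simp add: shift_def[abs_def] restrict_UNIV)
qed

lemma two_sided_skew_measurable [measurable]: "two_sided_skew \<in> borel \<Otimes>\<^sub>M Y \<rightarrow>\<^sub>M borel \<Otimes>\<^sub>M Y"
proof -
  have "(\<lambda>z. (fst z, snd z 1)) \<in> borel \<Otimes>\<^sub>M Y \<rightarrow>\<^sub>M borel \<Otimes>\<^sub>M M" by measurable
  from measurable_compose[OF this act_measurable_pair]
  have 1: "(\<lambda>z. act (snd z 1) (fst z)) \<in> borel \<Otimes>\<^sub>M Y \<rightarrow>\<^sub>M borel" by simp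
  have 2: "(\<lambda>z. shift (snd z)) \<in> borel \<Otimes>\<^sub>M Y \<rightarrow>\<^sub>M Y" by measurable
  show ?thesis
    using measurable_Pair[OF 1 2] by (simp add: two_sided_skew_def case_prod_beta')
qed

text \<open>This makes the product one of the measures that the uniqueness argument covers. At fixed
  \<open>r\<close> the slice of the preimage of \<open>A \<times> B\<close> is either empty or the
  preimage of \<open>A\<close> under one symbol, which has the measure of \<open>A\<close>.\<close>

lemma product_two_sided_skew_invariant:
  "distr (\<mu> \<Otimes>\<^sub>M Y) (\<mu> \<Otimes>\<^sub>M Y) two_sided_skew = \<mu> \<Otimes>\<^sub>M Y"
proof (rule pair_measure_eqI[symmetric])
  interpret Y: prob_space Y by (rule prob_space_Y)
  interpret \<mu>Y: pair_prob_space \<mu> Y ..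
  show "sigma_finite_measure \<mu>" "sigma_finite_measure Y" by unfold_locales
  fix A B assume A: "A \<in> sets \<mu>" and B: "B \<in> sets Y"
  have sets_eq: "sets (\<mu> \<Otimes>\<^sub>M Y) = sets (borel \<Otimes>\<^sub>M Y)"
    by (rule sets_pair_measure_cong[OF sets_\<mu> refl])
  have sp: "space \<mu> = UNIV" using sets_eq_imp_space_eq[OF sets_\<mu>] by simp
  have sk: "two_sided_skew \<in> \<mu> \<Otimes>\<^sub>M Y \<rightarrow>\<^sub>M \<mu> \<Otimes>\<^sub>M Y"
    using two_sided_skew_measurable by (simp only: measurable_cong_sets[OF sets_eq sets_eq])
  have AB: "A \<times> B \<in> sets (\<mu> \<Otimes>\<^sub>M Y)" using A B by simp
  have "emeasure (distr (\<mu> \<Otimes>\<^sub>M Y) (\<mu> \<Otimes>\<^sub>M Y) two_sided_skew) (A \<times> B)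
      = emeasure (\<mu> \<Otimes>\<^sub>M Y) (two_sided_skew -` (A \<times> B) \<inter> space (\<mu> \<Otimes>\<^sub>M Y))"
    by (rule emeasure_distr[OF sk AB])
  also have "\<dots> = (\<integral>\<^sup>+r. emeasure \<mu> ((\<lambda>x. (x, r)) -` (two_sided_skew -` (A \<times> B) \<inter> space (\<mu> \<Otimes>\<^sub>M Y))) \<partial>Y)"
    by (rule \<mu>Y.emeasure_pair_measure_alt2[OF measurable_sets[OF sk AB]])
  also have "\<dots> = (\<integral>\<^sup>+r. emeasure \<mu> A * indicator B (shift r) \<partial>Y)"
  proof (rule nn_integral_cong)
    fix r assume r: "r \<in> space Y"
    then have a: "r 1 \<in> space M" by (simp add: space_Y_iff)
    have am: "act (r 1) \<in> \<mu> \<rightarrow>\<^sub>M borel"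
      using act_measurable[OF a] by (simp only: measurable_cong_sets[OF sets_\<mu> refl])
    have "emeasure \<mu> A = emeasure (distr \<mu> borel (act (r 1))) A" by (simp add: act_invariant[OF a])
    also have "\<dots> = emeasure \<mu> (act (r 1) -` A)"
      using A by (subst emeasure_distr[OF am]) (simp_all add: sets_\<mu> sp)
    finally have "emeasure \<mu> (act (r 1) -` A) = emeasure \<mu> A" ..
    moreover have "(\<lambda>x. (x, r)) -` (two_sided_skew -` (A \<times> B) \<inter> space (\<mu> \<Otimes>\<^sub>M Y))
        = (if shift r \<in> B then act (r 1) -` A else {})"
      using r by (auto simp: two_sided_skew_def space_pair_measure sp)
    ultimately show "emeasure \<mu> ((\<lambda>x. (x, r)) -` (two_sided_skew -` (A \<times> B) \<inter> space (\<mu> \<Otimes>\<^sub>M Y)))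
        = emeasure \<mu> A * indicator B (shift r)"
      by simp
  qed
  also have "\<dots> = emeasure \<mu> A * (\<integral>\<^sup>+r. indicator B (shift r) \<partial>Y)"
    by (rule nn_integral_cmult[OF measurable_compose[OF shift_measurable borel_measurable_indicator[OF B]]])
  also have "(\<integral>\<^sup>+r. indicator B (shift r) \<partial>Y) = (\<integral>\<^sup>+r. indicator B r \<partial>distr Y Y shift)"
    using B by (intro nn_integral_distr[symmetric]) auto
  also have "\<dots> = emeasure Y B" using B by (simp add: distr_shift)
  finally show "emeasure \<mu> A * emeasure Y B = emeasure (distr (\<mu> \<Otimes>\<^sub>M Y) (\<mu> \<Otimes>\<^sub>M Y) two_sided_skew) (A \<times> B)" ..
qed simp

lemma two_sided_skew_funpow:
  "(two_sided_skew ^^ N) (x, r) = (fst ((skew ^^ N) (x, future r)), \<lambda>i. r (i + int N))"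
  "snd ((skew ^^ N) (x, future r)) = (\<lambda>n. r (int n + 1 + int N))"
proof -
  have "(two_sided_skew ^^ N) (x, r) = (fst ((skew ^^ N) (x, future r)), \<lambda>i. r (i + int N)) \<and>
    snd ((skew ^^ N) (x, future r)) = (\<lambda>n. r (int n + 1 + int N))"
    by (induction N) (auto simp: future_def[abs_def] two_sided_skew_def skew_def shift_def case_prod_beta' ac_simps)
  then show "(two_sided_skew ^^ N) (x, r) = (fst ((skew ^^ N) (x, future r)), \<lambda>i. r (i + int N))"
    "snd ((skew ^^ N) (x, future r)) = (\<lambda>n. r (int n + 1 + int N))" by auto
qed

lemma skew_funpow_prefix:
  assumes "\<forall>n<N. s n = t n"
  shows "fst ((skew ^^ N) (x, s)) = fst ((skew ^^ N) (x, t))"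
proof -
  have snd: "snd ((skew ^^ k) (x, s)) = (\<lambda>n. s (n + k))" for s k
    by (induction k) (auto simp: skew_def case_prod_beta')
  show ?thesis
    using assms
  proof (induction N)
    case (Suc N)
    have "fst (skew z) = act (snd z 0) (fst z)" for z by (simp add: skew_def case_prod_beta')
    then show ?case using Suc by (simp add: snd)
  qed simp
qed

lemma continuous_close_continuous:
  fixes u :: "'x \<Rightarrow> real"
  assumes "continuous_on UNIV u" "\<epsilon> > 0"
  obtains \<delta> where "\<delta> > 0" "\<And>x y. close \<delta> x y \<Longrightarrow> \<bar>u x - u y\<bar> \<le> \<epsilon>"
proof -
  obtain \<delta> where \<delta>: "\<delta> > 0" "\<And>x y. dist x y < \<delta> \<Longrightarrow> dist (u x) (u y) < \<epsilon>"
    using compact_uniformly_continuous[OF assms(1) compact_UNIV] assms(2)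
    unfolding uniformly_continuous_on_def by (metis UNIV_I dist_commute)
  show thesis
    using \<delta> close_dist by (intro that[of \<delta>]) (force simp: dist_real_def less_imp_le)+
qed

lemma continuous_bounded:
  fixes u :: "'x \<Rightarrow> real"
  assumes "continuous_on UNIV u"
  obtains C where "\<And>x. \<bar>u x\<bar> \<le> C"
proof -
  have "bounded (range u)"
    using compact_continuous_image[OF assms compact_UNIV] by (rule compact_imp_bounded)
  then show thesis using that unfolding bounded_iff by auto
qed

section \<open>Cylinder functions and the passage to positive coordinates\<close>

definition cylinder_function ::
    "('x \<Rightarrow> real) \<Rightarrow> int set \<Rightarrow> (int \<Rightarrow> 'a set) \<Rightarrow> 'x \<times> (int \<Rightarrow> 'a) \<Rightarrow> real" where
  "cylinder_function u J E z = u (fst z) * of_bool (\<forall>i\<in>J. snd z i \<in> E i)"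

text \<open>Once shifted far enough to the right, a cylinder depends only on positive coordinates, and a
  function of it factors through \<open>future\<close>.\<close>

definition shifted_cylinder_function ::
    "nat \<Rightarrow> ('x \<Rightarrow> real) \<Rightarrow> int set \<Rightarrow> (int \<Rightarrow> 'a set) \<Rightarrow> 'x \<times> (nat \<Rightarrow> 'a) \<Rightarrow> real" where
  "shifted_cylinder_function N u J E z =
     u (fst ((skew ^^ N) z)) * of_bool (\<forall>i\<in>J. snd z (nat (i + int N - 1)) \<in> E i)"

lemma cylinder_function_shift:
  assumes "\<And>i. i \<in> J \<Longrightarrow> i + int N \<ge> 1"
  shows "cylinder_function u J E ((two_sided_skew ^^ N) (x, r)) =
    shifted_cylinder_function N u J E (x, future r)"
proof -
  \<comment> \<open>The argument of \<open>nat\<close> is nonnegative by assumption, and the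
    \<open>- 1\<close> undoes the offset in \<open>future\<close>.\<close>
  have "future r (nat (i + int N - 1)) = r (i + int N)" if "i \<in> J" for i
    using assms[OF that] by (simp add: future_def)
  then show ?thesis
    by (simp add: cylinder_function_def shifted_cylinder_function_def two_sided_skew_funpow)
qed

lemma cylinder_function_measurable:
  assumes "u \<in> borel_measurable borel" "finite J" "\<And>i. i \<in> J \<Longrightarrow> E i \<subseteq> space M"
  shows "cylinder_function u J E \<in> borel_measurable (borel \<Otimes>\<^sub>M Y)"
proof -
  have "Measurable.pred (borel \<Otimes>\<^sub>M Y) (\<lambda>z. snd z i \<in> E i)" if "i \<in> J" for i
  proof -
    have "E i \<in> sets M" using assms(3)[OF that] by (simp add: sets_symbols)
    then show ?thesis by measurable
  qed
  then have "Measurable.pred (borel \<Otimes>\<^sub>M Y) (\<lambda>z. \<forall>i\<in>J. snd z i \<in> E i)"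
    using assms(2) by (intro pred_intros_finite)
  then show ?thesis
    using assms(1) unfolding cylinder_function_def[abs_def] by measurable
qed

lemma test_function_shifted_cylinder:
  assumes u: "continuous_on UNIV u" and J: "finite J" and E: "\<And>i. i \<in> J \<Longrightarrow> E i \<subseteq> space M"
  shows "test_function (shifted_cylinder_function N u J E)"
  unfolding test_function_def
proof (intro conjI)
  have "Measurable.pred XS (\<lambda>z. snd z (nat (i + int N - 1)) \<in> E i)" if "i \<in> J" for i
  proof -
    have "E i \<in> sets M" using E[OF that] by (simp add: sets_symbols)
    then show ?thesis by measurable
  qed
  then have "Measurable.pred XS (\<lambda>z. \<forall>i\<in>J. snd z (nat (i + int N - 1)) \<in> E i)"
    using J by (intro pred_intros_finite)
  moreover have "(\<lambda>z. u (fst ((skew ^^ N) z))) \<in> borel_measurable XS"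
    using borel_measurable_continuous_onI[OF u] by measurable
  ultimately show "shifted_cylinder_function N u J E \<in> borel_measurable XS"
    unfolding shifted_cylinder_function_def[abs_def] by measurable
next
  obtain C where C: "\<And>x. \<bar>u x\<bar> \<le> C" by (rule continuous_bounded[OF u]) blast
  have "0 \<le> C" using C abs_ge_zero order_trans by blast
  then show "\<exists>C. \<forall>z. \<bar>shifted_cylinder_function N u J E z\<bar> \<le> C"
    using C by (intro exI[of _ C]) (auto simp: shifted_cylinder_function_def)
next
  obtain L where L: "\<And>i. i \<in> J \<Longrightarrow> nat (i + int N - 1) < L"
    using J finite_nat_set_iff_bounded[of "(\<lambda>i. nat (i + int N - 1)) ` J"] by auto
  \<comment> \<open>The first \<open>N\<close> symbols move the point, and \<open>L\<close> exceeds
    every index that the cylinder reads.\<close>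
  have "depends_on_prefix (N + L) (\<lambda>s. shifted_cylinder_function N u J E (x, s))" for x
    unfolding depends_on_prefix_def
  proof (intro ballI impI)
    fix s t :: "nat \<Rightarrow> 'a" assume st: "\<forall>n<N + L. s n = t n"
    have "s (nat (i + int N - 1)) = t (nat (i + int N - 1))" if "i \<in> J" for i
      using st L[OF that] by simp
    moreover have "fst ((skew ^^ N) (x, s)) = fst ((skew ^^ N) (x, t))"
      using st by (intro skew_funpow_prefix) simp
    ultimately show "shifted_cylinder_function N u J E (x, s) = shifted_cylinder_function N u J E (x, t)"
      by (simp add: shifted_cylinder_function_def)
  qed
  then show "\<exists>L. \<forall>x. depends_on_prefix L (\<lambda>s. shifted_cylinder_function N u J E (x, s))" by blast
next
  show "\<forall>\<epsilon>>0. \<exists>\<delta>>0. \<forall>x y. close \<delta> x y \<longrightarrow> (\<forall>s\<in>space S.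
    \<bar>shifted_cylinder_function N u J E (x, s) - shifted_cylinder_function N u J E (y, s)\<bar> \<le> \<epsilon>)"
  proof (intro allI impI)
    fix \<epsilon> :: real assume \<epsilon>: "\<epsilon> > 0"
    obtain \<delta> where \<delta>: "\<delta> > 0" "\<And>x y. close \<delta> x y \<Longrightarrow> \<bar>u x - u y\<bar> \<le> \<epsilon>"
      by (rule continuous_close_continuous[OF u \<epsilon>]) blast
    have "\<bar>shifted_cylinder_function N u J E (x, s) - shifted_cylinder_function N u J E (y, s)\<bar> \<le> \<epsilon>"
      if "close \<delta> x y" "s \<in> space S" for x y s
      using \<delta>(2)[OF skew_funpow_close(1)[OF that(2,1), of N]] \<epsilon>
      by (simp add: shifted_cylinder_function_def)
    then show "\<exists>\<delta>>0. \<forall>x y. close \<delta> x y \<longrightarrow> (\<forall>s\<in>space S.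
        \<bar>shifted_cylinder_function N u J E (x, s) - shifted_cylinder_function N u J E (y, s)\<bar> \<le> \<epsilon>)"
      using \<delta>(1) by blast
  qed
qed

text \<open>A common value for all admissible measures is enough: it will be compared for
  \<open>\<tau>\<close> and for the product, so the integral against the product never has to be
  computed.\<close>

lemma cylinder_integral:
  assumes u: "continuous_on UNIV u" and J: "finite J" and E: "\<And>i. i \<in> J \<Longrightarrow> E i \<subseteq> space M"
  shows "\<exists>c. \<forall>\<tau>. prob_space \<tau> \<longrightarrow> sets \<tau> = sets (borel \<Otimes>\<^sub>M Y) \<longrightarrow>
    distr \<tau> \<tau> two_sided_skew = \<tau> \<longrightarrow> distr \<tau> Y snd = Y \<longrightarrow> (\<integral>z. cylinder_function u J E z \<partial>\<tau>) = c"
proof -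
  obtain N where N: "\<And>i. i \<in> J \<Longrightarrow> i + int N \<ge> 1"
  proof -
    obtain N where "\<And>i. i \<in> J \<Longrightarrow> nat (1 - i) < N"
      using J finite_nat_set_iff_bounded[of "(\<lambda>i. nat (1 - i)) ` J"] by auto
    then have "\<And>i. i \<in> J \<Longrightarrow> i + int N \<ge> 1" by force
    then show thesis by (rule that)
  qed
  let ?F = "shifted_cylinder_function N u J E"
  have F: "test_function ?F" by (rule test_function_shifted_cylinder[OF u J E])
  then have Fm: "?F \<in> borel_measurable XS" by (simp add: test_function_def)
  have cm: "cylinder_function u J E \<in> borel_measurable (borel \<Otimes>\<^sub>M Y)"
    by (rule cylinder_function_measurable[OF borel_measurable_continuous_onI[OF u] J E])
  show ?thesis
  proof (rule exI[of _ "\<integral>x. fibre_mean ?F x \<partial>\<mu>"], intro allI impI)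
    fix \<tau> :: "('x \<times> (int \<Rightarrow> 'a)) measure"
    assume \<tau>: "prob_space \<tau>" "sets \<tau> = sets (borel \<Otimes>\<^sub>M Y)"
      "distr \<tau> \<tau> two_sided_skew = \<tau>" "distr \<tau> Y snd = Y"
    \<comment> \<open>Forgetting the symbols of nonpositive index intertwines the two skew maps, so
      the image of \<open>\<tau>\<close> is invariant under the one-sided map and has marginal
      \<open>S\<close>.\<close>
    define j where "j z = (fst z, future (snd z))" for z :: "'x \<times> (int \<Rightarrow> 'a)"
    have jm: "j \<in> \<tau> \<rightarrow>\<^sub>M XS"
    proof -
      have "(\<lambda>z. (fst z, future (snd z))) \<in> borel \<Otimes>\<^sub>M Y \<rightarrow>\<^sub>M XS" by measurable
      then show ?thesis by (simp only: j_def[abs_def] measurable_cong_sets[OF \<tau>(2) refl])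
    qed
    have skm: "two_sided_skew \<in> \<tau> \<rightarrow>\<^sub>M \<tau>"
      using two_sided_skew_measurable by (simp only: measurable_cong_sets[OF \<tau>(2) \<tau>(2)])
    have js: "skew (j z) = j (two_sided_skew z)" for z
      by (cases z) (simp add: j_def skew_def two_sided_skew_def future_def[abs_def] shift_def ac_simps)
    let ?\<tau> = "distr \<tau> XS j"
    have 1: "prob_space ?\<tau>" by (rule prob_space.prob_space_distr[OF \<tau>(1) jm])
    have "distr ?\<tau> ?\<tau> skew = distr ?\<tau> XS skew" by (rule distr_cong) simp_all
    also have "\<dots> = distr \<tau> XS (skew \<circ> j)" by (rule distr_distr[OF skew_measurable jm])
    also have "skew \<circ> j = j \<circ> two_sided_skew" using js by auto
    also have "distr \<tau> XS (j \<circ> two_sided_skew) = distr (distr \<tau> \<tau> two_sided_skew) XS j"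
      by (rule distr_distr[OF jm skm, symmetric])
    also have "\<dots> = ?\<tau>" by (simp only: \<tau>(3))
    finally have 2: "distr ?\<tau> ?\<tau> skew = ?\<tau>" .
    have sndm: "snd \<in> \<tau> \<rightarrow>\<^sub>M Y"
      using measurable_snd by (simp only: measurable_cong_sets[OF \<tau>(2) refl])
    have "distr ?\<tau> S snd = distr \<tau> S (snd \<circ> j)" by (rule distr_distr[OF measurable_snd jm])
    also have "snd \<circ> j = future \<circ> snd" by (auto simp: j_def)
    also have "distr \<tau> S (future \<circ> snd) = distr (distr \<tau> Y snd) S future"
      by (rule distr_distr[OF future_measurable sndm, symmetric])
    also have "\<dots> = S" by (simp only: \<tau>(4) distr_future)
    finally have 3: "distr ?\<tau> S snd = S" .
    have inv: "(\<integral>z. cylinder_function u J E ((two_sided_skew ^^ k) z) \<partial>\<tau>) = (\<integral>z. cylinder_function u J E z \<partial>\<tau>)" for k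
    proof (induction k)
      case (Suc k)
      have km: "two_sided_skew ^^ k \<in> \<tau> \<rightarrow>\<^sub>M \<tau>"
        by (induction k) (auto simp: o_def intro: measurable_compose[OF _ skm])
      have "cylinder_function u J E \<in> borel_measurable \<tau>"
        using cm by (simp only: measurable_cong_sets[OF \<tau>(2) refl])
      from measurable_compose[OF km this]
      have m: "(\<lambda>z. cylinder_function u J E ((two_sided_skew ^^ k) z)) \<in> borel_measurable \<tau>" .
      have "(\<integral>z. cylinder_function u J E ((two_sided_skew ^^ Suc k) z) \<partial>\<tau>) =
          (\<integral>z. cylinder_function u J E ((two_sided_skew ^^ k) (two_sided_skew z)) \<partial>\<tau>)"
        by (simp only: funpow_Suc_right o_def)
      also have "\<dots> = (\<integral>z. cylinder_function u J E ((two_sided_skew ^^ k) z) \<partial>distr \<tau> \<tau> two_sided_skew)"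
        by (rule integral_distr[OF skm m, symmetric])
      finally show ?case by (simp only: \<tau>(3) Suc)
    qed simp
    have "(\<integral>z. cylinder_function u J E z \<partial>\<tau>) = (\<integral>z. cylinder_function u J E ((two_sided_skew ^^ N) z) \<partial>\<tau>)"
      by (rule inv[symmetric])
    also have "\<dots> = (\<integral>z. ?F (j z) \<partial>\<tau>)"
    proof (rule Bochner_Integration.integral_cong[OF refl])
      fix z
      show "cylinder_function u J E ((two_sided_skew ^^ N) z) = ?F (j z)"
        using cylinder_function_shift[OF N, where x="fst z" and r="snd z"] by (simp add: j_def)
    qed
    also have "\<dots> = (\<integral>z. ?F z \<partial>?\<tau>)" by (rule integral_distr[OF jm Fm, symmetric])
    also have "\<dots> = (\<integral>x. fibre_mean ?F x \<partial>\<mu>)"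
      by (rule invariant_integral[OF 1 _ 2 3 F]) simp
    finally show "(\<integral>z. cylinder_function u J E z \<partial>\<tau>) = (\<integral>x. fibre_mean ?F x \<partial>\<mu>)" .
  qed
qed

text \<open>The cutoffs decrease to the indicator of \<open>F\<close>: off a closed set the distance
  is positive, hence the value is 0 from some index on. For empty \<open>F\<close> the convention
  \<open>infdist x {} = 0\<close> would make them constantly 1.\<close>

lemma measure_closed_cylinder:
  assumes \<tau>: "prob_space \<tau>" "sets \<tau> = sets (borel \<Otimes>\<^sub>M Y)"
    and F: "closed F" "F \<noteq> {}" and J: "finite J" and E: "\<And>i. i \<in> J \<Longrightarrow> E i \<subseteq> space M"
  shows "(\<lambda>n. \<integral>z. cylinder_function (\<lambda>x. max 0 (1 - real n * infdist x F)) J E z \<partial>\<tau>)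
    \<longlonglongrightarrow> measure \<tau> (F \<times> prod_emb UNIV (\<lambda>_. M) J (Pi\<^sub>E J E))"
proof -
  interpret \<tau>: prob_space \<tau> by fact
  let ?u = "\<lambda>n x. max 0 (1 - real n * infdist x F)"
  let ?A = "F \<times> prod_emb UNIV (\<lambda>_. M) J (Pi\<^sub>E J E)"
  have A: "?A \<in> sets \<tau>"
    unfolding \<tau>(2) using F(1) J E by (intro pair_measureI sets_PiM_I) (auto simp: sets_symbols)
  have um: "?u n \<in> borel_measurable borel" for n
    by (intro borel_measurable_continuous_onI continuous_intros)
  have "(\<lambda>n. \<integral>z. cylinder_function (?u n) J E z \<partial>\<tau>) \<longlonglongrightarrow> (\<integral>z. indicator ?A z \<partial>\<tau>)"
  proof (rule integral_dominated_convergence[where w="\<lambda>_. 1"])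
    show "indicator ?A \<in> borel_measurable \<tau>" using A by simp
    show "cylinder_function (?u n) J E \<in> borel_measurable \<tau>" for n
      using cylinder_function_measurable[OF um J E] by (simp only: measurable_cong_sets[OF \<tau>(2) refl])
    show "AE z in \<tau>. (\<lambda>n. cylinder_function (?u n) J E z) \<longlonglongrightarrow> indicator ?A z"
    proof (rule AE_I2)
      fix z assume z: "z \<in> space \<tau>"
      then have zY: "snd z \<in> space Y"
        unfolding sets_eq_imp_space_eq[OF \<tau>(2)] space_pair_measure by (simp only: mem_Times_iff)
      have cyl: "(\<forall>i\<in>J. snd z i \<in> E i) \<longleftrightarrow> snd z \<in> prod_emb UNIV (\<lambda>_. M) J (Pi\<^sub>E J E)"
        using zY by (auto simp: prod_emb_def space_PiM)
      show "(\<lambda>n. cylinder_function (?u n) J E z) \<longlonglongrightarrow> indicator ?A z"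
      proof (cases "fst z \<in> F")
        case True
        then have "cylinder_function (?u n) J E z = indicator ?A z" for n
          by (cases "snd z \<in> prod_emb UNIV (\<lambda>_. M) J (Pi\<^sub>E J E)")
            (use cyl in \<open>auto simp: cylinder_function_def indicator_def mem_Times_iff\<close>)
        then show ?thesis by simp
      next
        case False
        then have d: "infdist (fst z) F > 0"
          using F by (simp add: infdist_pos_not_in_closed)
        obtain n0 :: nat where n0: "1 / infdist (fst z) F < real n0" using reals_Archimedean2 by blast
        have "cylinder_function (?u n) J E z = 0" if "n \<ge> n0" for n
        proof -
          have "1 / infdist (fst z) F \<le> real n" using n0 that by linarith
          then have "1 \<le> real n * infdist (fst z) F" using d by (simp add: field_simps)
          then show ?thesis by (simp add: cylinder_function_def)
        qed
        then have "eventually (\<lambda>n. cylinder_function (?u n) J E z = 0) sequentially"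
          by (auto simp: eventually_sequentially)
        moreover have "indicator ?A z = (0::real)" using False by (auto simp: indicator_def)
        ultimately show ?thesis by (simp add: tendsto_eventually)
      qed
    qed
    show "AE z in \<tau>. norm (cylinder_function (?u n) J E z) \<le> 1" for n
      by (intro AE_I2) (auto simp: cylinder_function_def infdist_nonneg)
  qed simp
  then show ?thesis using A by simp
qed

text \<open>Closed sets are limits of continuous cutoffs, which the cylinder integrals can test.
  Products of closed sets and cylinders are stable under intersection and generate, so agreement on
  them suffices.\<close>

theorem skew_invariant_measure_unique:
  assumes \<tau>: "prob_space \<tau>" "sets \<tau> = sets (\<mu> \<Otimes>\<^sub>M Y)"
    "distr \<tau> \<tau> two_sided_skew = \<tau>" "distr \<tau> Y snd = Y"
  shows "\<tau> = \<mu> \<Otimes>\<^sub>M Y"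
proof -
  interpret Y: prob_space Y by (rule prob_space_Y)
  interpret \<mu>Y: pair_prob_space \<mu> Y ..
  interpret \<tau>: prob_space \<tau> by fact
  have sets_eq: "sets (\<mu> \<Otimes>\<^sub>M Y) = sets (borel \<Otimes>\<^sub>M Y)"
    by (rule sets_pair_measure_cong[OF sets_\<mu> refl])
  let ?C = "prod_algebra (UNIV :: int set) (\<lambda>_. M)"
  let ?G = "{a \<times> b |a b. a \<in> {F :: 'x set. closed F} \<and> b \<in> ?C}"
  have gen: "sets (borel \<Otimes>\<^sub>M Y) = sigma_sets (UNIV \<times> space Y) ?G"
  proof -
    have "sets (borel \<Otimes>\<^sub>M Y) = sets (sigma (space borel \<times> space Y) ?G)"
    proof (rule sets_pair_eq)
      show "sets borel = sigma_sets (space borel) {F :: 'x set. closed F}"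
        by (subst borel_eq_closed) simp
      show "sets Y = sigma_sets (space Y) ?C" by (simp add: sets_PiM space_PiM)
      show "?C \<subseteq> Pow (space Y)" using prod_algebra_sets_into_space[of UNIV "\<lambda>_. M"] by (simp add: space_PiM)
      show "{UNIV} \<subseteq> {F :: 'x set. closed F}" "{space Y} \<subseteq> ?C"
        using space_in_prod_algebra[of UNIV "\<lambda>_. M"] by (simp_all add: space_PiM)
    qed auto
    also have "\<dots> = sigma_sets (UNIV \<times> space Y) ?G"
      using prod_algebra_sets_into_space[of UNIV "\<lambda>_. M"]
      by (subst sets_measure_of) (auto simp: space_PiM)
    finally show ?thesis .
  qed
  have snd_Y: "distr (\<mu> \<Otimes>\<^sub>M Y) Y snd = Y"
  proof (rule measure_eqI)
    fix B assume "B \<in> sets (distr (\<mu> \<Otimes>\<^sub>M Y) Y snd)"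
    then have B: "B \<in> sets Y" by simp
    have "snd -` B \<inter> space (\<mu> \<Otimes>\<^sub>M Y) = space \<mu> \<times> B"
      using sets.sets_into_space[OF B] unfolding space_pair_measure by auto
    then show "emeasure (distr (\<mu> \<Otimes>\<^sub>M Y) Y snd) B = emeasure Y B"
      using B by (simp only: emeasure_distr[OF measurable_snd B] Y.emeasure_pair_measure_Times[OF sets.top B]
          \<mu>p.emeasure_space_1 mult_1)
  qed simp
  show ?thesis
  proof (rule measure_eqI_generator_eq[where E="?G" and \<Omega>="UNIV \<times> space Y" and A="\<lambda>_::nat. UNIV \<times> space Y"])
    show "Int_stable ?G"
      unfolding Int_stable_def
    proof safe
      fix a c :: "'x set" and b d assume *: "closed a" "b \<in> ?C" "closed c" "d \<in> ?C"
      have "b \<inter> d \<in> ?C" using Int_stable_prod_algebra * by (auto simp: Int_stable_def)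
      then show "\<exists>aa ba. a \<times> b \<inter> c \<times> d = aa \<times> ba \<and> aa \<in> {F. closed F} \<and> ba \<in> ?C"
        using * by (intro exI[of _ "a \<inter> c"] exI[of _ "b \<inter> d"]) auto
    qed
    show "?G \<subseteq> Pow (UNIV \<times> space Y)"
      using prod_algebra_sets_into_space[of UNIV "\<lambda>_. M"] by (auto simp: space_PiM)
    show "sets \<tau> = sigma_sets (UNIV \<times> space Y) ?G" "sets (\<mu> \<Otimes>\<^sub>M Y) = sigma_sets (UNIV \<times> space Y) ?G"
      using \<tau>(2) sets_eq gen by simp_all
    show "range (\<lambda>_::nat. UNIV \<times> space Y) \<subseteq> ?G"
      using space_in_prod_algebra[of UNIV "\<lambda>_. M"] by (auto simp: space_PiM)
    fix X assume "X \<in> ?G"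
    then obtain F b where X: "X = F \<times> b" "closed F" "b \<in> ?C" by auto
    from X(3) obtain J E where b: "b = prod_emb UNIV (\<lambda>_. M) J (Pi\<^sub>E J E)"
      "finite J" "\<forall>i\<in>J. E i \<in> sets M" unfolding prod_algebra_def by auto
    then have E: "\<And>i. i \<in> J \<Longrightarrow> E i \<subseteq> space M" by (simp add: sets_symbols)
    show "emeasure \<tau> X = emeasure (\<mu> \<Otimes>\<^sub>M Y) X"
    proof (cases "F = {}")
      case False
      let ?I = "\<lambda>N n. \<integral>z. cylinder_function (\<lambda>x. max 0 (1 - real n * infdist x F)) J E z \<partial>N"
      have "?I \<tau> n = ?I (\<mu> \<Otimes>\<^sub>M Y) n" for n
      proof -
        have u: "continuous_on UNIV (\<lambda>x. max 0 (1 - real n * infdist x F))"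
          by (intro continuous_intros)
        from cylinder_integral[OF u b(2) E]
        obtain c where c: "\<forall>\<tau>. prob_space \<tau> \<longrightarrow> sets \<tau> = sets (borel \<Otimes>\<^sub>M Y) \<longrightarrow>
          distr \<tau> \<tau> two_sided_skew = \<tau> \<longrightarrow> distr \<tau> Y snd = Y \<longrightarrow> ?I \<tau> n = c" ..
        have "?I \<tau> n = c"
          using c[rule_format, OF \<tau>(1) trans[OF \<tau>(2) sets_eq] \<tau>(3,4)] .
        moreover have "?I (\<mu> \<Otimes>\<^sub>M Y) n = c"
          using c[rule_format, OF \<mu>Y.P.prob_space_axioms sets_eq product_two_sided_skew_invariant snd_Y] .
        ultimately show ?thesis by (simp only:)
      qed
      then have "measure \<tau> X = measure (\<mu> \<Otimes>\<^sub>M Y) X"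
        using LIMSEQ_unique[OF measure_closed_cylinder[OF \<tau>(1) trans[OF \<tau>(2) sets_eq] X(2) False b(2) E]]
          measure_closed_cylinder[OF \<mu>Y.P.prob_space_axioms sets_eq X(2) False b(2) E]
        unfolding X(1) b(1) by (simp only:)
      then show ?thesis by (simp add: \<tau>.emeasure_eq_measure \<mu>Y.P.emeasure_eq_measure)
    qed (simp add: X)
  qed (auto simp: \<tau>.emeasure_eq_measure)
qed

end

section \<open>The Bernoulli skew product\<close>

lemma prob_space_symbol_measure:
  assumes "\<And>n. n \<ge> 1 \<Longrightarrow> p n > 0" and "(p has_sum 1) {1..}"
  shows "prob_space (symbol_measure p)"
proof (rule prob_spaceI)
  let ?f = "\<lambda>s. case s of None \<Rightarrow> 0 | Some n \<Rightarrow> ennreal (p n)"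
  \<comment> \<open>\<open>q\<close> extends \<open>p\<close> by 0 at the index 0, which is not a
    symbol, so that a series over all naturals can be used.\<close>
  define q where "q n = (if n \<ge> 1 then p n else 0)" for n :: nat
  have q0: "0 \<le> q n" for n using assms(1)[of n] by (simp add: q_def less_imp_le)
  have "(q has_sum 1) UNIV \<longleftrightarrow> (p has_sum 1) {1..}"
    by (rule has_sum_cong_neutral) (auto simp: q_def)
  then have q: "q sums 1" using assms(2) by (simp add: has_sum_imp_sums)
  have "emeasure (symbol_measure p) (space (symbol_measure p)) =
      (\<integral>\<^sup>+s. ?f s * indicator (topspace Ntilde) s \<partial>count_space (topspace Ntilde))"
    unfolding symbol_measure_def point_measure_def by (subst emeasure_density) simp_all
  also have "\<dots> = (\<integral>\<^sup>+s. (case s of None \<Rightarrow> 0 | Some n \<Rightarrow> ennreal (q n)) \<partial>count_space (topspace Ntilde))"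
    by (rule nn_integral_cong) (auto simp: q_def)
  \<comment> \<open>The domain loses \<open>None\<close> and gains \<open>Some 0\<close>, both of
    weight 0.\<close>
  also have "\<dots> = (\<integral>\<^sup>+s. (case s of None \<Rightarrow> 0 | Some n \<Rightarrow> ennreal (q n)) \<partial>count_space (range Some))"
    by (rule nn_integral_count_space_eq) (auto simp: q_def)
  also have "\<dots> = (\<integral>\<^sup>+n. ennreal (q n) \<partial>count_space UNIV)"
    by (subst nn_integral_bij_count_space[of Some UNIV "range Some", symmetric]) (auto simp: bij_betw_def)
  also have "\<dots> = (\<Sum>n. ennreal (q n))" by (rule nn_integral_count_space_nat)
  also have "\<dots> = 1" using q q0 by (simp add: suminf_ennreal2 sums_iff)
  finally show "emeasure (symbol_measure p) (space (symbol_measure p)) = 1" .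
qed

lemma measure_symbol_pos:
  assumes "p n > 0" "n \<ge> 1" "prob_space (symbol_measure p)"
  shows "measure (symbol_measure p) {Some n} > 0"
proof -
  interpret prob_space "symbol_measure p" by fact
  have "{s \<in> {Some n}. 0 < (case s of None \<Rightarrow> 0 | Some n \<Rightarrow> ennreal (p n))} = {Some n}"
    using assms(1) by auto
  then have "emeasure (symbol_measure p) {Some n} = ennreal (p n)"
    using assms(2) unfolding symbol_measure_def
    by (subst emeasure_point_measure) auto
  then show ?thesis using assms(1) by (simp add: measure_def)
qed

context compact_action
begin

text \<open>Concatenation of words corresponds to the product in the group: \<open>foldr\<close>
  lets the last letter act first, as composition does.\<close>

lemma semigroup_generate_foldr:
  assumes "g \<in> semigroup_generate G (\<Phi> ` {1..})" "\<And>n. n \<ge> 1 \<Longrightarrow> \<Phi> n \<in> carrier G"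
  shows "g \<in> carrier G \<and> (\<exists>w\<in>lists (Some ` {1..}).
    \<forall>x. foldr (\<lambda>s. case s of None \<Rightarrow> id | Some n \<Rightarrow> \<phi> (\<Phi> n)) w x = \<phi> g x)"
  using assms(1)
proof induction
  case (incl g)
  then obtain n where n: "g = \<Phi> n" "n \<ge> 1" by auto
  then show ?case using assms(2) by (intro conjI bexI[of _ "[Some n]"]) auto
next
  case (mult g h)
  obtain v where v: "v \<in> lists (Some ` {1..})"
    "\<And>x. foldr (\<lambda>s. case s of None \<Rightarrow> id | Some n \<Rightarrow> \<phi> (\<Phi> n)) v x = \<phi> g x" using mult.IH(1) by blast
  obtain w where w: "w \<in> lists (Some ` {1..})"
    "\<And>x. foldr (\<lambda>s. case s of None \<Rightarrow> id | Some n \<Rightarrow> \<phi> (\<Phi> n)) w x = \<phi> h x" using mult.IH(2) by blast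
  have gh: "g \<in> carrier G" "h \<in> carrier G" using mult.IH by auto
  show ?case
  proof (intro conjI bexI[of _ "v @ w"] allI)
    show "g \<otimes>\<^bsub>G\<^esub> h \<in> carrier G" using gh group by (simp add: group.is_monoid monoid.m_closed)
    show "foldr (\<lambda>s. case s of None \<Rightarrow> id | Some n \<Rightarrow> \<phi> (\<Phi> n)) (v @ w) x = \<phi> (g \<otimes>\<^bsub>G\<^esub> h) x" for x
      by (simp only: foldr_append o_apply v(2) w(2) act_mult[OF gh])
    show "v @ w \<in> lists (Some ` {1..})" using v w by simp
  qed
qed

end

theorem theorem2p1:
  fixes G :: "('g, 'm) monoid_scheme"
    and T :: "'g topology"
    and \<phi> :: "'g \<Rightarrow> 'x::metric_space \<Rightarrow> 'x"
    and \<mu> :: "'x measure"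
    and \<Phi> :: "nat \<Rightarrow> 'g"
    and p :: "nat \<Rightarrow> real"
    and \<tau> :: "('x \<times> (int \<Rightarrow> nat option)) measure"
  assumes "locally_compact_group G T" and "separable_space T" and "amenable G T"
    and "compact (UNIV :: 'x set)"
    and "prob_space \<mu>" and "sets \<mu> = sets borel"
    and "continuous_group_action G T \<phi>"
    and "invariant_measure G \<phi> \<mu>"
    and "uniquely_ergodic_for G \<phi> \<mu>"
    and "\<not> sensitive_on G \<phi> (measure_support \<mu>)"
    and "\<And>n. n \<ge> 1 \<Longrightarrow> \<Phi> n \<in> carrier G"
    and "T closure_of (semigroup_generate G (\<Phi> ` {1..})) = carrier G"
    and "\<And>n. n \<ge> 1 \<Longrightarrow> p n > 0" and "(p has_sum 1) {1..}"
    and "prob_space \<tau>" and "sets \<tau> = sets (borel_of (prod_topology euclidean Y_top))"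
    and "distr \<tau> \<tau> (skew_product \<phi> \<Phi>) = \<tau>"
    and "distr \<tau> (borel_of Y_top) snd = bernoulli_measure p"
  shows "\<tau> = \<mu> \<Otimes>\<^sub>M bernoulli_measure p"
proof -
  interpret A: nonsensitive_action G T \<phi> \<mu>
    using assms(1,3,4,7,9,10) by unfold_locales (simp_all add: locally_compact_group_def)
  \<comment> \<open>The point at infinity acts as the identity, in line with the convention for its
    homeomorphism.\<close>
  let ?act = "\<lambda>s. case s of None \<Rightarrow> id | Some n \<Rightarrow> \<phi> (\<Phi> n)"
  have M: "prob_space (symbol_measure p)"
    by (rule prob_space_symbol_measure[OF assms(13,14)])
  have act_cases: "?act s = id \<or> (\<exists>n\<ge>1. ?act s = \<phi> (\<Phi> n))" if "s \<in> space (symbol_measure p)" for s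
    using that by auto
  have id_distr: "distr \<mu> borel id = \<mu>"
  proof -
    have "distr \<mu> borel id = distr \<mu> \<mu> (\<lambda>x. x)" by (rule distr_cong) (simp_all add: assms(6))
    then show ?thesis by simp
  qed
  have phi_distr: "distr \<mu> borel (\<phi> g) = \<mu>" if "g \<in> carrier G" for g
  proof -
    have "distr \<mu> borel (\<phi> g) = distr \<mu> \<mu> (\<phi> g)" by (rule distr_cong) (simp_all add: assms(6))
    then show ?thesis using assms(8) that by (simp add: invariant_measure_def)
  qed
  interpret R: random_iteration "symbol_measure p" ?act \<mu> A.orbit_close
  proof (intro random_iteration.intro random_iteration_axioms.intro)
    show "sequence_space (symbol_measure p)"
      unfolding sequence_space_def using M
      by (intro product_prob_space.intro product_prob_space_axioms.intro product_sigma_finite.intro)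
        (simp_all add: prob_space_imp_sigma_finite)
    fix s assume s: "s \<in> space (symbol_measure p)"
    show "?act s \<in> borel_measurable borel"
      using act_cases[OF s] A.act_measurable assms(11) by auto
    show "distr \<mu> borel (?act s) = \<mu>"
      using act_cases[OF s] id_distr phi_distr assms(11) by auto
    show "A.orbit_close e (?act s x) (?act s y)" if "A.orbit_close e x y" for e x y
      using act_cases[OF s] A.orbit_close_act[OF that] that assms(11) by auto
  next
    fix e :: real assume e: "e > 0"
    obtain D where "finite D" "\<And>x. \<exists>y\<in>D. A.orbit_close e y x" by (rule A.orbit_close_net[OF e]) blast
    then show "\<exists>D. finite D \<and> (\<forall>x. \<exists>y\<in>D. A.orbit_close e y x)" by blast
  next
    fix e :: real assume e: "e > 0"
    let ?W = "semigroup_generate G (\<Phi> ` {1..})"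
    have W: "g \<in> carrier G \<and> (\<exists>w\<in>lists (Some ` {1..}). \<forall>x. foldr ?act w x = \<phi> g x)" if "g \<in> ?W" for g
      using that assms(11) by (rule A.semigroup_generate_foldr)
    then have "?W \<subseteq> carrier G" by blast
    obtain V where V: "finite V" "V \<subseteq> ?W" "\<And>x y. \<exists>w\<in>V. A.orbit_close e (\<phi> w x) y"
      by (rule A.dense_subset_finitely_transitive[OF e assms(12) \<open>?W \<subseteq> carrier G\<close>]) blast
    have "\<forall>g\<in>V. \<exists>w. w \<in> lists (Some ` {1..}) \<and> (\<forall>x. foldr ?act w x = \<phi> g x)"
      using W V(2) by blast
    then obtain word where word: "\<forall>g\<in>V. word g \<in> lists (Some ` {1..}) \<and> (\<forall>x. foldr ?act (word g) x = \<phi> g x)"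
      by metis
    \<comment> \<open>Words consist of integers, which carry positive mass; the point at infinity
      has mass 0 and cannot be a letter.\<close>
    have "Some ` {1..} \<subseteq> {s \<in> space (symbol_measure p). measure (symbol_measure p) {s} > 0}"
      using measure_symbol_pos[OF assms(13) _ M] by auto
    note lists_sub = lists_mono[OF this]
    have "word ` V \<subseteq> lists {s \<in> space (symbol_measure p). measure (symbol_measure p) {s} > 0}"
    proof (rule image_subsetI)
      fix g assume "g \<in> V"
      then show "word g \<in> lists {s \<in> space (symbol_measure p). measure (symbol_measure p) {s} > 0}"
        using word by (intro subsetD[OF lists_sub]) (elim ballE conjE, assumption, simp)
    qed
    moreover have "\<exists>w\<in>word ` V. A.orbit_close e (foldr ?act w x) y" for x y
    proof -
      obtain g where "g \<in> V" "A.orbit_close e (\<phi> g x) y" using V(3) by blast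
      then show ?thesis using word by (intro bexI[of _ "word g"]) auto
    qed
    ultimately show "\<exists>V. finite V \<and> V \<subseteq> lists {s \<in> space (symbol_measure p). measure (symbol_measure p) {s} > 0} \<and>
        (\<forall>x y. \<exists>w\<in>V. A.orbit_close e (foldr ?act w x) y)"
      using V(1) by (intro exI[of _ "word ` V"]) simp
  qed (use assms A.orbit_close_dist in auto)
  have skew: "skew_product \<phi> \<Phi> = R.two_sided_skew"
    by (auto simp: skew_product_def R.two_sided_skew_def fun_eq_iff split: option.splits)
  have "sets \<tau> = sets (\<mu> \<Otimes>\<^sub>M bernoulli_measure p)"
    using assms(16) sets_pair_bernoulli_measure[OF assms(4,6)] by simp
  \<comment> \<open>The marginal is given on the Borel sets of \<open>Y_top\<close>, which are the
    sets of the product sigma-algebra.\<close>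
  moreover have "distr \<tau> (bernoulli_measure p) snd = distr \<tau> (borel_of Y_top) snd"
    by (rule distr_cong) (simp_all add: sets_bernoulli_measure)
  ultimately show ?thesis
    using R.skew_invariant_measure_unique[OF assms(15)] assms(17,18)
    unfolding skew bernoulli_measure_def by simp
qed

end
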